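(* Let $G$ be one of the groups $\operatorname{GL}_2(\mathbb{Z})$, $\operatorname{PGL}_2(\mathbb{Z})$, $\operatorname{SL}_2(\mathbb{Z})$, or $\operatorname{PSL}_2(\mathbb{Z})$. There is an algorithm which, given matrices $h_1,\ldots,h_s;g\in G$, decides whether $g$ is algebraic over the subgroup $H=\langle h_1,\ldots,h_s\rangle\leqslant G$; moreover, in the affirmative case, the algorithm computes finitely many $H$-equations $w_1(x),\ldots,w_p(x)\in I_H(g)\lhd H*\langle x\rangle$ further satisfying that any $w(x)\in H*\langle x\rangle$ with $w(g)=1$ is a product of conjugates of $w_1(x),\ldots,w_p(x)$.
   Context: For a group $G$, a subgroup $H\leqslant G$ and an element $g\in G$, let $H*\langle x\rangle$ be the free product of $H$ with the infinite cyclic group generated by a variable $x$. Elements $w(x)\in H*\langle x\rangle$ are called $H$-equations; $w(g)\in G$ denotes the image of $w(x)$ under the homomorphism $H*\langle x\rangle\to G$ that is the inclusion on $H$ and sends $x\mapsto g$. The ideal of $g$ over $H$ is the normal subgroup $I_H(g)=\{w(x)\in H*\langle x\rangle\mid w(g)=1\}$ of $H*\langle x\rangle$. The element $g$ is algebraic over $H$ if there is a non-trivial $w(x)\in H*\langle x\rangle$ with $w(g)=1$, i.e. if $I_H(g)\neq\{1\}$. "Product of conjugates of $w_1(x),\ldots,w_p(x)$" means a product of conjugates, in $H*\langle x\rangle$, of the elements $w_i(x)^{\pm1}$; i.e., $w_1(x),\ldots,w_p(x)$ generate $I_H(g)$ as a normal subgroup of $H*\langle x\rangle$. $\operatorname{GL}_2(\mathbb{Z})$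 is the group of invertible $2\times 2$ matrices over the integers, $\operatorname{SL}_2(\mathbb{Z})$ its subgroup of determinant $1$ matrices, and $\operatorname{PGL}_2(\mathbb{Z})$, $\operatorname{PSL}_2(\mathbb{Z})$ their respective quotients by $\{\pm I\}$; elements of these quotients are represented by integral matrices. *)

theory Defs
  imports
    "HOL-Analysis.Determinants"
    "HOL-Algebra.Elementary_Groups"
    "HOL-Library.Nat_Bijection"
begin

section \<open>Free products and equations over a subgroup\<close>

text \<open>
  The free product of \<open>A\<close> and \<open>B\<close> is the set of words over the disjoint union of the two
  carriers modulo the congruence generated by multiplying adjacent letters of the same factor
  and deleting the two neutral letters.
\<close>

inductive_set fp_step ::
  "('a, 'm) monoid_scheme \<Rightarrow> ('b, 'n) monoid_scheme \<Rightarrow> (('a + 'b) list \<times> ('a + 'b) list) set"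
  for A B
where
  mult_l: "\<lbrakk>us \<in> lists (carrier A <+> carrier B); vs \<in> lists (carrier A <+> carrier B);
            a \<in> carrier A; a' \<in> carrier A\<rbrakk>
    \<Longrightarrow> (us @ [Inl a, Inl a'] @ vs, us @ [Inl (a \<otimes>\<^bsub>A\<^esub> a')] @ vs) \<in> fp_step A B"
| mult_r: "\<lbrakk>us \<in> lists (carrier A <+> carrier B); vs \<in> lists (carrier A <+> carrier B);
            b \<in> carrier B; b' \<in> carrier B\<rbrakk>
    \<Longrightarrow> (us @ [Inr b, Inr b'] @ vs, us @ [Inr (b \<otimes>\<^bsub>B\<^esub> b')] @ vs) \<in> fp_step A B"
| one_l: "\<lbrakk>us \<in> lists (carrier A <+> carrier B); vs \<in> lists (carrier A <+> carrier B)\<rbrakk>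
    \<Longrightarrow> (us @ [Inl \<one>\<^bsub>A\<^esub>] @ vs, us @ vs) \<in> fp_step A B"
| one_r: "\<lbrakk>us \<in> lists (carrier A <+> carrier B); vs \<in> lists (carrier A <+> carrier B)\<rbrakk>
    \<Longrightarrow> (us @ [Inr \<one>\<^bsub>B\<^esub>] @ vs, us @ vs) \<in> fp_step A B"

definition fp_rel ::
  "('a, 'm) monoid_scheme \<Rightarrow> ('b, 'n) monoid_scheme \<Rightarrow> (('a + 'b) list \<times> ('a + 'b) list) set"
  where "fp_rel A B = Restr ((fp_step A B \<union> (fp_step A B)\<inverse>)\<^sup>*) (lists (carrier A <+> carrier B))"

definition free_product ::
  "('a, 'm) monoid_scheme \<Rightarrow> ('b, 'n) monoid_scheme \<Rightarrow> ('a + 'b) list set monoid"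
  where "free_product A B =
    \<lparr>carrier = lists (carrier A <+> carrier B) // fp_rel A B,
     monoid.mult = (\<lambda>P Q. \<Union>p\<in>P. \<Union>q\<in>Q. fp_rel A B `` {p @ q}),
     one = fp_rel A B `` {[]}\<rparr>"

text \<open>\<open>H * \<langle>x\<rangle>\<close>, where \<open>x\<close> is the generator \<open>1\<close> of the infinite cyclic group \<open>integer_group\<close>.\<close>

definition equations :: "('a, 'm) monoid_scheme \<Rightarrow> 'a set \<Rightarrow> ('a + int) list set monoid"
  where "equations G H = free_product (G\<lparr>carrier := H\<rparr>) integer_group"

definition const_eq :: "('a, 'm) monoid_scheme \<Rightarrow> 'a set \<Rightarrow> 'a \<Rightarrow> ('a + int) list set"
  where "const_eq G H h = fp_rel (G\<lparr>carrier := H\<rparr>) integer_group `` {[Inl h]}"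

definition var_pow :: "('a, 'm) monoid_scheme \<Rightarrow> 'a set \<Rightarrow> int \<Rightarrow> ('a + int) list set"
  where "var_pow G H k = fp_rel (G\<lparr>carrier := H\<rparr>) integer_group `` {[Inr k]}"

fun eval_word :: "('a, 'm) monoid_scheme \<Rightarrow> 'a \<Rightarrow> ('a + int) list \<Rightarrow> 'a"
where
  "eval_word G g [] = \<one>\<^bsub>G\<^esub>"
| "eval_word G g (Inl h # w) = h \<otimes>\<^bsub>G\<^esub> eval_word G g w"
| "eval_word G g (Inr k # w) = g [^]\<^bsub>G\<^esub> k \<otimes>\<^bsub>G\<^esub> eval_word G g w"

text \<open>
  \<open>eval_eq G g w\<close> is \<open>w(g)\<close>. All representatives of \<open>w\<close> have the same value; see
  \<open>eval_eq_hom\<close>, \<open>eval_eq_const\<close> and \<open>eval_eq_var\<close> below.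
\<close>

definition eval_eq :: "('a, 'm) monoid_scheme \<Rightarrow> 'a \<Rightarrow> ('a + int) list set \<Rightarrow> 'a"
  where "eval_eq G g w = the_elem (eval_word G g ` w)"

definition equation_ideal ::
  "('a, 'm) monoid_scheme \<Rightarrow> 'a set \<Rightarrow> 'a \<Rightarrow> ('a + int) list set set"
  where "equation_ideal G H g = kernel (equations G H) G (eval_eq G g)"

definition algebraic_over :: "('a, 'm) monoid_scheme \<Rightarrow> 'a set \<Rightarrow> 'a \<Rightarrow> bool"
  where "algebraic_over G H g \<longleftrightarrow>
    (\<exists>w \<in> carrier (equations G H). w \<noteq> \<one>\<^bsub>equations G H\<^esub> \<and> eval_eq G g w = \<one>\<^bsub>G\<^esub>)"

text \<open>The products of conjugates of the elements of \<open>W\<close> and their inverses.\<close>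

definition normal_closure :: "('a, 'm) monoid_scheme \<Rightarrow> 'a set \<Rightarrow> 'a set"
  where "normal_closure F W =
    generate F {u \<otimes>\<^bsub>F\<^esub> w \<otimes>\<^bsub>F\<^esub> inv\<^bsub>F\<^esub> u | u w. u \<in> carrier F \<and> w \<in> W}"


section \<open>Basic properties of these constructions\<close>

context
  fixes A :: "('a, 'm) monoid_scheme" and B :: "('b, 'n) monoid_scheme"
begin

private abbreviation "W \<equiv> lists (carrier A <+> carrier B)"

lemma fp_rel_equiv: "equiv W (fp_rel A B)"
proof (rule equivI)
  have "sym ((fp_step A B \<union> (fp_step A B)\<inverse>)\<^sup>*)"
    by (intro sym_rtrancl) (auto simp: sym_def)
  then show "sym (fp_rel A B)"
    unfolding fp_rel_def sym_def by blast
  show "trans (fp_rel A B)"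
    unfolding fp_rel_def trans_def by (auto intro: rtrancl_trans)
qed (auto simp: fp_rel_def refl_on_def)

lemma fp_step_append:
  assumes "(p, q) \<in> fp_step A B" "u \<in> W" "v \<in> W"
  shows "(u @ p @ v, u @ q @ v) \<in> fp_step A B"
  using assms(1)
proof cases
  case (mult_l us vs a a')
  then show ?thesis
    using fp_step.mult_l[of "u @ us" A B "vs @ v" a a'] assms(2,3) by simp
next
  case (mult_r us vs b b')
  then show ?thesis
    using fp_step.mult_r[of "u @ us" A B "vs @ v" b b'] assms(2,3) by simp
next
  case (one_l us vs)
  then show ?thesis
    using fp_step.one_l[of "u @ us" A B "vs @ v"] assms(2,3) by simp
next
  case (one_r us vs)
  then show ?thesis
    using fp_step.one_r[of "u @ us" A B "vs @ v"] assms(2,3) by simp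
qed

lemma fp_rel_append:
  assumes "(p, p') \<in> fp_rel A B" "(q, q') \<in> fp_rel A B"
  shows "(p @ q, p' @ q') \<in> fp_rel A B"
proof -
  let ?S = "fp_step A B \<union> (fp_step A B)\<inverse>"
  have *: "(u @ p @ v, u @ q @ v) \<in> ?S\<^sup>*" if "(p, q) \<in> ?S\<^sup>*" "u \<in> W" "v \<in> W" for p q u v
    using that(1)
  proof induction
    case (step y z)
    then have "(u @ y @ v, u @ z @ v) \<in> ?S"
      using fp_step_append[of y z u v] fp_step_append[of z y u v] that(2,3) by auto
    with step.IH show ?case by (rule rtrancl_into_rtrancl)
  qed simp
  have W: "p \<in> W" "p' \<in> W" "q \<in> W" "q' \<in> W"
    and R: "(p, p') \<in> ?S\<^sup>*" "(q, q') \<in> ?S\<^sup>*"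
    using assms unfolding fp_rel_def by auto
  have "(p @ q, p' @ q) \<in> ?S\<^sup>*" using *[OF R(1), of "[]" q] W by simp
  moreover have "(p' @ q, p' @ q') \<in> ?S\<^sup>*" using *[OF R(2), of p' "[]"] W by simp
  ultimately show ?thesis using W unfolding fp_rel_def by auto
qed

lemma free_product_carrier: "carrier (free_product A B) = W // fp_rel A B"
  and free_product_one: "\<one>\<^bsub>free_product A B\<^esub> = fp_rel A B `` {[]}"
  by (simp_all add: free_product_def)

lemma free_product_mult:
  assumes "p \<in> W" "q \<in> W"
  shows "fp_rel A B `` {p} \<otimes>\<^bsub>free_product A B\<^esub> fp_rel A B `` {q} = fp_rel A B `` {p @ q}"
proof -
  have "fp_rel A B `` {p' @ q'} = fp_rel A B `` {p @ q}"
    if "p' \<in> fp_rel A B `` {p}" "q' \<in> fp_rel A B `` {q}" for p' q'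
    using that fp_rel_append[of p p' q q'] equiv_class_eq[OF fp_rel_equiv] by blast
  moreover have "p \<in> fp_rel A B `` {p}" "q \<in> fp_rel A B `` {q}"
    using assms equiv_class_self[OF fp_rel_equiv] by blast+
  ultimately have "(\<Union>p'\<in>fp_rel A B `` {p}. \<Union>q'\<in>fp_rel A B `` {q}. fp_rel A B `` {p' @ q'})
      = fp_rel A B `` {p @ q}"
    by (intro equalityI UN_least) blast+
  then show ?thesis by (simp add: free_product_def)
qed

lemma free_product_group:
  assumes "group A" "group B"
  shows "group (free_product A B)"
proof -
  interpret A: group A by fact
  interpret B: group B by fact
  let ?R = "fp_rel A B" and ?F = "free_product A B"
  have cls: "\<exists>p\<in>W. X = ?R `` {p}" if "X \<in> carrier ?F" for X
    using that unfolding free_product_carrier by (auto elim!: quotientE)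
  have clsI: "?R `` {p} \<in> carrier ?F" if "p \<in> W" for p
    using that unfolding free_product_carrier by (rule quotientI)
  have nil: "[] \<in> W" by simp
  have inv_ex: "\<exists>q\<in>W. (q @ p, []) \<in> ?R" if "p \<in> W" for p
    using that
  proof (induction p)
    case Nil
    then show ?case by (auto intro!: bexI[of _ "[]"] simp: fp_rel_def)
  next
    case (Cons c p)
    then obtain q where q: "q \<in> W" "(q @ p, []) \<in> ?R" by blast
    from Cons have p: "p \<in> W" by simp
    obtain c' where c': "c' \<in> carrier A <+> carrier B" "(q @ [c', c] @ p, q @ p) \<in> ?R"
    proof (cases c)
      case (Inl a)
      with Cons have a: "a \<in> carrier A" by auto
      have "(q @ [Inl (inv\<^bsub>A\<^esub> a), Inl a] @ p, q @ [Inl \<one>\<^bsub>A\<^esub>] @ p) \<in> fp_step A B"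
        using fp_step.mult_l[OF q(1) p, of "inv\<^bsub>A\<^esub> a" a] a by simp
      moreover have "(q @ [Inl \<one>\<^bsub>A\<^esub>] @ p, q @ p) \<in> fp_step A B"
        by (rule fp_step.one_l[OF q(1) p])
      ultimately have "(q @ [Inl (inv\<^bsub>A\<^esub> a), Inl a] @ p, q @ p)
          \<in> (fp_step A B \<union> (fp_step A B)\<inverse>)\<^sup>*"
        by (meson UnI1 r_into_rtrancl rtrancl_into_rtrancl)
      then have "(q @ [Inl (inv\<^bsub>A\<^esub> a), Inl a] @ p, q @ p) \<in> ?R"
        unfolding fp_rel_def using a q(1) p by auto
      with a Inl that[of "Inl (inv\<^bsub>A\<^esub> a)"] show ?thesis by auto
    next
      case (Inr b)
      with Cons have b: "b \<in> carrier B" by auto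
      have "(q @ [Inr (inv\<^bsub>B\<^esub> b), Inr b] @ p, q @ [Inr \<one>\<^bsub>B\<^esub>] @ p) \<in> fp_step A B"
        using fp_step.mult_r[OF q(1) p, of "inv\<^bsub>B\<^esub> b" b] b by simp
      moreover have "(q @ [Inr \<one>\<^bsub>B\<^esub>] @ p, q @ p) \<in> fp_step A B"
        by (rule fp_step.one_r[OF q(1) p])
      ultimately have "(q @ [Inr (inv\<^bsub>B\<^esub> b), Inr b] @ p, q @ p)
          \<in> (fp_step A B \<union> (fp_step A B)\<inverse>)\<^sup>*"
        by (meson UnI1 r_into_rtrancl rtrancl_into_rtrancl)
      then have "(q @ [Inr (inv\<^bsub>B\<^esub> b), Inr b] @ p, q @ p) \<in> ?R"
        unfolding fp_rel_def using b q(1) p by auto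
      with b Inr that[of "Inr (inv\<^bsub>B\<^esub> b)"] show ?thesis by auto
    qed
    have "((q @ [c']) @ c # p, []) \<in> ?R"
      using c'(2) q(2) equivE[OF fp_rel_equiv] by (auto elim: transE)
    moreover have "q @ [c'] \<in> W" using q(1) c'(1) by simp
    ultimately show ?case by blast
  qed
  show ?thesis
  proof (rule groupI)
    fix X Y assume "X \<in> carrier ?F" "Y \<in> carrier ?F"
    then obtain p q where "p \<in> W" "X = ?R `` {p}" "q \<in> W" "Y = ?R `` {q}"
      using cls by meson
    then show "X \<otimes>\<^bsub>?F\<^esub> Y \<in> carrier ?F"
      by (simp add: free_product_mult clsI)
  next
    show "\<one>\<^bsub>?F\<^esub> \<in> carrier ?F" unfolding free_product_one by (rule clsI) simp
  next
    fix X Y Z assume "X \<in> carrier ?F" "Y \<in> carrier ?F" "Z \<in> carrier ?F"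
    then obtain p q r where "p \<in> W" "X = ?R `` {p}" "q \<in> W" "Y = ?R `` {q}"
      "r \<in> W" "Z = ?R `` {r}"
      using cls by meson
    moreover from this have "p @ q \<in> W" "q @ r \<in> W" by simp_all
    ultimately show "X \<otimes>\<^bsub>?F\<^esub> Y \<otimes>\<^bsub>?F\<^esub> Z = X \<otimes>\<^bsub>?F\<^esub> (Y \<otimes>\<^bsub>?F\<^esub> Z)"
      by (simp add: free_product_mult del: append_in_lists_conv)
  next
    fix X assume "X \<in> carrier ?F"
    then obtain p where p: "p \<in> W" "X = ?R `` {p}" using cls by meson
    then show "\<one>\<^bsub>?F\<^esub> \<otimes>\<^bsub>?F\<^esub> X = X"
      using free_product_mult[OF nil p(1)] by (simp add: free_product_one)
    obtain q where q: "q \<in> W" "(q @ p, []) \<in> ?R" using inv_ex[OF p(1)] by blast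
    have "?R `` {q} \<otimes>\<^bsub>?F\<^esub> X = \<one>\<^bsub>?F\<^esub>"
      using free_product_mult[OF q(1) p(1)] equiv_class_eq[OF fp_rel_equiv q(2)] p(2)
      by (simp add: free_product_one)
    with clsI[OF q(1)] show "\<exists>Y\<in>carrier ?F. Y \<otimes>\<^bsub>?F\<^esub> X = \<one>\<^bsub>?F\<^esub>" by blast
  qed
qed

end

context
  fixes G :: "('a, 'm) monoid_scheme" (structure) and H :: "'a set" and g :: 'a
  assumes G: "group G" and H: "subgroup H G" and g: "g \<in> carrier G"
begin

interpretation group G by (fact G)

private abbreviation "EW \<equiv> lists (H <+> (UNIV :: int set))"
private abbreviation "ER \<equiv> fp_rel (G\<lparr>carrier := H\<rparr>) integer_group"

lemma equations_group: "group (equations G H)"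
  unfolding equations_def
  by (rule free_product_group[OF subgroup_imp_group[OF H] group_integer_group])

private lemma letter_simps [simp]:
  "Inl h \<in> H <+> (UNIV :: int set) \<longleftrightarrow> h \<in> H" "Inr k \<in> H <+> (UNIV :: int set)"
  by auto

private lemma EW_induct [consumes 1, case_names Nil Inl Inr]:
  assumes "u \<in> EW" "P []"
    "\<And>h u. h \<in> H \<Longrightarrow> u \<in> EW \<Longrightarrow> P u \<Longrightarrow> P (Inl h # u)"
    "\<And>k u. u \<in> EW \<Longrightarrow> P u \<Longrightarrow> P (Inr k # u)"
  shows "P u"
  using assms(1)
proof (induction u)
  case (Cons c u)
  then show ?case using assms(3,4) by (cases c) auto
qed (rule assms(2))

private lemma eval_word_closed: "u \<in> EW \<Longrightarrow> eval_word G g u \<in> carrier G"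
  by (induction u rule: EW_induct) (auto intro: g subgroup.mem_carrier[OF H])

private lemma eval_word_append:
  assumes "u \<in> EW" "v \<in> EW"
  shows "eval_word G g (u @ v) = eval_word G g u \<otimes> eval_word G g v"
  using assms(1)
  by (induction u rule: EW_induct)
    (simp_all add: assms(2) eval_word_closed g subgroup.mem_carrier[OF H] m_assoc)

private lemma eval_word_step:
  assumes "(u, v) \<in> fp_step (G\<lparr>carrier := H\<rparr>) integer_group"
  shows "eval_word G g u = eval_word G g v"
  using assms
proof cases
  case (mult_l us vs a a')
  then show ?thesis
    using subgroup.m_closed[OF H, of a a']
    by (simp add: eval_word_append eval_word_closed subgroup.mem_carrier[OF H] m_assoc)
next
  case (mult_r us vs k l)
  then show ?thesis
    by (simp add: eval_word_append eval_word_closed g m_assoc int_pow_mult)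
next
  case (one_l us vs)
  then show ?thesis
    using subgroup.one_closed[OF H]
    by (simp add: eval_word_append eval_word_closed)
next
  case (one_r us vs)
  then show ?thesis
    by (simp add: eval_word_append eval_word_closed)
qed

private lemma eval_word_rel:
  assumes "(u, v) \<in> ER"
  shows "eval_word G g u = eval_word G g v"
proof -
  have "(u, v) \<in> (fp_step (G\<lparr>carrier := H\<rparr>) integer_group
      \<union> (fp_step (G\<lparr>carrier := H\<rparr>) integer_group)\<inverse>)\<^sup>*"
    using assms unfolding fp_rel_def by blast
  then show ?thesis
    by induction (auto dest: eval_word_step)
qed

private lemma eval_eq_class:
  assumes "u \<in> EW"
  shows "eval_eq G g (ER `` {u}) = eval_word G g u"
proof -
  have "u \<in> ER `` {u}"
    using assms equiv_class_self[OF fp_rel_equiv, of u "G\<lparr>carrier := H\<rparr>" integer_group] by simp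
  moreover have "eval_word G g v = eval_word G g u" if "v \<in> ER `` {u}" for v
    using eval_word_rel[of u v] that by (metis Image_singleton_iff)
  ultimately have "eval_word G g ` (ER `` {u}) = {eval_word G g u}"
    by blast
  then show ?thesis unfolding eval_eq_def by simp
qed

lemma eval_eq_hom: "eval_eq G g \<in> hom (equations G H) G"
proof (rule homI)
  fix X assume "X \<in> carrier (equations G H)"
  then obtain u where "u \<in> EW" "X = ER `` {u}"
    unfolding equations_def free_product_carrier by (auto elim!: quotientE)
  then show "eval_eq G g X \<in> carrier G"
    using eval_eq_class eval_word_closed by metis
next
  fix X Y assume "X \<in> carrier (equations G H)" "Y \<in> carrier (equations G H)"
  then obtain u v where uv: "u \<in> EW" "X = ER `` {u}" "v \<in> EW" "Y = ER `` {v}"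
    unfolding equations_def free_product_carrier by (auto elim!: quotientE)
  then have "X \<otimes>\<^bsub>equations G H\<^esub> Y = ER `` {u @ v}"
    unfolding equations_def
    using free_product_mult[of u "G\<lparr>carrier := H\<rparr>" integer_group v] by simp
  moreover have "u @ v \<in> EW" using uv by simp
  ultimately show "eval_eq G g (X \<otimes>\<^bsub>equations G H\<^esub> Y) = eval_eq G g X \<otimes> eval_eq G g Y"
    using uv eval_eq_class eval_word_append by metis
qed

lemma eval_eq_const: "h \<in> H \<Longrightarrow> eval_eq G g (const_eq G H h) = h"
  unfolding const_eq_def using eval_eq_class[of "[Inl h]"] subgroup.mem_carrier[OF H, of h]
  by simp

lemma eval_eq_var: "eval_eq G g (var_pow G H k) = g [^] k"
  unfolding var_pow_def using eval_eq_class[of "[Inr k]"] g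
  by simp

end


section \<open>The four groups\<close>

definition GL2Z :: "(int^2^2) monoid"
  where "GL2Z = \<lparr>carrier = {A. invertible A}, monoid.mult = (**), one = mat 1\<rparr>"

definition SL2Z :: "(int^2^2) monoid"
  where "SL2Z = \<lparr>carrier = {A. det A = 1}, monoid.mult = (**), one = mat 1\<rparr>"

definition PGL2Z :: "(int^2^2) set monoid"
  where "PGL2Z = GL2Z Mod {mat 1, - mat 1}"

definition PSL2Z :: "(int^2^2) set monoid"
  where "PSL2Z = SL2Z Mod {mat 1, - mat 1}"


lemma GL2Z_group: "group GL2Z"
proof (rule groupI)
  fix A assume "A \<in> carrier GL2Z"
  then obtain B where "A ** B = mat 1" "B ** A = mat 1"
    unfolding GL2Z_def invertible_def by auto
  then show "\<exists>B\<in>carrier GL2Z. B \<otimes>\<^bsub>GL2Z\<^esub> A = \<one>\<^bsub>GL2Z\<^esub>"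
    unfolding GL2Z_def invertible_def by auto
next
  fix A B assume "A \<in> carrier GL2Z" "B \<in> carrier GL2Z"
  then obtain A' B' where AB: "A ** A' = mat 1" "A' ** A = mat 1" "B ** B' = mat 1" "B' ** B = mat 1"
    unfolding GL2Z_def invertible_def by auto
  have "(A ** B) ** (B' ** A') = A ** (B ** B') ** A'"
    "(B' ** A') ** (A ** B) = B' ** (A' ** A) ** B"
    by (simp_all only: matrix_mul_assoc)
  with AB have "(A ** B) ** (B' ** A') = mat 1" "(B' ** A') ** (A ** B) = mat 1"
    by simp_all
  then show "A \<otimes>\<^bsub>GL2Z\<^esub> B \<in> carrier GL2Z"
    unfolding GL2Z_def invertible_def by auto
next
  show "\<one>\<^bsub>GL2Z\<^esub> \<in> carrier GL2Z"
    unfolding GL2Z_def invertible_def by (auto intro: exI[of _ "mat 1"])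
qed (simp_all add: GL2Z_def matrix_mul_assoc)

lemma SL2Z_subgroup: "subgroup (carrier SL2Z) GL2Z"
proof -
  interpret group GL2Z by (rule GL2Z_group)
  have inv_ex: "\<exists>B. A ** B = mat 1 \<and> B ** A = mat 1" if "det A = 1" for A :: "int^2^2"
  proof -
    define B :: "int^2^2" where
      "B = (\<chi> i j. if i = 1 then (if j = 1 then A$2$2 else - A$1$2)
                     else (if j = 1 then - A$2$1 else A$1$1))"
    show ?thesis
      using that unfolding det_2
      by (intro exI[of _ B])
        (simp add: B_def vec_eq_iff matrix_matrix_mult_def mat_def sum_2 forall_2 algebra_simps)
  qed
  show ?thesis
  proof (rule subgroupI)
    show "carrier SL2Z \<subseteq> carrier GL2Z"
      using inv_ex unfolding SL2Z_def GL2Z_def invertible_def by auto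
    then have sub: "A \<in> carrier GL2Z" if "A \<in> carrier SL2Z" for A
      using that by blast
    have "det (mat 1 :: int^2^2) = 1" by (rule det_I)
    then have "mat 1 \<in> carrier SL2Z" by (simp add: SL2Z_def)
    then show "carrier SL2Z \<noteq> {}" by blast
    fix A assume A: "A \<in> carrier SL2Z"
    have "A ** inv\<^bsub>GL2Z\<^esub> A = mat 1"
      using r_inv[OF sub[OF A]] by (simp add: GL2Z_def)
    then have "det A * det (inv\<^bsub>GL2Z\<^esub> A) = 1"
      by (metis det_I det_mul)
    with A show "inv\<^bsub>GL2Z\<^esub> A \<in> carrier SL2Z" by (simp add: SL2Z_def)
    fix B assume "B \<in> carrier SL2Z"
    with A show "A \<otimes>\<^bsub>GL2Z\<^esub> B \<in> carrier SL2Z"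
      by (simp add: SL2Z_def GL2Z_def det_mul)
  qed
qed

lemma SL2Z_eq: "SL2Z = GL2Z\<lparr>carrier := carrier SL2Z\<rparr>"
  by (simp add: SL2Z_def GL2Z_def)

lemma SL2Z_group: "group SL2Z"
  by (subst SL2Z_eq, rule subgroup.subgroup_is_group[OF SL2Z_subgroup GL2Z_group])

lemma pm_one_mult:
  fixes A :: "int^2^2"
  shows "(- mat 1) ** A = - A" "A ** (- mat 1) = - A"
  by (simp_all add: vec_eq_iff matrix_matrix_mult_def mat_def sum_2 forall_2)

lemma pm_one_normal:
  shows "{mat 1, - mat 1} \<lhd> GL2Z" and "{mat 1, - mat 1} \<lhd> SL2Z"
proof -
  have *: "{mat 1, - mat 1} \<lhd> G"
    if "group G" and G: "monoid.mult G = (**)" "\<one>\<^bsub>G\<^esub> = mat 1" and m: "- mat 1 \<in> carrier G"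
    for G :: "(int^2^2) monoid"
  proof -
    interpret group G by fact
    have [simp]: "- mat 1 \<otimes>\<^bsub>G\<^esub> - mat 1 = \<one>\<^bsub>G\<^esub>"
      by (simp add: G pm_one_mult)
    have "inv\<^bsub>G\<^esub> (- mat 1) = - mat 1"
      using m by (intro inv_equality) simp_all
    then have "subgroup {mat 1, - mat 1} G"
      using m one_closed inv_one by (intro subgroupI) (auto simp: G pm_one_mult)
    moreover have "{mat 1, - mat 1} #>\<^bsub>G\<^esub> A = A <#\<^bsub>G\<^esub> {mat 1, - mat 1}" for A
      by (auto simp: r_coset_def l_coset_def G pm_one_mult)
    ultimately show ?thesis
      by (simp add: normal_def normal_axioms_def is_group)
  qed
  have "det (- mat 1 :: int^2^2) = 1" by (simp add: det_2 mat_def)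
  then have "- mat 1 \<in> carrier SL2Z" by (simp add: SL2Z_def)
  moreover from this have "- mat 1 \<in> carrier GL2Z"
    using subgroup.subset[OF SL2Z_subgroup] by blast
  ultimately show "{mat 1, - mat 1} \<lhd> GL2Z" "{mat 1, - mat 1} \<lhd> SL2Z"
    by (auto intro!: * GL2Z_group SL2Z_group) (simp_all add: GL2Z_def SL2Z_def)
qed


section \<open>Algorithms\<close>

text \<open>
  The total recursive functions of a given arity; a function of arity \<open>n\<close> is only meaningful on
  argument lists of length \<open>n\<close>. The first argument is the recursion variable of a primitive
  recursion and the search variable of a minimization; minimization is restricted to searches
  that succeed for all arguments.
\<close>

inductive recursive_fun :: "nat \<Rightarrow> (nat list \<Rightarrow> nat) \<Rightarrow> bool"
where
  zero: "recursive_fun n (\<lambda>xs. 0)"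
| succ: "recursive_fun 1 (\<lambda>xs. Suc (xs ! 0))"
| proj: "i < n \<Longrightarrow> recursive_fun n (\<lambda>xs. xs ! i)"
| comp: "\<lbrakk>recursive_fun (length gs) f; \<forall>g \<in> set gs. recursive_fun n g\<rbrakk>
    \<Longrightarrow> recursive_fun n (\<lambda>xs. f (map (\<lambda>g. g xs) gs))"
| prim_rec: "\<lbrakk>recursive_fun n f; recursive_fun (Suc (Suc n)) h\<rbrakk>
    \<Longrightarrow> recursive_fun (Suc n)
      (\<lambda>xs. rec_nat (f (tl xs)) (\<lambda>k r. h (k # r # tl xs)) (hd xs))"
| minimize: "\<lbrakk>recursive_fun (Suc n) f; \<forall>xs. length xs = n \<longrightarrow> (\<exists>k. f (k # xs) = 0)\<rbrakk>
    \<Longrightarrow> recursive_fun n (\<lambda>xs. LEAST k. f (k # xs) = 0)"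

definition computable :: "(nat \<Rightarrow> nat) \<Rightarrow> bool"
  where "computable F \<longleftrightarrow> (\<exists>f. recursive_fun 1 f \<and> (\<forall>n. F n = f [n]))"

definition matrix_code :: "int^2^2 \<Rightarrow> nat"
  where "matrix_code A =
    list_encode [int_encode (A$1$1), int_encode (A$1$2), int_encode (A$2$1), int_encode (A$2$2)]"

definition input_code :: "(int^2^2) list \<Rightarrow> int^2^2 \<Rightarrow> nat"
  where "input_code hs g = prod_encode (list_encode (map matrix_code hs), matrix_code g)"

text \<open>
  An \<open>H\<close>-equation is output as a list of pairs: \<open>(0, k)\<close> stands for \<open>x\<^sup>k\<close> and
  \<open>(Suc i, k)\<close> for the \<open>k\<close>-th power of the generator \<open>hs ! i\<close> of \<open>H\<close>.
\<close>

type_synonym eqn_word = "(nat \<times> int) list"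

definition eqn_word_code :: "eqn_word \<Rightarrow> nat"
  where "eqn_word_code w = list_encode (map (\<lambda>(j, k). prod_encode (j, int_encode k)) w)"

definition valid_eqn_word :: "'a list \<Rightarrow> eqn_word \<Rightarrow> bool"
  where "valid_eqn_word hs w \<longleftrightarrow> (\<forall>(j, k) \<in> set w. j \<le> length hs)"

fun eqn_of_word ::
  "('a, 'm) monoid_scheme \<Rightarrow> 'a set \<Rightarrow> 'a list \<Rightarrow> eqn_word \<Rightarrow> ('a + int) list set"
where
  "eqn_of_word G H hs [] = \<one>\<^bsub>equations G H\<^esub>"
| "eqn_of_word G H hs ((0, k) # w) = var_pow G H k \<otimes>\<^bsub>equations G H\<^esub> eqn_of_word G H hs w"
| "eqn_of_word G H hs ((Suc i, k) # w) =
    const_eq G H ((hs ! i) [^]\<^bsub>G\<^esub> k) \<otimes>\<^bsub>equations G H\<^esub> eqn_of_word G H hs w"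

text \<open>Output \<open>0\<close> is the negative answer.\<close>

definition correct_output :: "('a, 'm) monoid_scheme \<Rightarrow> 'a list \<Rightarrow> 'a \<Rightarrow> nat \<Rightarrow> bool"
  where "correct_output G hs g out \<longleftrightarrow>
    (let H = generate G (set hs) in
      if algebraic_over G H g
      then \<exists>ws. out = Suc (list_encode (map eqn_word_code ws)) \<and>
             (\<forall>w \<in> set ws. valid_eqn_word hs w \<and> eqn_of_word G H hs w \<in> equation_ideal G H g) \<and>
             equation_ideal G H g \<subseteq> normal_closure (equations G H) (eqn_of_word G H hs ` set ws)
      else out = 0)"

text \<open>
  The elements of \<open>G\<close> are presented by integral matrices: \<open>M\<close> is the set of admissible matrices
  and \<open>\<pi>\<close> sends a matrix to the element of \<open>G\<close> that it represents.
\<close>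

definition algebraicity_algorithm ::
  "('a, 'm) monoid_scheme \<Rightarrow> (int^2^2) set \<Rightarrow> (int^2^2 \<Rightarrow> 'a) \<Rightarrow> (nat \<Rightarrow> nat) \<Rightarrow> bool"
  where "algebraicity_algorithm G M \<pi> F \<longleftrightarrow>
    computable F \<and>
    (\<forall>hs g. set hs \<subseteq> M \<longrightarrow> g \<in> M \<longrightarrow>
       correct_output G (map \<pi> hs) (\<pi> g) (F (input_code hs g)))"

end

theory Submission
  imports Defs
begin

text \<open>
  Let \<open>K = \<langle>h\<^sub>1, \<dots>, h\<^sub>s, g\<rangle>\<close>. The ideal \<open>I\<^sub>H(g)\<close> is the kernel of the evaluation
  \<open>H * \<langle>x\<rangle> \<rightarrow> K\<close>, and words in the letters \<open>h\<^sub>i\<close> and \<open>x\<close> represent all elements of \<open>H * \<langle>x\<rangle>\<close>.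
  So any set of defining relators of \<open>K\<close> on its given generators, read in \<open>H * \<langle>x\<rangle>\<close>, generates
  the ideal as a normal subgroup. The element \<open>g\<close> is algebraic
  iff one of these relators is non-trivial in \<open>H * \<langle>x\<rangle>\<close>. Both the relators and their triviality
  are accessible because \<open>K\<close> is a group of integral matrices, in which words can be evaluated.

  It remains to bound the length of a sufficient set of relators by a computable function of the
  input. The group \<open>GL\<^sub>2(\<int>)\<close> acts with finite stabilizers on a trivalent tree whose vertices are the
  superbases of \<open>\<int>\<^sup>2\<close> (Conway's topograph). Let \<open>B\<close> be the finite ball of the matrices that move the
  base vertex by at most \<open>D\<close>, where \<open>D\<close> is so large that \<open>B\<close> contains the generators. A word over
  \<open>B\<close> with trivial product describes a closed polygon in the tree whose sides are at most \<open>D\<close>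
  long. The two neighbours of a corner farthest from the base vertex are again at distance at
  most \<open>D\<close>, so two adjacent letters have their product in \<open>B\<close> (\<open>gl_ball_merge\<close>). Hence every
  relator decomposes into triangles over \<open>B\<close>. A pigeonhole argument on the subsets of \<open>B\<close> reached
  by words of length \<open>1, 2, 4, 8, \<dots>\<close> shows that the elements of \<open>B \<inter> K\<close> that are needed are
  reached by words of length at most \<open>2 ^ card B\<close>, so that relators of length at most
  \<open>3 * 2 ^ card B\<close> suffice (\<open>ideal_generated_by_short_relators\<close>). The size of \<open>B\<close> is bounded
  explicitly through the entries of its matrices (\<open>card_gl_ball\<close>).

  The algorithm therefore lists all words up to the bound whose value is trivial in \<open>G\<close> and whose
  normal form in \<open>H * \<langle>x\<rangle>\<close> is not empty (\<open>class_eq_one_iff\<close>). It is primitive recursive. Passing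
  to the quotient by \<open>{\<plusminus> I}\<close> changes only the test for triviality, because \<open>- I\<close> fixes every
  superbase; one algorithm, parametrized by the set \<open>Z\<close> of the matrices representing the neutral
  element, serves all four groups.
\<close>

section \<open>Closure properties of the computable functions\<close>

text \<open>
  A value on an argument list of the wrong length carries no meaning, so agreement with a recursive
  function is only asked for on lists of length \<open>n\<close>.
\<close>

definition rec_on :: "nat \<Rightarrow> (nat list \<Rightarrow> nat) \<Rightarrow> bool"
  where "rec_on n f \<longleftrightarrow> (\<exists>F. recursive_fun n F \<and> (\<forall>xs. length xs = n \<longrightarrow> f xs = F xs))"

lemma rec_onI: "recursive_fun n F \<Longrightarrow> (\<And>xs. length xs = n \<Longrightarrow> f xs = F xs) \<Longrightarrow> rec_on n f"
  unfolding rec_on_def by blast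

lemma rec_on_cong: "rec_on n f \<Longrightarrow> (\<And>xs. length xs = n \<Longrightarrow> g xs = f xs) \<Longrightarrow> rec_on n g"
  unfolding rec_on_def by metis

lemma rec_on_proj: "i < n \<Longrightarrow> rec_on n (\<lambda>xs. xs ! i)"
  by (rule rec_onI[OF recursive_fun.proj]) auto

lemma rec_on_comp:
  assumes f: "rec_on (length gs) f" and gs: "\<forall>g\<in>set gs. rec_on n g"
  shows "rec_on n (\<lambda>xs. f (map (\<lambda>g. g xs) gs))"
proof -
  obtain F where F: "recursive_fun (length gs) F" "\<And>xs. length xs = length gs \<Longrightarrow> f xs = F xs"
    using f unfolding rec_on_def by blast
  obtain E where E: "\<And>g. g \<in> set gs \<Longrightarrow> recursive_fun n (E g)"
    "\<And>g xs. g \<in> set gs \<Longrightarrow> length xs = n \<Longrightarrow> g xs = E g xs"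
    using gs unfolding rec_on_def by metis
  have "recursive_fun n (\<lambda>xs. F (map (\<lambda>g. g xs) (map E gs)))"
    by (rule recursive_fun.comp) (use F E in auto)
  then show ?thesis
  proof (rule rec_onI)
    fix xs :: "nat list" assume "length xs = n"
    then have "map (\<lambda>g. g xs) gs = map (\<lambda>g. g xs) (map E gs)" using E(2) by auto
    then show "f (map (\<lambda>g. g xs) gs) = F (map (\<lambda>g. g xs) (map E gs))"
      using F(2)[of "map (\<lambda>g. g xs) gs"] by (metis length_map)
  qed
qed

lemma rec_on_comp1:
  assumes "rec_on 1 (\<lambda>xs. f (xs ! 0))" "rec_on n a"
  shows "rec_on n (\<lambda>xs. f (a xs))"
  using rec_on_comp[of "[a]" "\<lambda>xs. f (xs ! 0)" n] assms by simp

text \<open>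
  In applications of this rule the function \<open>f\<close> is given explicitly: \<open>xs ! 0\<close> and \<open>xs ! 1\<close> are not
  bound variables, so finding \<open>f\<close> by higher-order unification need not terminate.
\<close>

lemma rec_on_comp2:
  assumes "rec_on 2 (\<lambda>xs. f (xs ! 0) (xs ! 1))" "rec_on n a" "rec_on n b"
  shows "rec_on n (\<lambda>xs. f (a xs) (b xs))"
  using rec_on_comp[of "[a, b]" "\<lambda>xs. f (xs ! 0) (xs ! 1)" n] assms by (simp add: numeral_2_eq_2)

lemma rec_on_Suc: "rec_on n a \<Longrightarrow> rec_on n (\<lambda>xs. Suc (a xs))"
  by (rule rec_on_comp1[where f = Suc]) (rule rec_onI[OF recursive_fun.succ], simp_all)

lemma rec_on_const: "rec_on n (\<lambda>xs. c)"
proof (induction c)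
  case 0
  show ?case by (rule rec_onI[OF recursive_fun.zero]) simp
qed (rule rec_on_Suc)

lemma rec_on_prim:
  assumes "rec_on n f" "rec_on (Suc (Suc n)) h"
  shows "rec_on (Suc n) (\<lambda>xs. rec_nat (f (tl xs)) (\<lambda>k r. h (k # r # tl xs)) (hd xs))"
proof -
  obtain F H where F: "recursive_fun n F" "\<And>xs. length xs = n \<Longrightarrow> f xs = F xs"
    and H: "recursive_fun (Suc (Suc n)) H" "\<And>xs. length xs = Suc (Suc n) \<Longrightarrow> h xs = H xs"
    using assms unfolding rec_on_def by blast
  show ?thesis
  proof (rule rec_onI[OF recursive_fun.prim_rec[OF F(1) H(1)]])
    fix xs :: "nat list" assume l: "length xs = Suc n"
    have "rec_nat (f (tl xs)) (\<lambda>k r. h (k # r # tl xs)) m = rec_nat (F (tl xs)) (\<lambda>k r. H (k # r # tl xs)) m" for m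
      using l F(2) H(2) by (induction m) auto
    then show "rec_nat (f (tl xs)) (\<lambda>k r. h (k # r # tl xs)) (hd xs)
      = rec_nat (F (tl xs)) (\<lambda>k r. H (k # r # tl xs)) (hd xs)" .
  qed
qed

lemma rec_on_prim1:
  assumes "rec_on 2 (\<lambda>xs. h (xs ! 0) (xs ! 1))"
  shows "rec_on 1 (\<lambda>xs. rec_nat c h (xs ! 0))"
  using rec_on_prim[OF rec_on_const[of 0 c], of "\<lambda>xs. h (xs ! 0) (xs ! 1)"] assms
  by (auto elim!: rec_on_cong simp: numeral_2_eq_2 length_Suc_conv)

lemma rec_on_prim2:
  assumes "rec_on 1 (\<lambda>xs. f (xs ! 0))" "rec_on 3 (\<lambda>xs. h (xs ! 0) (xs ! 1) (xs ! 2))"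
  shows "rec_on 2 (\<lambda>xs. rec_nat (f (xs ! 1)) (\<lambda>k r. h k r (xs ! 1)) (xs ! 0))"
  using rec_on_prim[of 1 "\<lambda>xs. f (xs ! 0)" "\<lambda>xs. h (xs ! 0) (xs ! 1) (xs ! 2)"] assms
  by (auto elim!: rec_on_cong simp: numeral_2_eq_2 numeral_3_eq_3 length_Suc_conv)

lemma rec_on_add: "rec_on 2 (\<lambda>xs. xs ! 0 + xs ! 1)"
proof -
  have "rec_on 2 (\<lambda>xs. rec_nat (xs ! 1) (\<lambda>k r. Suc r) (xs ! 0))"
    by (rule rec_on_prim2) (auto intro!: rec_on_Suc rec_on_proj)
  moreover have "rec_nat b (\<lambda>k r. Suc r) a = a + b" for a b :: nat by (induction a) auto
  ultimately show ?thesis by simp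
qed

lemma rec_on_mult: "rec_on 2 (\<lambda>xs. xs ! 0 * xs ! 1)"
proof -
  have "rec_on 2 (\<lambda>xs. rec_nat 0 (\<lambda>k r. xs ! 1 + r) (xs ! 0))"
    by (rule rec_on_prim2[where f = "\<lambda>_. 0" and h = "\<lambda>k r b. b + r"])
      (auto intro!: rec_on_const rec_on_comp2[where f = "(+)", OF rec_on_add] rec_on_proj)
  moreover have "rec_nat 0 (\<lambda>k r. b + r) a = a * b" for a b :: nat by (induction a) auto
  ultimately show ?thesis by simp
qed

lemma rec_on_pred: "rec_on 1 (\<lambda>xs. xs ! 0 - 1)"
proof -
  have "rec_on 1 (\<lambda>xs. rec_nat 0 (\<lambda>k r. k) (xs ! 0))"
    by (rule rec_on_prim1) (rule rec_on_proj, simp)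
  moreover have "rec_nat 0 (\<lambda>k r. k) a = a - 1" for a :: nat by (cases a) auto
  ultimately show ?thesis by simp
qed

text \<open>
  The recursion runs over the subtrahend, which therefore is the first argument.
\<close>

lemma rec_on_diff: "rec_on 2 (\<lambda>xs. xs ! 1 - xs ! 0)"
proof -
  have "rec_on 2 (\<lambda>xs. rec_nat (xs ! 1) (\<lambda>k r. r - 1) (xs ! 0))"
    by (rule rec_on_prim2[where f = "\<lambda>b. b" and h = "\<lambda>k r b. r - 1"])
      (rule rec_on_proj rec_on_comp1[where f = "\<lambda>x. x - 1", OF rec_on_pred] | simp)+
  moreover have "rec_nat b (\<lambda>k r. r - 1) a = b - a" for a b :: nat by (induction a) auto
  ultimately show ?thesis by simp
qed

lemma computable_iff: "computable f \<longleftrightarrow> rec_on 1 (\<lambda>xs. f (xs ! 0))"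
proof
  assume "computable f"
  then obtain F where "recursive_fun 1 F" "\<forall>n. f n = F [n]" unfolding computable_def by blast
  then show "rec_on 1 (\<lambda>xs. f (xs ! 0))"
    by (intro rec_onI[of 1 F]) (auto simp: length_Suc_conv)
next
  assume "rec_on 1 (\<lambda>xs. f (xs ! 0))"
  then obtain F where F: "recursive_fun 1 F" "\<And>xs. length xs = 1 \<Longrightarrow> f (xs ! 0) = F xs"
    unfolding rec_on_def by blast
  have "f n = F [n]" for n using F(2)[of "[n]"] by simp
  then have "recursive_fun 1 F \<and> (\<forall>n. f n = F [n])" using F(1) by simp
  then show "computable f" unfolding computable_def by (rule exI[where x = F])
qed

lemma rec_on_computable: "computable f \<Longrightarrow> rec_on n a \<Longrightarrow> rec_on n (\<lambda>xs. f (a xs))"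
  unfolding computable_iff by (rule rec_on_comp1[where f = f])

lemma computable_compose: "computable f \<Longrightarrow> computable a \<Longrightarrow> computable (\<lambda>n. f (a n))"
  unfolding computable_iff by (rule rec_on_comp1[where f = f])

lemma computable_op2:
  assumes "rec_on 2 (\<lambda>xs. f (xs ! 0) (xs ! 1))" "computable a" "computable b"
  shows "computable (\<lambda>n. f (a n) (b n))"
  unfolding computable_iff
  by (rule rec_on_comp2[where f = f, OF assms(1) assms(2,3)[unfolded computable_iff]])

text \<open>
  These rules follow the syntax of a function, so that \<open>intro comp_intros\<close> proves the computability
  of a function composed of known ones.
\<close>

named_theorems comp_intros

lemma computable_const [comp_intros]: "computable (\<lambda>n. c)"
  unfolding computable_iff by (rule rec_on_const)

lemma computable_id [comp_intros]: "computable (\<lambda>n. n)"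
  unfolding computable_iff by (rule rec_on_proj) simp

lemma computable_Suc [comp_intros]: "computable a \<Longrightarrow> computable (\<lambda>n. Suc (a n))"
  unfolding computable_iff by (rule rec_on_Suc)

lemma computable_add [comp_intros]:
  "computable a \<Longrightarrow> computable b \<Longrightarrow> computable (\<lambda>n. a n + b n)"
  by (rule computable_op2[where f = "(+)", OF rec_on_add])

lemma computable_mult [comp_intros]:
  "computable a \<Longrightarrow> computable b \<Longrightarrow> computable (\<lambda>n. a n * b n)"
  by (rule computable_op2[where f = "(*)", OF rec_on_mult])

lemma computable_diff [comp_intros]:
  "computable a \<Longrightarrow> computable b \<Longrightarrow> computable (\<lambda>n. a n - b n)"
  by (rule computable_op2[where f = "\<lambda>x y. y - x", OF rec_on_diff])

text \<open>
  Predicates are represented by 0-1-valued functions, on which the connectives and the conditional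
  become arithmetic.
\<close>

definition decidable :: "(nat \<Rightarrow> bool) \<Rightarrow> bool"
  where "decidable P \<longleftrightarrow> computable (\<lambda>n. of_bool (P n))"

lemma decidable_compose: "decidable P \<Longrightarrow> computable a \<Longrightarrow> decidable (\<lambda>n. P (a n))"
  unfolding decidable_def by (rule computable_compose[where f = "\<lambda>n. of_bool (P n)"])

lemma computable_if [comp_intros]:
  assumes "decidable P" "computable a" "computable b"
  shows "computable (\<lambda>n. if P n then a n else b n)"
proof -
  have "computable (\<lambda>n. of_bool (P n) * a n + (1 - of_bool (P n)) * b n)"
    using assms unfolding decidable_def by (intro comp_intros)
  moreover have "(of_bool p * x + (1 - of_bool p) * y :: nat) = (if p then x else y)" for p x y
    by simp
  ultimately show ?thesis by simp
qed

lemma decidable_not [comp_intros]: "decidable P \<Longrightarrow> decidable (\<lambda>n. \<not> P n)"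
proof -
  have "of_bool (\<not> p) = (1 :: nat) - of_bool p" for p by simp
  then show "decidable P \<Longrightarrow> decidable (\<lambda>n. \<not> P n)"
    unfolding decidable_def by (simp only:) (intro comp_intros)
qed

lemma decidable_conj [comp_intros]:
  "decidable P \<Longrightarrow> decidable Q \<Longrightarrow> decidable (\<lambda>n. P n \<and> Q n)"
  unfolding decidable_def of_bool_conj by (intro comp_intros)

lemma decidable_disj [comp_intros]:
  assumes "decidable P" "decidable Q"
  shows "decidable (\<lambda>n. P n \<or> Q n)"
proof -
  have "decidable (\<lambda>n. \<not> (\<not> P n \<and> \<not> Q n))"
    by (intro decidable_not decidable_conj assms)
  then show ?thesis by simp
qed

lemma decidable_le [comp_intros]:
  assumes "computable a" "computable b"
  shows "decidable (\<lambda>n. a n \<le> b n)"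
proof -
  have "of_bool (x \<le> y) = 1 - (x - y)" for x y :: nat by auto
  then show ?thesis unfolding decidable_def using assms by (auto intro!: comp_intros)
qed

lemma decidable_eq [comp_intros]:
  assumes "computable a" "computable b"
  shows "decidable (\<lambda>n. a n = b n)"
  unfolding eq_iff by (intro comp_intros assms)

abbreviation "pfst n \<equiv> fst (prod_decode n)"
abbreviation "psnd n \<equiv> snd (prod_decode n)"

lemma triangle_rec: "triangle n = rec_nat 0 (\<lambda>k r. Suc (r + k)) n"
  by (induction n) auto

lemma computable_triangle: "computable triangle"
  unfolding triangle_rec[abs_def] computable_iff
  by (rule rec_on_prim1)
    (rule rec_on_Suc rec_on_comp2[where f = "(+)", OF rec_on_add] rec_on_proj | simp)+

lemma computable_prod_encode [comp_intros]:
  "computable a \<Longrightarrow> computable b \<Longrightarrow> computable (\<lambda>n. prod_encode (a n, b n))"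
  unfolding prod_encode_def prod.case
  by (intro comp_intros computable_compose[OF computable_triangle])

text \<open>
  The inverse of the pairing function is obtained by counting: the index of the diagonal on which
  \<open>n\<close> lies grows by one exactly when \<open>n\<close> reaches the next triangular number, and the coordinates
  are read off from this index.
\<close>

definition diagonal :: "nat \<Rightarrow> nat"
  where "diagonal n = pfst n + psnd n"

lemma triangle_diagonal: "triangle (diagonal n) + pfst n = n"
  using prod_decode_inverse[of n] by (simp add: diagonal_def prod_encode_def case_prod_beta)

lemma triangle_mono: "m \<le> n \<Longrightarrow> triangle m \<le> triangle n"
  by (induction rule: dec_induct) auto

lemma diagonal_unique: "triangle s \<le> n \<Longrightarrow> n < triangle (Suc s) \<Longrightarrow> diagonal n = s"
proof -
  assume s: "triangle s \<le> n" "n < triangle (Suc s)"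
  have d: "triangle (diagonal n) \<le> n" "n < triangle (Suc (diagonal n))"
    using triangle_diagonal[of n] by (auto simp: diagonal_def)
  show ?thesis
    using triangle_mono[of "Suc s" "diagonal n"] triangle_mono[of "Suc (diagonal n)" s] s d
    by linarith
qed

lemma diagonal_rec:
  "diagonal n = rec_nat 0 (\<lambda>k r. r + of_bool (triangle (Suc r) \<le> Suc k)) n"
proof (induction n)
  case 0
  show ?case using diagonal_unique[of 0 0] by simp
next
  case (Suc n)
  have d: "triangle (diagonal n) \<le> n" "n < triangle (Suc (diagonal n))"
    using triangle_diagonal[of n] by (auto simp: diagonal_def)
  have "diagonal (Suc n) = diagonal n + of_bool (triangle (Suc (diagonal n)) \<le> Suc n)"
    using d by (intro diagonal_unique) auto
  then show ?case unfolding nat.rec Suc.IH[symmetric] .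
qed

lemma computable_diagonal: "computable diagonal"
proof -
  have 2: "rec_on 2 (\<lambda>xs. of_bool (triangle (Suc (xs ! 1)) \<le> Suc (xs ! 0)))"
  proof -
    have "rec_on 2 (\<lambda>xs. 1 - (triangle (Suc (xs ! 1)) - Suc (xs ! 0)))"
      by (intro rec_on_comp2[where f = "\<lambda>x y. y - x", OF rec_on_diff, of _ _ "\<lambda>_. 1"] rec_on_const
        rec_on_comp2[where f = "\<lambda>x y. y - x", OF rec_on_diff] rec_on_Suc rec_on_computable[OF computable_triangle] rec_on_proj) auto
    moreover have "of_bool (x \<le> y) = 1 - (x - y)" for x y :: nat by auto
    ultimately show ?thesis by simp
  qed
  show ?thesis
    unfolding diagonal_rec[abs_def] computable_iff
    by (rule rec_on_prim1) (intro rec_on_comp2[where f = "(+)", OF rec_on_add] 2 rec_on_proj; simp)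
qed

lemma computable_pfst [comp_intros]: "computable a \<Longrightarrow> computable (\<lambda>n. pfst (a n))"
proof -
  have "pfst n = n - triangle (diagonal n)" for n using triangle_diagonal[of n] by linarith
  then show "computable a \<Longrightarrow> computable (\<lambda>n. pfst (a n))"
    by (auto intro!: comp_intros computable_compose[OF computable_triangle]
      computable_compose[OF computable_diagonal])
qed

lemma computable_psnd [comp_intros]: "computable a \<Longrightarrow> computable (\<lambda>n. psnd (a n))"
proof -
  have "psnd n = diagonal n - pfst n" for n by (simp add: diagonal_def)
  then show "computable a \<Longrightarrow> computable (\<lambda>n. psnd (a n))"
    by (auto intro!: comp_intros computable_compose[OF computable_diagonal])
qed

text \<open>
  The step function of the recursion receives the parameter, the counter and the previous value
  packed into one number, so that all side conditions again concern unary functions.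
\<close>

lemma computable_rec_nat:
  assumes f: "computable f" and m: "computable m"
    and h: "computable (\<lambda>p. h (pfst p) (pfst (psnd p)) (psnd (psnd p)))"
  shows "computable (\<lambda>n. rec_nat (f n) (\<lambda>k r. h n k r) (m n))"
proof -
  let ?h = "\<lambda>p. h (pfst p) (pfst (psnd p)) (psnd (psnd p))"
  have pair: "rec_on 2 (\<lambda>xs. prod_encode (xs ! 0, xs ! 1))"
    unfolding prod_encode_def prod.case
    by (intro rec_on_comp2[where f = "(+)", OF rec_on_add] rec_on_computable[OF computable_triangle] rec_on_proj) auto
  have "rec_on 3 (\<lambda>xs. ?h (prod_encode (xs ! 2, prod_encode (xs ! 0, xs ! 1))))"
    by (rule rec_on_computable[OF h],
        intro rec_on_comp2[where f = "\<lambda>x y. prod_encode (x, y)", OF pair, of 3 "\<lambda>xs. xs ! 2" "\<lambda>xs. prod_encode (xs ! 0, xs ! 1)"]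
          rec_on_comp2[where f = "\<lambda>x y. prod_encode (x, y)", OF pair] rec_on_proj) auto
  then have "rec_on 3 (\<lambda>xs. h (xs ! 2) (xs ! 0) (xs ! 1))" by simp
  then have "rec_on 2 (\<lambda>xs. rec_nat (f (xs ! 1)) (\<lambda>k r. h (xs ! 1) k r) (xs ! 0))"
    using f[unfolded computable_iff] by (rule rec_on_prim2[rotated])
  from computable_op2[where f = "\<lambda>k n. rec_nat (f n) (\<lambda>k r. h n k r) k", OF this m computable_id] show ?thesis .
qed

lemma computable_power [comp_intros]: "computable a \<Longrightarrow> computable (\<lambda>n. b ^ a n)"
proof -
  assume a: "computable a"
  have "computable (\<lambda>n. rec_nat 1 (\<lambda>k r. b * r) (a n))"
    by (intro computable_rec_nat comp_intros a)
  moreover have "rec_nat 1 (\<lambda>k r. b * r) m = b ^ m" for m by (induction m) auto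
  ultimately show ?thesis by simp
qed

abbreviation "lhd c \<equiv> pfst (c - Suc 0)"
abbreviation "ltl c \<equiv> psnd (c - Suc 0)"

lemma list_decode_ltl: "list_decode (ltl c) = tl (list_decode c)"
proof (cases c)
  case 0
  have "prod_decode 0 = (0, 0)" using prod_encode_inverse[of "(0, 0)"] by (simp add: prod_encode_def)
  then show ?thesis using 0 by simp
qed (auto split: prod.split)

lemma list_decode_nonzero: "c \<noteq> 0 \<Longrightarrow> list_decode c = lhd c # list_decode (ltl c)"
  by (cases c) (auto split: prod.split)

lemma list_decode_eq_Nil: "list_decode c = [] \<longleftrightarrow> c = 0"
  by (cases c) (auto split: prod.split)

definition ldrop :: "nat \<Rightarrow> nat \<Rightarrow> nat"
  where "ldrop j c = rec_nat c (\<lambda>k r. ltl r) j"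

lemma computable_ldrop [comp_intros]:
  "computable j \<Longrightarrow> computable c \<Longrightarrow> computable (\<lambda>n. ldrop (j n) (c n))"
  unfolding ldrop_def by (intro computable_rec_nat comp_intros)

lemma list_decode_ldrop: "list_decode (ldrop j c) = drop j (list_decode c)"
  unfolding ldrop_def by (induction j) (auto simp: list_decode_ltl drop_Suc tl_drop)

lemma length_list_decode_le: "length (list_decode c) \<le> c"
proof (induction c rule: less_induct)
  case (less c)
  show ?case
  proof (cases c)
    case (Suc d)
    have "psnd d \<le> d" using le_prod_encode_2[of "psnd d" "pfst d"] by simp
    then show ?thesis using less[of "psnd d"] Suc list_decode_nonzero[of c] by simp
  qed simp
qed

text \<open>
  The fold is an iteration on pairs of the remaining list and the accumulator. The code of a list
  bounds its length and therefore serves as the number of iterations; the surplus iterations leave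
  the pair unchanged.
\<close>

lemma computable_foldl:
  assumes i: "computable i" and m: "computable m"
    and h: "computable (\<lambda>p. h (pfst p) (pfst (psnd p)) (psnd (psnd p)))"
  shows "computable (\<lambda>n. foldl (\<lambda>s x. h n s x) (i n) (list_decode (m n)))"
proof -
  define step where "step n r = (if pfst r = 0 then r
    else prod_encode (ltl (pfst r), h n (psnd r) (lhd (pfst r))))" for n r
  have h': "computable (\<lambda>p. h (pfst p) (psnd (psnd (psnd p))) (lhd (pfst (psnd (psnd p)))))"
    using computable_compose[OF h, of "\<lambda>p. prod_encode (pfst p,
       prod_encode (psnd (psnd (psnd p)), lhd (pfst (psnd (psnd p)))))"]
    by (simp add: comp_intros)
  have "computable (\<lambda>n. psnd (rec_nat (prod_encode (m n, i n)) (\<lambda>k r. step n r) (m n)))"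
    unfolding step_def by (intro comp_intros computable_rec_nat i m h')
  moreover have "psnd (rec_nat (prod_encode (c, s)) (\<lambda>k r. step n r) k)
     = foldl (\<lambda>s x. h n s x) s (list_decode c)" if "length (list_decode c) \<le> k" for n c s k
  proof -
    have rec: "rec_nat x (\<lambda>k r. step n r) k = (step n ^^ k) x" for x k
      by (induction k) auto
    show ?thesis using that unfolding rec
    proof (induction k arbitrary: c s)
      case 0
      then show ?case by (simp add: list_decode_eq_Nil)
    next
      case (Suc k)
      show ?case
      proof (cases "c = 0")
        case True
        have "(step n ^^ k) (prod_encode (0, s)) = prod_encode (0, s)" for k
          by (induction k) (auto simp: step_def)
        then show ?thesis using True
          by (simp del: funpow.simps)
      next
        case False
        have "(step n ^^ Suc k) (prod_encode (c, s))
            = (step n ^^ k) (prod_encode (ltl c, h n s (lhd c)))"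
          using False by (simp add: funpow_Suc_right step_def del: funpow.simps)
        then show ?thesis
          using Suc.IH[of "ltl c" "h n s (lhd c)"] Suc.prems list_decode_nonzero[OF False] by simp
      qed
    qed
  qed
  ultimately show ?thesis by (simp add: length_list_decode_le)
qed

lemma decidable_list_all:
  assumes "computable m" "decidable (\<lambda>p. P (pfst p) (psnd p))"
  shows "decidable (\<lambda>n. \<forall>x\<in>set (list_decode (m n)). P n x)"
proof -
  have P: "decidable (\<lambda>p. P (pfst p) (psnd (psnd p)))"
    using computable_compose[OF assms(2)[unfolded decidable_def],
        of "\<lambda>p. prod_encode (pfst p, psnd (psnd p))"]
    by (simp add: decidable_def comp_intros)
  have "computable (\<lambda>n. foldl (\<lambda>s x. if P n x then s else 0) 1 (list_decode (m n)))"
    by (intro computable_foldl comp_intros assms P)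
  moreover have "foldl (\<lambda>s x. if P n x then s else 0) s xs = (if \<forall>x\<in>set xs. P n x then s else 0)"
    for n xs and s :: nat by (induction xs arbitrary: s) auto
  ultimately show ?thesis by (simp add: decidable_def of_bool_def del: One_nat_def)
qed

lemma computable_rev:
  assumes "computable m"
  shows "computable (\<lambda>n. list_encode (rev (list_decode (m n))))"
proof -
  have "computable (\<lambda>n. foldl (\<lambda>s x. Suc (prod_encode (x, s))) 0 (list_decode (m n)))"
    by (intro computable_foldl comp_intros assms)
  moreover have "foldl (\<lambda>s x. Suc (prod_encode (x, s))) (list_encode ys) xs = list_encode (rev xs @ ys)"
    for xs ys
  proof (induction xs arbitrary: ys)
    case (Cons x xs)
    then show ?case using Cons[of "x # ys"] by simp
  qed simp
  from this[of "[]"] have "foldl (\<lambda>s x. Suc (prod_encode (x, s))) 0 xs = list_encode (rev xs)" for xs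
    by simp
  ultimately show ?thesis by simp
qed

lemma computable_foldr:
  assumes i: "computable i" and m: "computable m"
    and h: "computable (\<lambda>p. h (pfst p) (psnd (psnd p)) (pfst (psnd p)))"
  shows "computable (\<lambda>n. foldr (\<lambda>x s. h n x s) (list_decode (m n)) (i n))"
  using computable_foldl[OF i computable_rev[OF m], of "\<lambda>n s x. h n x s"] h
  by (simp add: foldl_conv_foldr)

text \<open>
  Differences of natural numbers can be added and multiplied without case distinctions on signs;
  the passage to and from \<open>int_encode\<close> takes place only at the ends (\<open>computable_int_encode\<close>,
  \<open>computable_int_decode\<close>).
\<close>

definition computable_int :: "(nat \<Rightarrow> int) \<Rightarrow> bool"
  where "computable_int f \<longleftrightarrow> (\<exists>a b. computable a \<and> computable b \<and> (\<forall>n. f n = int (a n) - int (b n)))"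

lemma computable_intI:
  "computable a \<Longrightarrow> computable b \<Longrightarrow> (\<And>n. f n = int (a n) - int (b n)) \<Longrightarrow> computable_int f"
  unfolding computable_int_def by blast

lemma computable_int_const [comp_intros]: "computable_int (\<lambda>n. c)"
  by (rule computable_intI[of "\<lambda>n. nat c" "\<lambda>n. nat (- c)"]) (auto intro: comp_intros)

lemma computable_int_add [comp_intros]:
  assumes "computable_int f" "computable_int g" shows "computable_int (\<lambda>n. f n + g n)"
proof -
  obtain a b c d where *: "computable a" "computable b" "computable c" "computable d"
    "\<And>n. f n = int (a n) - int (b n)" "\<And>n. g n = int (c n) - int (d n)"
    using assms unfolding computable_int_def by metis
  show ?thesis
    by (rule computable_intI[of "\<lambda>n. a n + c n" "\<lambda>n. b n + d n"]) (auto intro: comp_intros simp: *)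
qed

lemma computable_int_minus [comp_intros]:
  assumes "computable_int f" shows "computable_int (\<lambda>n. - f n)"
  using assms unfolding computable_int_def by force

lemma computable_int_diff [comp_intros]:
  assumes "computable_int f" "computable_int g" shows "computable_int (\<lambda>n. f n - g n)"
  using computable_int_add[OF assms(1) computable_int_minus[OF assms(2)]] by simp

lemma computable_int_mult [comp_intros]:
  assumes "computable_int f" "computable_int g" shows "computable_int (\<lambda>n. f n * g n)"
proof -
  obtain a b c d where *: "computable a" "computable b" "computable c" "computable d"
    "\<And>n. f n = int (a n) - int (b n)" "\<And>n. g n = int (c n) - int (d n)"
    using assms unfolding computable_int_def by metis
  show ?thesis
    by (rule computable_intI[of "\<lambda>n. a n * c n + b n * d n" "\<lambda>n. a n * d n + b n * c n"])
      (auto intro!: comp_intros simp: * algebra_simps)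
qed

lemma decidable_int_eq [comp_intros]:
  assumes "computable_int f" "computable_int g" shows "decidable (\<lambda>n. f n = g n)"
proof -
  obtain a b c d where *: "computable a" "computable b" "computable c" "computable d"
    "\<And>n. f n = int (a n) - int (b n)" "\<And>n. g n = int (c n) - int (d n)"
    using assms unfolding computable_int_def by metis
  have "f n = g n \<longleftrightarrow> a n + d n = c n + b n" for n using * by auto
  then show ?thesis using * by (auto intro!: comp_intros)
qed

lemma computable_int_encode [comp_intros]:
  assumes "computable_int f" shows "computable (\<lambda>n. int_encode (f n))"
proof -
  obtain a b where *: "computable a" "computable b" "\<And>n. f n = int (a n) - int (b n)"
    using assms unfolding computable_int_def by metis
  have "int_encode (int x - int y) = (if y \<le> x then 2 * (x - y) else 2 * (y - x) - 1)" for x y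
  proof (cases "y \<le> x")
    case True
    then obtain d where "x = y + d" using le_Suc_ex by blast
    then show ?thesis by (simp add: int_encode_def sum_encode_def)
  next
    case False
    then obtain d where "y = x + Suc d" using less_iff_Suc_add[of x y] by auto
    then show ?thesis by (simp add: int_encode_def sum_encode_def)
  qed
  moreover have "computable (\<lambda>n. if b n \<le> a n then 2 * (a n - b n) else 2 * (b n - a n) - 1)"
    by (intro comp_intros *(1,2))
  ultimately show ?thesis by (simp only: *(3))
qed

lemma computable_half: "computable (\<lambda>n. n div 2)"
  and decidable_even: "decidable even"
proof -
  have "computable (\<lambda>n. rec_nat 0 (\<lambda>k r. 1 - r) n)"
    by (intro computable_rec_nat comp_intros)
  moreover have "rec_nat 0 (\<lambda>k r. 1 - r) n = (of_bool (odd n) :: nat)" for n by (induction n) auto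
  ultimately have "decidable odd" unfolding decidable_def by simp
  from decidable_not[OF this] show ev: "decidable even" by simp
  have "computable (\<lambda>n. rec_nat 0 (\<lambda>k r. if even k then r else Suc r) n)"
    by (intro computable_rec_nat comp_intros decidable_compose[OF ev])
  moreover have "rec_nat 0 (\<lambda>k r. if even k then r else Suc r) n = n div 2" for n
    by (induction n) (auto elim!: evenE oddE)
  ultimately show "computable (\<lambda>n. n div 2)" by simp
qed

lemma computable_int_decode [comp_intros]:
  assumes "computable a" shows "computable_int (\<lambda>n. int_decode (a n))"
proof -
  have ev: "decidable (\<lambda>n. even (a n))"
    by (rule decidable_compose[OF decidable_even assms])
  show ?thesis
    by (rule computable_intI[of "\<lambda>n. if even (a n) then a n div 2 else 0" "\<lambda>n. if even (a n) then 0 else Suc (a n div 2)"])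
      (auto intro!: comp_intros computable_compose[OF computable_half] ev assms
        simp: int_decode_def sum_decode_def)
qed

lemma computable_int_if [comp_intros]:
  assumes "decidable P" "computable_int f" "computable_int g"
  shows "computable_int (\<lambda>n. if P n then f n else g n)"
proof -
  obtain a b c d where *: "computable a" "computable b" "computable c" "computable d"
    "\<And>n. f n = int (a n) - int (b n)" "\<And>n. g n = int (c n) - int (d n)"
    using assms unfolding computable_int_def by metis
  show ?thesis
    by (rule computable_intI[of "\<lambda>n. if P n then a n else c n" "\<lambda>n. if P n then b n else d n"])
      (use * assms(1) in \<open>auto intro: computable_if\<close>)
qed


section \<open>Integral matrices of size two\<close>

lemma mat2_mult_nth [simp]:
  fixes A B :: "int^2^2"
  shows "(A ** B) $ i $ j = A $ i $ 1 * B $ 1 $ j + A $ i $ 2 * B $ 2 $ j"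
  by (simp add: matrix_matrix_mult_def sum_2)

lemma mat2_eq_iff:
  fixes A B :: "int^2^2"
  shows "A = B \<longleftrightarrow> A $ 1 $ 1 = B $ 1 $ 1 \<and> A $ 1 $ 2 = B $ 1 $ 2 \<and> A $ 2 $ 1 = B $ 2 $ 1 \<and> A $ 2 $ 2 = B $ 2 $ 2"
  by (auto simp: vec_eq_iff forall_2)

lemma mat2_one_nth [simp]: "(mat 1 :: int^2^2) $ 1 $ 1 = 1" "(mat 1 :: int^2^2) $ 1 $ 2 = 0"
  "(mat 1 :: int^2^2) $ 2 $ 1 = 0" "(mat 1 :: int^2^2) $ 2 $ 2 = 1"
  by (simp_all add: mat_def)

definition mat2 :: "int \<Rightarrow> int \<Rightarrow> int \<Rightarrow> int \<Rightarrow> int^2^2"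
  where "mat2 a b c d = (\<chi> i j. if i = 1 then if j = 1 then a else b else if j = 1 then c else d)"

lemma mat2_nth [simp]: "mat2 a b c d $ 1 $ 1 = a" "mat2 a b c d $ 1 $ 2 = b"
  "mat2 a b c d $ 2 $ 1 = c" "mat2 a b c d $ 2 $ 2 = d"
  by (simp_all add: mat2_def)

text \<open>
  The adjugate multiplied by the determinant, which is its own inverse for the matrices in
  \<open>GL\<^sub>2(\<int>)\<close>.
\<close>

definition mat2_inv :: "int^2^2 \<Rightarrow> int^2^2"
  where "mat2_inv A = mat2 (det A * A $ 2 $ 2) (- det A * A $ 1 $ 2) (- det A * A $ 2 $ 1) (det A * A $ 1 $ 1)"

lemma mat2_inv_of_unit_det:
  assumes "det A = 1 \<or> det A = -1"
  shows "A ** mat2_inv A = mat 1" "mat2_inv A ** A = mat 1"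
proof -
  have d: "A $ 1 $ 1 * A $ 2 $ 2 - A $ 1 $ 2 * A $ 2 $ 1 = det A" by (simp add: det_2)
  have "det A * det A = 1" using assms by auto
  then have e: "det A * (A $ 1 $ 1 * A $ 2 $ 2 - A $ 1 $ 2 * A $ 2 $ 1) = 1" unfolding d .
  show "A ** mat2_inv A = mat 1"
    unfolding mat2_eq_iff mat2_mult_nth mat2_inv_def mat2_nth mat2_one_nth
    using e by (simp add: algebra_simps)
  show "mat2_inv A ** A = mat 1"
    unfolding mat2_eq_iff mat2_mult_nth mat2_inv_def mat2_nth mat2_one_nth
    using e by (simp add: algebra_simps)
qed

lemma GL2Z_iff: "A \<in> carrier GL2Z \<longleftrightarrow> det A = 1 \<or> det A = -1"
proof
  assume "A \<in> carrier GL2Z"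
  then obtain B where "A ** B = mat 1" unfolding GL2Z_def invertible_def by auto
  then have "det A * det B = 1" by (metis det_I det_mul)
  then show "det A = 1 \<or> det A = -1" by (simp add: zmult_eq_1_iff) blast
next
  assume "det A = 1 \<or> det A = -1"
  from mat2_inv_of_unit_det[OF this] show "A \<in> carrier GL2Z"
    unfolding GL2Z_def invertible_def by auto
qed

lemma GL2Z_simps [simp]: "\<one>\<^bsub>GL2Z\<^esub> = mat 1" "A \<otimes>\<^bsub>GL2Z\<^esub> B = A ** B"
  by (simp_all add: GL2Z_def)

lemma mat2_inv:
  assumes "A \<in> carrier GL2Z"
  shows "A ** mat2_inv A = mat 1" "mat2_inv A ** A = mat 1"
  using mat2_inv_of_unit_det assms unfolding GL2Z_iff by auto

lemma mult_in_GL2Z: "A \<in> carrier GL2Z \<Longrightarrow> B \<in> carrier GL2Z \<Longrightarrow> A ** B \<in> carrier GL2Z"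
  unfolding GL2Z_iff det_mul by auto

lemma mat2_inv_in_GL2Z: "A \<in> carrier GL2Z \<Longrightarrow> mat2_inv A \<in> carrier GL2Z"
  using mat2_inv unfolding GL2Z_def invertible_def by auto

lemma GL2Z_inv: "A \<in> carrier GL2Z \<Longrightarrow> inv\<^bsub>GL2Z\<^esub> A = mat2_inv A"
  using group.inv_equality[OF GL2Z_group, of "mat2_inv A" A] mat2_inv(2) mat2_inv_in_GL2Z by simp


section \<open>The tree of superbases\<close>

text \<open>
  Let \<open>u\<close>, \<open>v\<close> be the columns of \<open>A\<close> and \<open>w = - (u + v)\<close>. The set \<open>{\<plusminus>u, \<plusminus>v, \<plusminus>w}\<close> is a superbase of
  \<open>\<int>\<^sup>2\<close>. It is encoded by the coefficients \<open>(x, y, z)\<close> of the form with the matrix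
  \<open>(2x, y; y, 2z) = u u\<^sup>T + v v\<^sup>T + w w\<^sup>T\<close>, which does not depend on the order and the signs of the
  three vectors. These forms are the vertices of the tree.
\<close>

definition superbase :: "int^2^2 \<Rightarrow> int \<times> int \<times> int"
  where "superbase A = (let a = A $ 1 $ 1; b = A $ 1 $ 2; c = A $ 2 $ 1; d = A $ 2 $ 2 in
    (a * a + a * b + b * b, 2 * a * c + a * d + b * c + 2 * b * d, c * c + c * d + d * d))"

text \<open>
  The action \<open>Q \<mapsto> A Q A\<^sup>T\<close> on forms, in the coordinates used for superbases.
\<close>

fun form_act :: "int^2^2 \<Rightarrow> int \<times> int \<times> int \<Rightarrow> int \<times> int \<times> int"
  where "form_act A (x, y, z) = (let a = A $ 1 $ 1; b = A $ 1 $ 2; c = A $ 2 $ 1; d = A $ 2 $ 2 in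
    (a * a * x + a * b * y + b * b * z, 2 * a * c * x + (a * d + b * c) * y + 2 * b * d * z,
     c * c * x + c * d * y + d * d * z))"

lemma superbase_mult: "superbase (A ** B) = form_act A (superbase B)"
  by (simp add: superbase_def Let_def) algebra

text \<open>
  In the inner product \<open>\<langle>p, q\<rangle>\<close> with the Gram matrix \<open>(2, -1; -1, 2)\<close>, this is half of
  \<open>\<langle>u, u\<rangle> + \<langle>v, v\<rangle> + \<langle>w, w\<rangle>\<close>. It makes the tree a rooted one: Selling's reduction of a superbase
  lowers the height at every step, until it reaches the standard superbase.
\<close>

fun height :: "int \<times> int \<times> int \<Rightarrow> int"
  where "height (x, y, z) = 2 * x + 2 * z - y"

text \<open>
  Multiplication by this matrix from the right turns the superbase of \<open>u\<close>, \<open>v\<close>, \<open>w\<close> into that of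
  \<open>u\<close>, \<open>- v\<close>, \<open>v - u\<close>, its neighbour across the edge \<open>{\<plusminus>u, \<plusminus>v}\<close>.
\<close>

definition flip :: "int^2^2" where "flip = mat2 1 0 0 (-1)"

lemma flip_in: "flip \<in> carrier GL2Z" and flip_flip: "flip ** flip = mat 1"
  by (simp_all add: GL2Z_iff flip_def det_2 mat2_eq_iff)

text \<open>
  Any two of the three vectors of a superbase are the columns of a matrix that has this superbase,
  so all three neighbours are covered.
\<close>

definition adj :: "int \<times> int \<times> int \<Rightarrow> int \<times> int \<times> int \<Rightarrow> bool"
  where "adj X Y \<longleftrightarrow> (\<exists>A\<in>carrier GL2Z. X = superbase A \<and> Y = superbase (A ** flip))"

lemma adj_sym: "adj X Y \<Longrightarrow> adj Y X"
proof -
  assume "adj X Y"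
  then obtain A where A: "A \<in> carrier GL2Z" "X = superbase A" "Y = superbase (A ** flip)"
    unfolding adj_def by blast
  have "A ** flip ** flip = A" using flip_flip by (metis matrix_mul_assoc matrix_mul_rid)
  then show "adj Y X" using A mult_in_GL2Z[OF A(1) flip_in] unfolding adj_def by metis
qed

lemma adj_act: "adj X Y \<Longrightarrow> A \<in> carrier GL2Z \<Longrightarrow> adj (form_act A X) (form_act A Y)"
proof -
  assume "adj X Y" and A: "A \<in> carrier GL2Z"
  then obtain B where B: "B \<in> carrier GL2Z" "X = superbase B" "Y = superbase (B ** flip)"
    unfolding adj_def by blast
  show ?thesis unfolding adj_def
    by (rule bexI[of _ "A ** B"])
      (use A B mult_in_GL2Z in \<open>auto simp: superbase_mult[symmetric] matrix_mul_assoc\<close>)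
qed

text \<open>
  The inner product \<open>\<langle>u, v\<rangle>\<close> of the columns; its sign tells whether crossing the edge \<open>{\<plusminus>u, \<plusminus>v}\<close>
  lowers or raises the height.
\<close>

definition col_inner :: "int^2^2 \<Rightarrow> int"
  where "col_inner A = (let a = A $ 1 $ 1; b = A $ 1 $ 2; c = A $ 2 $ 1; d = A $ 2 $ 2 in
    2 * a * b + 2 * c * d - (a * d + b * c))"

lemma height_flip: "height (superbase (A ** flip)) = height (superbase A) - 2 * col_inner A"
  by (simp add: superbase_def Let_def col_inner_def flip_def algebra_simps)

text \<open>
  Modulo 2 the inner product of the columns is the determinant. So it never vanishes, and
  neighbours always differ in height.
\<close>

lemma odd_col_inner: "A \<in> carrier GL2Z \<Longrightarrow> odd (col_inner A)"
proof -
  assume "A \<in> carrier GL2Z"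
  then have "odd (det A)" unfolding GL2Z_iff by auto
  moreover have "col_inner A = det A + 2 * (A $ 1 $ 1 * A $ 1 $ 2 + A $ 2 $ 1 * A $ 2 $ 2 - A $ 1 $ 1 * A $ 2 $ 2)"
    by (simp add: col_inner_def Let_def det_2 algebra_simps)
  ultimately show ?thesis by simp
qed

lemma quad_form_nonneg: "0 \<le> a * a - a * b + b * (b :: int)"
proof -
  have "0 \<le> a * a + b * b + (a - b) * (a - b)" by simp
  then show ?thesis by (simp add: algebra_simps)
qed

lemma quad_form_eq_1:
  assumes "a * a + a * b + b * b = (1 :: int)"
  shows "(a, b) \<in> {(1,0), (-1,0), (0,1), (0,-1), (1,-1), (-1,1)}"
proof -
  have bound: "\<bar>x\<bar> \<le> 1" if "x * x + x * y + y * y = (1 :: int)" for x y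
  proof (rule ccontr)
    assume "\<not> \<bar>x\<bar> \<le> 1"
    then have "2 * 2 \<le> \<bar>x\<bar> * \<bar>x\<bar>" by (intro mult_mono) auto
    then have "4 \<le> x * x" by simp
    moreover have "0 \<le> (x + 2 * y) * (x + 2 * y)" by simp
    moreover have "(x + 2 * y) * (x + 2 * y) = 4 - 3 * (x * x)" using that by (simp add: algebra_simps)
    ultimately show False by linarith
  qed
  have "\<bar>a\<bar> \<le> 1" "\<bar>b\<bar> \<le> 1" using bound[of a b] bound[of b a] assms by (simp_all add: algebra_simps)
  then have "a \<in> {-1, 0, 1}" "b \<in> {-1, 0, 1}" by auto
  then show ?thesis using assms by auto
qed

text \<open>
  At most one neighbour of a superbase is lower: two edges leading to lower neighbours would share a
  vector, say \<open>v\<close>, and then \<open>0 < \<langle>u, v\<rangle> + \<langle>v, w\<rangle> = - \<langle>v, v\<rangle>\<close>. Two matrices with the same superbase differ by an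
  element \<open>S\<close> of the stabilizer of the standard superbase, a group of order 12; its elements are
  enumerated, and each of them either preserves the edge of the columns or takes it to another
  one.
\<close>

lemma flip_coset_cases:
  assumes "superbase S = superbase (mat 1)"
  shows "superbase (S ** flip) = superbase flip \<or>
    (\<forall>A\<in>carrier GL2Z. \<not> (0 < col_inner A \<and> 0 < col_inner (A ** S)))"
proof -
  obtain a b c d where S: "S = mat2 a b c d"
    by (rule that[of "S $ 1 $ 1" "S $ 1 $ 2" "S $ 2 $ 1" "S $ 2 $ 2"]) (simp add: mat2_eq_iff)
  have norms: "a * a + a * b + b * b = 1" "c * c + c * d + d * d = 1"
    and y: "2 * a * c + a * d + b * c + 2 * b * d = 1"
    using assms unfolding S by (simp_all add: superbase_def Let_def)
  from norms(1) have ab: "(a, b) \<in> {(1,0), (-1,0), (0,1), (0,-1), (1,-1), (-1,1)}"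
    by (rule quad_form_eq_1)
  have cd: "(c, d) \<in> {(1,0), (-1,0), (0,1), (0,-1), (1,-1), (-1,1)}"
    using norms(2) by (rule quad_form_eq_1)
  show ?thesis
  proof (cases "superbase (S ** flip) = superbase flip")
    case False
    have "\<not> (0 < col_inner A \<and> 0 < col_inner (A ** S))" if "A \<in> carrier GL2Z" for A
      using ab cd y False quad_form_nonneg[of "A $ 1 $ 1" "A $ 2 $ 1"] quad_form_nonneg[of "A $ 1 $ 2" "A $ 2 $ 2"]
      unfolding S
      by (auto simp: superbase_def Let_def flip_def col_inner_def algebra_simps)
    then show ?thesis by blast
  qed simp
qed

lemma parent_unique:
  assumes "adj X Y" "adj X Y'" "height Y < height X" "height Y' < height X"
  shows "Y = Y'"
proof -
  obtain A B where A: "A \<in> carrier GL2Z" "X = superbase A" "Y = superbase (A ** flip)"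
    and B: "B \<in> carrier GL2Z" "X = superbase B" "Y' = superbase (B ** flip)"
    using assms(1,2) unfolding adj_def by blast
  define S where "S = mat2_inv A ** B"
  have AS: "A ** S = B"
    unfolding S_def using mat2_inv(1)[OF A(1)] by (simp add: matrix_mul_assoc)
  have "superbase S = form_act (mat2_inv A) (superbase A)"
    unfolding S_def superbase_mult using A(2) B(2) by simp
  also have "\<dots> = superbase (mat 1)"
    using mat2_inv(2)[OF A(1)] by (simp only: superbase_mult[symmetric])
  finally have S: "superbase S = superbase (mat 1)" .
  have "0 < col_inner A" "0 < col_inner B"
    using assms(3,4) A B height_flip by auto
  with flip_coset_cases[OF S] A(1) AS have "superbase (S ** flip) = superbase flip" by blast
  then have "superbase (A ** S ** flip) = superbase (A ** flip)"
    by (simp only: superbase_mult matrix_mul_assoc[symmetric])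
  then show ?thesis using A B AS by simp
qed

lemma adj_height_neq: "adj X Y \<Longrightarrow> height X \<noteq> height Y"
  using odd_col_inner height_flip unfolding adj_def by fastforce

text \<open>
  The bound amounts to \<open>0 \<le> \<langle>u + v, u + v\<rangle>\<close>.
\<close>

lemma adj_height_le:
  assumes "adj X Y" shows "height Y \<le> 3 * height X"
proof -
  obtain A where A: "A \<in> carrier GL2Z" "X = superbase A" "Y = superbase (A ** flip)"
    using assms unfolding adj_def by blast
  have "0 \<le> height (superbase A) + col_inner A"
    using quad_form_nonneg[of "A$1$1 + A$1$2" "A$2$1 + A$2$2"]
    by (simp add: superbase_def Let_def col_inner_def algebra_simps)
  then show ?thesis using height_flip[of A] A by simp
qed

lemma entry_le_height:
  assumes "A \<in> carrier GL2Z"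
  shows "\<bar>A $ i $ j\<bar> \<le> 2 * height (superbase A)"
proof -
  have le: "\<bar>x\<bar> \<le> 2 * (x * x - x * y + y * y)" "\<bar>y\<bar> \<le> 2 * (x * x - x * y + y * y)" for x y :: int
  proof -
    have sq: "\<bar>z\<bar> \<le> z * z" for z :: int
      by (metis abs_ge_zero abs_mult_self_eq int_one_le_iff_zero_less less_le mult_cancel_left2 mult_left_mono mult_zero_left not_le)
    have "0 \<le> (x - y) * (x - y)" by simp
    then show "\<bar>x\<bar> \<le> 2 * (x * x - x * y + y * y)" "\<bar>y\<bar> \<le> 2 * (x * x - x * y + y * y)"
      using sq[of x] sq[of y] zero_le_square[of x] zero_le_square[of y]
      by (simp_all add: algebra_simps)
  qed
  let ?u = "A$1$1 * A$1$1 - A$1$1 * A$2$1 + A$2$1 * A$2$1"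
  let ?v = "A$1$2 * A$1$2 - A$1$2 * A$2$2 + A$2$2 * A$2$2"
  have h: "height (superbase A) \<ge> ?u" "height (superbase A) \<ge> ?v"
    using quad_form_nonneg[of "A$1$1 + A$1$2" "A$2$1 + A$2$2"] quad_form_nonneg[of "A$1$1" "A$2$1"]
     quad_form_nonneg[of "A$1$2" "A$2$2"]
    by (simp_all add: superbase_def Let_def algebra_simps)
  have "\<forall>i j. \<bar>A $ i $ j\<bar> \<le> 2 * height (superbase A)"
    unfolding forall_2 using h le(1)[of "A$1$1" "A$2$1"] le(2)[of "A$2$1" "A$1$1"]
      le(1)[of "A$1$2" "A$2$2"] le(2)[of "A$2$2" "A$1$2"] by (auto simp: algebra_simps)
  then show ?thesis by blast
qed

text \<open>
  The same superbase presented by its edges \<open>{\<plusminus>u, \<plusminus>w}\<close> and \<open>{\<plusminus>v, \<plusminus>w}\<close>: here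
  \<open>\<langle>u, w\<rangle> = - \<langle>u, v\<rangle> - \<langle>u, u\<rangle>\<close>, and similarly for \<open>v\<close>.
\<close>

lemma superbase_edge_uw:
  assumes "A \<in> carrier GL2Z"
  obtains B where "B \<in> carrier GL2Z" "superbase B = superbase A"
     "col_inner B = - col_inner A - 2 * (A$1$1 * A$1$1 - A$1$1 * A$2$1 + A$2$1 * A$2$1)"
proof (rule that[of "A ** mat2 1 (-1) 0 (-1)"])
  show "A ** mat2 1 (-1) 0 (-1) \<in> carrier GL2Z"
    by (rule mult_in_GL2Z[OF assms]) (simp add: GL2Z_iff det_2)
qed (simp_all add: superbase_def Let_def col_inner_def algebra_simps)

lemma superbase_edge_vw:
  assumes "A \<in> carrier GL2Z"
  obtains B where "B \<in> carrier GL2Z" "superbase B = superbase A"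
     "col_inner B = - col_inner A - 2 * (A$1$2 * A$1$2 - A$1$2 * A$2$2 + A$2$2 * A$2$2)"
proof (rule that[of "A ** mat2 0 (-1) 1 (-1)"])
  show "A ** mat2 0 (-1) 1 (-1) \<in> carrier GL2Z"
    by (rule mult_in_GL2Z[OF assms]) (simp add: GL2Z_iff det_2)
qed (simp_all add: superbase_def Let_def col_inner_def algebra_simps)

text \<open>
  Selling's argument: if no neighbour is lower, the three numbers \<open>- \<langle>u, v\<rangle>\<close>, \<open>- \<langle>u, w\<rangle>\<close>,
  \<open>- \<langle>v, w\<rangle>\<close> are positive, while the sum of their pairwise products is the Gram determinant 3.
  Hence all three are 1, and only the standard superbase has this Gram matrix.
\<close>

lemma no_parent_root:
  assumes A: "A \<in> carrier GL2Z" and no: "\<And>Y. adj (superbase A) Y \<Longrightarrow> height (superbase A) < height Y"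
  shows "superbase A = superbase (mat 1)"
proof -
  have neg: "col_inner B \<le> -1" if "B \<in> carrier GL2Z" "superbase B = superbase A" for B
    using no[of "superbase (B ** flip)"] that height_flip[of B] unfolding adj_def by force
  let ?u = "A$1$1 * A$1$1 - A$1$1 * A$2$1 + A$2$1 * A$2$1"
  let ?v = "A$1$2 * A$1$2 - A$1$2 * A$2$2 + A$2$2 * A$2$2"
  define p q r where "p = - col_inner A" and "q = 2 * ?u + col_inner A" and "r = 2 * ?v + col_inner A"
  obtain B where B: "B \<in> carrier GL2Z" "superbase B = superbase A" "col_inner B = - col_inner A - 2 * ?u"
    by (rule superbase_edge_uw[OF A])
  obtain C where C: "C \<in> carrier GL2Z" "superbase C = superbase A" "col_inner C = - col_inner A - 2 * ?v"
    by (rule superbase_edge_vw[OF A])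
  have pqr: "1 \<le> p" "1 \<le> q" "1 \<le> r"
    using neg[OF A] neg[OF B(1,2)] neg[OF C(1,2)] B(3) C(3) by (simp_all add: p_def q_def r_def)
  have "p * q + q * r + r * p = 3 * (det A * det A)"
    unfolding p_def q_def r_def col_inner_def Let_def det_2 by algebra
  then have "p * q + q * r + r * p = 3" using A unfolding GL2Z_iff by auto
  moreover have "1 \<le> x * y" if "1 \<le> x" "1 \<le> y" for x y :: int
    using mult_mono[of 1 x 1 y] that by simp
  then have "1 \<le> p * q" "1 \<le> q * r" "1 \<le> r * p" using pqr by blast+
  ultimately have "p * q = 1" "q * r = 1" by linarith+
  then have "p = 1" "q = 1" "r = 1"
    using pqr by (auto simp: zmult_eq_1_iff)
  then have uv: "?u = 1" "?v = 1" and i: "col_inner A = -1" unfolding p_def q_def r_def by auto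
  have "(A$1$1, - A$2$1) \<in> {(1,0), (-1,0), (0,1), (0,-1), (1,-1), (-1,1)}"
    "(A$1$2, - A$2$2) \<in> {(1,0), (-1,0), (0,1), (0,-1), (1,-1), (-1,1)}"
    by (rule quad_form_eq_1; use uv in \<open>simp add: algebra_simps\<close>)+
  then show ?thesis using i unfolding superbase_def col_inner_def Let_def by auto
qed

lemma height_ge_3: "A \<in> carrier GL2Z \<Longrightarrow> 3 \<le> height (superbase A)"
proof (induction "nat (height (superbase A))" arbitrary: A rule: less_induct)
  case less
  show ?case
  proof (cases "\<exists>Y. adj (superbase A) Y \<and> height Y < height (superbase A)")
    case True
    then obtain B where B: "B \<in> carrier GL2Z" "height (superbase (B ** flip)) < height (superbase A)"
      unfolding adj_def by blast
    have "0 < height (superbase A)"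
    proof (rule ccontr)
      assume "\<not> 0 < height (superbase A)"
      then have "A $ i $ j = 0" for i j
        using entry_le_height[OF less.prems, of i j] by linarith
      then show False using less.prems unfolding GL2Z_iff det_2 by simp
    qed
    then show ?thesis using less.hyps[of "B ** flip"] B mult_in_GL2Z[OF B(1) flip_in] by auto
  next
    case False
    then have "superbase A = superbase (mat 1)"
      using no_parent_root[OF less.prems] adj_height_neq by (metis linorder_neqE_linordered_idom)
    then show ?thesis by (simp add: superbase_def Let_def)
  qed
qed


section \<open>Distances in the tree\<close>

definition near :: "nat \<Rightarrow> int \<times> int \<times> int \<Rightarrow> int \<times> int \<times> int \<Rightarrow> bool"
  where "near D X Y \<longleftrightarrow> (\<exists>k\<le>D. (adj ^^ k) X Y)"

lemma relpowp_adj_sym: "(adj ^^ k) X Y \<Longrightarrow> (adj ^^ k) Y X"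
proof (induction k arbitrary: Y)
  case (Suc k)
  then show ?case by (metis adj_sym relpowp_Suc_E relpowp_Suc_I2)
qed simp

lemma near_sym: "near D X Y \<Longrightarrow> near D Y X"
  using relpowp_adj_sym unfolding near_def by blast

lemma near_act: "near D X Y \<Longrightarrow> A \<in> carrier GL2Z \<Longrightarrow> near D (form_act A X) (form_act A Y)"
proof -
  assume A: "A \<in> carrier GL2Z"
  have "(adj ^^ k) X Y \<Longrightarrow> (adj ^^ k) (form_act A X) (form_act A Y)" for k
  proof (induction k arbitrary: Y)
    case (Suc k)
    then show ?case by (metis adj_act[OF _ A] relpowp_Suc_E relpowp_Suc_I)
  qed simp
  then show "near D X Y \<Longrightarrow> near D (form_act A X) (form_act A Y)" unfolding near_def by blast
qed

text \<open>
  The root and the triples that are not superbases are their own parents.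
\<close>

definition parent :: "int \<times> int \<times> int \<Rightarrow> int \<times> int \<times> int"
  where "parent X = (if \<exists>Y. adj X Y \<and> height Y < height X
    then SOME Y. adj X Y \<and> height Y < height X else X)"

lemma parent_eq: "adj X Y \<Longrightarrow> height Y < height X \<Longrightarrow> parent X = Y"
proof -
  assume Y: "adj X Y" "height Y < height X"
  then have "\<exists>Y. adj X Y \<and> height Y < height X" by blast
  from someI_ex[OF this] this have "adj X (parent X)" "height (parent X) < height X"
    by (simp_all add: parent_def)
  then show ?thesis using parent_unique Y by blast
qed

text \<open>
  The conditions on the height make the recursion terminate on all triples; on superbases the
  depth is the distance from the root.
\<close>

function depth :: "int \<times> int \<times> int \<Rightarrow> nat"
  where "depth X = (if 0 < height X \<and> height (parent X) < height X then Suc (depth (parent X)) else 0)"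
  by auto
termination by (relation "measure (nat \<circ> height)") auto

declare depth.simps [simp del]

lemma adj_height_pos: "adj X Y \<Longrightarrow> 0 < height X"
  unfolding adj_def using height_ge_3 by fastforce

lemma depth_pos_parent:
  "0 < depth X \<Longrightarrow> adj X (parent X) \<and> height (parent X) < height X \<and> depth X = Suc (depth (parent X))"
proof -
  assume "0 < depth X"
  then have *: "0 < height X" "height (parent X) < height X" "depth X = Suc (depth (parent X))"
    by (auto simp: depth.simps[of X] split: if_splits)
  then obtain Y where "adj X Y" "height Y < height X" unfolding parent_def by (auto split: if_splits)
  then show ?thesis using parent_eq * by blast
qed

lemma adj_cases:
  assumes "adj X Y"
  obtains "parent X = Y" "depth X = Suc (depth Y)" | "parent Y = X" "depth Y = Suc (depth X)"
proof (cases "height Y < height X")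
  case True
  then show ?thesis
    using parent_eq[OF assms] adj_height_pos[OF assms] that(1) depth.simps[of X] by simp
next
  case False
  then have "height X < height Y" using adj_height_neq[OF assms] by simp
  then show ?thesis
    using parent_eq[OF adj_sym[OF assms]] adj_height_pos[OF adj_sym[OF assms]] that(2) depth.simps[of Y] by simp
qed

lemma ancestor_path: "i \<le> depth X \<Longrightarrow> (adj ^^ i) X ((parent ^^ i) X) \<and> depth ((parent ^^ i) X) = depth X - i"
proof (induction i)
  case (Suc i)
  then have "0 < depth ((parent ^^ i) X)" by simp
  from depth_pos_parent[OF this] show ?case using Suc by (auto intro: relpowp_Suc_I)
qed simp

text \<open>
  A path can be shortened until it first goes up to a common ancestor and then down: a step to
  the parent after a step to a child is undone, because a vertex has only one parent.
\<close>

lemma path_common_ancestor: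
  assumes "(adj ^^ k) X Y"
  shows "\<exists>i j. i + j \<le> k \<and> i \<le> depth X \<and> j \<le> depth Y \<and> (parent ^^ i) X = (parent ^^ j) Y"
  using assms
proof (induction k arbitrary: Y)
  case 0
  then show ?case by auto
next
  case (Suc k)
  then obtain Z where Z: "(adj ^^ k) X Z" "adj Z Y" by auto
  from Suc.IH[OF Z(1)] obtain i j where ij: "i + j \<le> k" "i \<le> depth X" "j \<le> depth Z"
    "(parent ^^ i) X = (parent ^^ j) Z" by blast
  from Z(2) show ?case
  proof (cases rule: adj_cases)
    case 1
    show ?thesis
    proof (cases j)
      case 0
      with ij have "depth Z = depth X - i" using ancestor_path[of i X] by simp
      then show ?thesis using ij 0 1 by (intro exI[of _ "Suc i"] exI[of _ 0]) auto
    next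
      case (Suc j')
      then show ?thesis using ij 1 by (intro exI[of _ i] exI[of _ j']) (auto simp: funpow_Suc_right simp del: funpow.simps)
    qed
  next
    case 2
    then show ?thesis
      using ij by (intro exI[of _ i] exI[of _ "Suc j"]) (auto simp: funpow_Suc_right simp del: funpow.simps)
  qed
qed

lemma common_ancestor_path:
  assumes "(parent ^^ i) X = (parent ^^ j) Y" "i \<le> depth X" "j \<le> depth Y" "i + j \<le> D"
  shows "near D X Y"
proof -
  have "(adj ^^ (i + j)) X Y"
    using ancestor_path[OF assms(2)] relpowp_adj_sym[of j Y] ancestor_path[OF assms(3)] assms(1)
    by (metis relpowp_trans)
  then show ?thesis using assms(4) unfolding near_def by blast
qed

text \<open>
  This is where the tree property enters. The paths from \<open>P\<close> to \<open>Q\<close> and to \<open>R\<close> climb \<open>i1\<close> and \<open>i2\<close>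
  steps and descend \<open>j1 \<le> i1\<close> and \<open>j2 \<le> i2\<close> steps, because \<open>P\<close> is at least as deep as the ends.
  If \<open>i2 \<le> i1\<close>, the path from \<open>Q\<close> through the higher ancestor to \<open>R\<close> has the length
  \<open>j1 + (i1 - i2) + j2 \<le> j1 + i1 \<le> D\<close>.
\<close>

lemma near_merge:
  assumes "near D P Q" "near D P R" "depth Q \<le> depth P" "depth R \<le> depth P"
  shows "near D Q R"
proof -
  obtain i1 j1 where 1: "i1 + j1 \<le> D" "i1 \<le> depth P" "j1 \<le> depth Q" "(parent ^^ i1) P = (parent ^^ j1) Q"
    using assms(1) path_common_ancestor unfolding near_def by (meson le_trans)
  obtain i2 j2 where 2: "i2 + j2 \<le> D" "i2 \<le> depth P" "j2 \<le> depth R" "(parent ^^ i2) P = (parent ^^ j2) R"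
    using assms(2) path_common_ancestor unfolding near_def by (meson le_trans)
  have d: "depth P - i1 = depth Q - j1" "depth P - i2 = depth R - j2"
    using ancestor_path 1 2 by metis+
  show ?thesis
  proof (cases "i2 \<le> i1")
    case True
    have "(parent ^^ j1) Q = (parent ^^ (i1 - i2)) ((parent ^^ i2) P)"
      using 1(4) True by (metis funpow_add comp_apply le_add_diff_inverse2)
    also have "\<dots> = (parent ^^ (i1 - i2 + j2)) R" by (simp add: 2(4) funpow_add)
    finally show ?thesis
      by (rule common_ancestor_path) (use 1 2 d True assms in linarith)+
  next
    case False
    have "(parent ^^ (i2 - i1 + j1)) Q = (parent ^^ (i2 - i1)) ((parent ^^ i1) P)"
      by (simp add: 1(4) funpow_add)
    also have "\<dots> = (parent ^^ j2) R"
      using 2(4) False by (metis funpow_add comp_apply le_add_diff_inverse2 nat_le_linear)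
    finally show ?thesis
      by (rule common_ancestor_path) (use 1 2 d False assms in linarith)+
  qed
qed

lemma depth_root: "depth (superbase (mat 1)) = 0"
proof (rule ccontr)
  assume "depth (superbase (mat 1)) \<noteq> 0"
  then have "0 < depth (superbase (mat 1))" by simp
  then have "height (parent (superbase (mat 1))) < height (superbase (mat 1))"
    "adj (superbase (mat 1)) (parent (superbase (mat 1)))"
    using depth_pos_parent by blast+
  moreover have "height (superbase (mat 1)) = 3" by (simp add: superbase_def Let_def)
  ultimately show False using height_ge_3 mult_in_GL2Z flip_in unfolding adj_def by fastforce
qed

definition gl_ball :: "nat \<Rightarrow> (int^2^2) set"
  where "gl_ball D = {A \<in> carrier GL2Z. near D (superbase (mat 1)) (superbase A)}"

definition mat_prod :: "(int^2^2) list \<Rightarrow> int^2^2"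
  where "mat_prod As = foldr (**) As (mat 1)"

lemma mat_prod_simps [simp]: "mat_prod [] = mat 1" "mat_prod (A # As) = A ** mat_prod As"
  by (simp_all add: mat_prod_def)

lemma mat_prod_append [simp]: "mat_prod (As @ Bs) = mat_prod As ** mat_prod Bs"
  by (induction As) (simp_all add: matrix_mul_assoc)

lemma mat_prod_in_GL2Z: "set As \<subseteq> carrier GL2Z \<Longrightarrow> mat_prod As \<in> carrier GL2Z"
proof (induction As)
  case Nil
  show ?case by (simp add: GL2Z_iff)
qed (auto intro: mult_in_GL2Z)

text \<open>
  The prefixes of the word carry the base vertex around a closed polygon. At a deepest corner
  \<open>near_merge\<close> cuts off the corner, that is, merges the two letters meeting there.
\<close>

theorem gl_ball_merge:
  assumes ks: "set ks \<subseteq> gl_ball D" "2 \<le> length ks" "superbase (mat_prod ks) = superbase (mat 1)"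
  shows "\<exists>us a b vs. ks = us @ [a, b] @ vs \<and> a ** b \<in> gl_ball D"
proof -
  define p where "p j = superbase (mat_prod (take j ks))" for j
  let ?J = "{1..length ks - 1}"
  have "finite ?J" "?J \<noteq> {}" using ks(2) by auto
  then have "Max ((\<lambda>j. depth (p j)) ` ?J) \<in> (\<lambda>j. depth (p j)) ` ?J" by (intro Max_in) auto
  then obtain j where j: "j \<in> ?J" "depth (p j) = Max ((\<lambda>j. depth (p j)) ` ?J)" by auto
  have max: "depth (p i) \<le> depth (p j)" if "i \<le> length ks" for i
  proof (cases "i \<in> ?J")
    case True
    then show ?thesis unfolding j(2) by (intro Max_ge) auto
  next
    case False
    then have "i = 0 \<or> i = length ks" using that by auto
    then show ?thesis using ks(3) depth_root by (auto simp: p_def)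
  qed
  obtain i where i: "j = Suc i" "Suc i < length ks" using j(1) by (cases j) auto
  define P a b where "P = mat_prod (take i ks)" and "a = ks ! i" and "b = ks ! Suc i"
  have split: "ks = take i ks @ [a, b] @ drop (Suc (Suc i)) ks"
    using i(2) id_take_nth_drop[of i ks] Cons_nth_drop_Suc[of "Suc i" ks] by (simp add: a_def b_def)
  have mem: "a \<in> gl_ball D" "b \<in> gl_ball D" using ks(1) i(2) by (auto simp: a_def b_def)
  then have G: "a \<in> carrier GL2Z" "b \<in> carrier GL2Z" by (auto simp: gl_ball_def)
  have "set (take i ks) \<subseteq> carrier GL2Z" using ks(1) set_take_subset[of i ks] by (auto simp: gl_ball_def)
  then have P: "P \<in> carrier GL2Z" unfolding P_def by (rule mat_prod_in_GL2Z)
  have p0: "p i = superbase P" by (simp add: p_def P_def)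
  have p1: "p (Suc i) = superbase (P ** a)"
    using i(2) by (simp add: p_def P_def take_Suc_conv_app_nth a_def)
  have p2: "p (Suc (Suc i)) = superbase (P ** a ** b)"
    using i(2) by (simp add: p_def P_def take_Suc_conv_app_nth a_def b_def matrix_mul_assoc)
  have step: "near D (superbase Q) (superbase (Q ** c))" if "Q \<in> carrier GL2Z" "c \<in> gl_ball D" for Q c
    using near_act[of D "superbase (mat 1)" "superbase c" Q] that
    by (simp add: gl_ball_def superbase_mult[symmetric])
  have "near D (p i) (p (Suc (Suc i)))"
  proof (rule near_merge[of D "p (Suc i)"])
    show "near D (p (Suc i)) (p i)" "near D (p (Suc i)) (p (Suc (Suc i)))"
      unfolding p0 p1 p2 using near_sym[OF step[OF P mem(1)]] step[OF mult_in_GL2Z[OF P G(1)] mem(2)]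
      by auto
    show "depth (p i) \<le> depth (p (Suc i))" "depth (p (Suc (Suc i))) \<le> depth (p (Suc i))"
      using max i by auto
  qed
  from near_act[OF this mat2_inv_in_GL2Z[OF P]]
  have "near D (superbase (mat2_inv P ** P)) (superbase (mat2_inv P ** P ** (a ** b)))"
    unfolding p0 p2 by (simp add: superbase_mult[symmetric] matrix_mul_assoc)
  then have "a ** b \<in> gl_ball D"
    using G mult_in_GL2Z by (simp add: mat2_inv(2)[OF P] gl_ball_def)
  then show ?thesis using split by blast
qed

lemma near_height: "near D X Y \<Longrightarrow> 0 \<le> height X \<Longrightarrow> height Y \<le> 3 ^ D * height X"
proof -
  have k: "(adj ^^ k) X Y \<Longrightarrow> height Y \<le> 3 ^ k * height X" for k
  proof (induction k arbitrary: Y)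
    case (Suc k)
    then obtain Z where "(adj ^^ k) X Z" "adj Z Y" by auto
    then show ?case using Suc.IH[of Z] adj_height_le[of Z Y] by simp
  qed simp
  assume "near D X Y" and X: "0 \<le> height X"
  then obtain k where "k \<le> D" "(adj ^^ k) X Y" unfolding near_def by blast
  moreover from this(1) have "(3 :: int) ^ k * height X \<le> 3 ^ D * height X"
    using X by (intro mult_right_mono power_increasing) auto
  ultimately show ?thesis using k by fastforce
qed

text \<open>
  Every step of Selling's reduction lowers the height, so the height bounds the distance from the
  root.
\<close>

lemma near_root:
  "A \<in> carrier GL2Z \<Longrightarrow> near (nat (height (superbase A))) (superbase (mat 1)) (superbase A)"
proof (induction "nat (height (superbase A))" arbitrary: A rule: less_induct)
  case less
  show ?case
  proof (cases "\<exists>Y. adj (superbase A) Y \<and> height Y < height (superbase A)")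
    case True
    then obtain B where B: "B \<in> carrier GL2Z" "height (superbase (B ** flip)) < height (superbase A)"
      "adj (superbase A) (superbase (B ** flip))"
      unfolding adj_def by blast
    have B': "B ** flip \<in> carrier GL2Z" by (rule mult_in_GL2Z[OF B(1) flip_in])
    then have lt: "nat (height (superbase (B ** flip))) < nat (height (superbase A))"
      using height_ge_3[OF B'] B(2) by linarith
    from less.hyps[OF lt B'] obtain k where "k \<le> nat (height (superbase (B ** flip)))"
      "(adj ^^ k) (superbase (mat 1)) (superbase (B ** flip))" unfolding near_def by blast
    then have "(adj ^^ Suc k) (superbase (mat 1)) (superbase A)" "Suc k \<le> nat (height (superbase A))"
      using adj_sym[OF B(3)] lt by (auto intro: relpowp_Suc_I)
    then show ?thesis unfolding near_def by blast
  next
    case False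
    then have "superbase A = superbase (mat 1)"
      using no_parent_root[OF less.prems] adj_height_neq by (metis linorder_neqE_linordered_idom)
    then show ?thesis unfolding near_def by (intro exI[of _ 0]) simp
  qed
qed

lemma height_le_entries:
  assumes "\<And>i j. \<bar>A $ i $ j\<bar> \<le> int n"
  shows "height (superbase A) \<le> int (18 * n ^ 2)"
proof -
  have "\<bar>A $ i $ j * A $ k $ l\<bar> \<le> int n * int n" for i j k l
    unfolding abs_mult by (rule mult_mono[OF assms assms]) auto
  then have *: "A $ i $ j * A $ k $ l \<le> int n * int n" "- (A $ i $ j * A $ k $ l) \<le> int n * int n" for i j k l
    by (meson abs_le_D1 abs_le_D2)+
  show ?thesis
    using *[of 1 1 1 1] *[of 1 1 1 2] *[of 1 2 1 2] *[of 2 1 2 1] *[of 2 1 2 2] *[of 2 2 2 2]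
      *[of 1 1 2 1] *[of 1 1 2 2] *[of 1 2 2 1] *[of 1 2 2 2]
    by (simp add: superbase_def Let_def power2_eq_square algebra_simps)
qed

lemma in_gl_ball:
  assumes "A \<in> carrier GL2Z" "\<And>i j. \<bar>A $ i $ j\<bar> \<le> int n"
  shows "A \<in> gl_ball (18 * n ^ 2)"
proof -
  have "nat (height (superbase A)) \<le> 18 * n ^ 2" using height_le_entries[OF assms(2)] by linarith
  then show ?thesis
    using near_root[OF assms(1)] assms(1) unfolding gl_ball_def near_def by (auto intro: le_trans)
qed

text \<open>
  The height at most triples along an edge and dominates the entries, so the ball consists of
  matrices with entries of absolute value at most \<open>2 * 3 ^ (D + 1)\<close>.
\<close>

lemma card_gl_ball: "finite (gl_ball D)" "card (gl_ball D) \<le> (4 * 3 ^ Suc D + 1) ^ 4"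
proof -
  define M :: int where "M = 2 * 3 ^ Suc D"
  let ?I = "{-M..M}"
  have sub: "gl_ball D \<subseteq> (\<lambda>(a, b, c, d). mat2 a b c d) ` (?I \<times> ?I \<times> ?I \<times> ?I)"
  proof
    fix A assume A: "A \<in> gl_ball D"
    then have "height (superbase A) \<le> 3 ^ D * height (superbase (mat 1))"
      unfolding gl_ball_def by (intro near_height) (auto simp: superbase_def Let_def)
    then have "height (superbase A) \<le> 3 ^ Suc D" by (simp add: superbase_def Let_def)
    then have "\<bar>A $ i $ j\<bar> \<le> M" for i j
      using entry_le_height[of A i j] A unfolding M_def gl_ball_def by simp
    then have "A $ i $ j \<in> ?I" for i j by (meson abs_le_iff atLeastAtMost_iff minus_le_iff)
    moreover have "A = mat2 (A$1$1) (A$1$2) (A$2$1) (A$2$2)" by (simp add: mat2_eq_iff)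
    ultimately show "A \<in> (\<lambda>(a, b, c, d). mat2 a b c d) ` (?I \<times> ?I \<times> ?I \<times> ?I)"
      by (intro image_eqI[of _ _ "(A$1$1, A$1$2, A$2$1, A$2$2)"]) auto
  qed
  have "card ?I = 4 * 3 ^ Suc D + 1" by (simp add: M_def nat_add_distrib nat_mult_distrib nat_power_eq)
  then have "card (?I \<times> ?I \<times> ?I \<times> ?I) = (4 * 3 ^ Suc D + 1) ^ 4"
    by (simp only: card_cartesian_product power4_eq_xxxx mult.assoc)
  then show "finite (gl_ball D)" "card (gl_ball D) \<le> (4 * 3 ^ Suc D + 1) ^ 4"
    using sub finite_subset[OF sub] card_mono[OF _ sub]
      card_image_le[of "?I \<times> ?I \<times> ?I \<times> ?I" "\<lambda>(a, b, c, d). mat2 a b c d"] by auto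
qed


section \<open>Normal forms in free products\<close>

text \<open>
  A word in normal form is kept as a stack whose top is its first letter, and these functions
  multiply it by a letter from the left. Multiplication and the test for triviality are parameters,
  because the algorithm runs on matrices that represent the elements of a group up to sign.
\<close>

fun push_l :: "('a \<Rightarrow> 'a \<Rightarrow> 'a) \<Rightarrow> ('a \<Rightarrow> bool) \<Rightarrow> 'a \<Rightarrow> ('a + 'b) list \<Rightarrow> ('a + 'b) list"
where
  "push_l m triv a (Inl b # s) = (if triv (m a b) then s else Inl (m a b) # s)"
| "push_l m triv a s = (if triv a then s else Inl a # s)"

fun push_r :: "('b \<Rightarrow> 'b \<Rightarrow> 'b) \<Rightarrow> ('b \<Rightarrow> bool) \<Rightarrow> 'b \<Rightarrow> ('a + 'b) list \<Rightarrow> ('a + 'b) list"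
where
  "push_r m triv a (Inr b # s) = (if triv (m a b) then s else Inr (m a b) # s)"
| "push_r m triv a s = (if triv a then s else Inr a # s)"

lemma syllables_cases:
  obtains (nil) "s = []" | (inl) x r where "s = Inl x # r" | (inr) y r where "s = Inr y # r"
  by (metis list.exhaust sum.exhaust)

text \<open>
  Van der Waerden's trick: the letters act on the words in normal form. As this action respects the
  defining relations of the free product, an element of the free product has only one normal form.
\<close>

definition fp_push ::
  "('a, 'm) monoid_scheme \<Rightarrow> ('b, 'n) monoid_scheme \<Rightarrow> 'a + 'b \<Rightarrow> ('a + 'b) list \<Rightarrow> ('a + 'b) list"
  where "fp_push A B c s = (case c of
    Inl a \<Rightarrow> push_l (monoid.mult A) (\<lambda>x. x = \<one>\<^bsub>A\<^esub>) a s
  | Inr b \<Rightarrow> push_r (monoid.mult B) (\<lambda>x. x = \<one>\<^bsub>B\<^esub>) b s)"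

fun fp_reduced :: "('a, 'm) monoid_scheme \<Rightarrow> ('b, 'n) monoid_scheme \<Rightarrow> ('a + 'b) list \<Rightarrow> bool"
where
  "fp_reduced A B [] \<longleftrightarrow> True"
| "fp_reduced A B (Inl a # s) \<longleftrightarrow>
    a \<in> carrier A \<and> a \<noteq> \<one>\<^bsub>A\<^esub> \<and> (\<forall>x r. s \<noteq> Inl x # r) \<and> fp_reduced A B s"
| "fp_reduced A B (Inr b # s) \<longleftrightarrow>
    b \<in> carrier B \<and> b \<noteq> \<one>\<^bsub>B\<^esub> \<and> (\<forall>x r. s \<noteq> Inr x # r) \<and> fp_reduced A B s"

context
  fixes A :: "('a, 'm) monoid_scheme" and B :: "('b, 'n) monoid_scheme"
  assumes A: "group A" and B: "group B"
begin

private abbreviation "W \<equiv> lists (carrier A <+> carrier B)"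
private abbreviation "push \<equiv> fp_push A B"
private abbreviation "reduced \<equiv> fp_reduced A B"

interpretation A: group A by (fact A)
interpretation B: group B by (fact B)

lemma reduced_push: "c \<in> carrier A <+> carrier B \<Longrightarrow> reduced s \<Longrightarrow> reduced (push c s)"
  by (cases c; cases s rule: syllables_cases) (auto simp: fp_push_def)

lemma reduced_pushes: "u \<in> W \<Longrightarrow> reduced s \<Longrightarrow> reduced (foldr push u s)"
  by (induction u) (auto intro: reduced_push)

lemma push_l_mult:
  assumes "a \<in> carrier A" "a' \<in> carrier A" "reduced s"
  shows "push (Inl a) (push (Inl a') s) = push (Inl (a \<otimes>\<^bsub>A\<^esub> a')) s"
proof (cases s rule: syllables_cases)
  case nil
  then show ?thesis using assms by (auto simp: fp_push_def)
next
  case (inl x r)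
  with assms have x: "x \<in> carrier A" "x \<noteq> \<one>\<^bsub>A\<^esub>" and r: "\<forall>x q. r \<noteq> Inl x # q" by auto
  have push_r: "push (Inl b) r = (if b = \<one>\<^bsub>A\<^esub> then r else Inl b # r)" for b
    using r by (cases r rule: syllables_cases) (auto simp: fp_push_def)
  show ?thesis
  proof (cases "a' \<otimes>\<^bsub>A\<^esub> x = \<one>\<^bsub>A\<^esub>")
    case True
    then have "a \<otimes>\<^bsub>A\<^esub> a' \<otimes>\<^bsub>A\<^esub> x = a" using assms x by (simp add: A.m_assoc)
    then show ?thesis using True push_r[of a] by (auto simp: inl fp_push_def)
  next
    case False
    then show ?thesis using assms x by (simp add: inl fp_push_def A.m_assoc)
  qed
next
  case (inr y r)
  then show ?thesis using assms by (auto simp: fp_push_def)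
qed

lemma push_r_mult:
  assumes "a \<in> carrier B" "a' \<in> carrier B" "reduced s"
  shows "push (Inr a) (push (Inr a') s) = push (Inr (a \<otimes>\<^bsub>B\<^esub> a')) s"
proof (cases s rule: syllables_cases)
  case nil
  then show ?thesis using assms by (auto simp: fp_push_def)
next
  case (inr x r)
  with assms have x: "x \<in> carrier B" "x \<noteq> \<one>\<^bsub>B\<^esub>" and r: "\<forall>x q. r \<noteq> Inr x # q" by auto
  have push_r: "push (Inr b) r = (if b = \<one>\<^bsub>B\<^esub> then r else Inr b # r)" for b
    using r by (cases r rule: syllables_cases) (auto simp: fp_push_def)
  show ?thesis
  proof (cases "a' \<otimes>\<^bsub>B\<^esub> x = \<one>\<^bsub>B\<^esub>")
    case True
    then have "a \<otimes>\<^bsub>B\<^esub> a' \<otimes>\<^bsub>B\<^esub> x = a" using assms x by (simp add: B.m_assoc)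
    then show ?thesis using True push_r[of a] by (auto simp: inr fp_push_def)
  next
    case False
    then show ?thesis using assms x by (simp add: inr fp_push_def B.m_assoc)
  qed
next
  case (inl y r)
  then show ?thesis using assms by (auto simp: fp_push_def)
qed

lemma push_one:
  assumes "reduced s"
  shows "push (Inl \<one>\<^bsub>A\<^esub>) s = s" "push (Inr \<one>\<^bsub>B\<^esub>) s = s"
  using assms by (cases s rule: syllables_cases; auto simp: fp_push_def)+

lemma pushes_step:
  assumes "(u, v) \<in> fp_step A B"
  shows "foldr push u [] = foldr push v []"
  using assms
  by cases (simp_all add: reduced_pushes push_l_mult push_r_mult push_one)

lemma pushes_rel:
  assumes "(u, v) \<in> fp_rel A B"
  shows "foldr push u [] = foldr push v []"
proof -
  have "(u, v) \<in> (fp_step A B \<union> (fp_step A B)\<inverse>)\<^sup>*"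
    using assms unfolding fp_rel_def by blast
  then show ?thesis by induction (auto dest: pushes_step)
qed

lemma push_rel:
  assumes c: "c \<in> carrier A <+> carrier B" and s: "s \<in> W"
  shows "(c # s, push c s) \<in> fp_rel A B"
proof -
  have step: "(u, v) \<in> fp_rel A B" if "(u, v) \<in> fp_step A B" "u \<in> W" "v \<in> W" for u v
    using that unfolding fp_rel_def by blast
  have trans: "(u, w) \<in> fp_rel A B" if "(u, v) \<in> fp_rel A B" "(v, w) \<in> fp_rel A B" for u v w
    using that equivE[OF fp_rel_equiv] by (auto elim: transE)
  have refl: "(u, u) \<in> fp_rel A B" if "u \<in> W" for u using that unfolding fp_rel_def by auto
  have one: "(Inl \<one>\<^bsub>A\<^esub> # r, r) \<in> fp_rel A B" "(Inr \<one>\<^bsub>B\<^esub> # r, r) \<in> fp_rel A B" if "r \<in> W" for r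
    using fp_step.one_l[of "[]" A B r] fp_step.one_r[of "[]" A B r] that by (auto intro!: step)
  have l: "(Inl a # Inl x # r, Inl (a \<otimes>\<^bsub>A\<^esub> x) # r) \<in> fp_rel A B"
    if "a \<in> carrier A" "x \<in> carrier A" "r \<in> W" for a x r
    using fp_step.mult_l[of "[]" A B r a x] that by (auto intro!: step)
  have r: "(Inr a # Inr x # r, Inr (a \<otimes>\<^bsub>B\<^esub> x) # r) \<in> fp_rel A B"
    if "a \<in> carrier B" "x \<in> carrier B" "r \<in> W" for a x r
    using fp_step.mult_r[of "[]" A B r a x] that by (auto intro!: step)
  have cs: "c # s \<in> W" using c s by simp
  show ?thesis
  proof (cases c)
    case (Inl a)
    with c have a: "a \<in> carrier A" by auto
    show ?thesis
    proof (cases s rule: syllables_cases)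
      case (inl x q)
      then have "x \<in> carrier A" "q \<in> W" using s by auto
      with l[of a x q] one(1)[of q] show ?thesis using a Inl inl trans by (auto simp: fp_push_def)
    qed (use Inl one(1)[OF s] refl[OF cs] in \<open>auto simp: fp_push_def\<close>)
  next
    case (Inr a)
    with c have a: "a \<in> carrier B" by auto
    show ?thesis
    proof (cases s rule: syllables_cases)
      case (inr x q)
      then have "x \<in> carrier B" "q \<in> W" using s by auto
      with r[of a x q] one(2)[of q] show ?thesis using a Inr inr trans by (auto simp: fp_push_def)
    qed (use Inr one(2)[OF s] refl[OF cs] in \<open>auto simp: fp_push_def\<close>)
  qed
qed

lemma pushes_in_rel:
  assumes "u \<in> W"
  shows "(u, foldr push u []) \<in> fp_rel A B"
  using assms
proof (induction u)
  case Nil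
  then show ?case by (simp add: fp_rel_def)
next
  case (Cons c u)
  then have *: "c \<in> carrier A <+> carrier B" "u \<in> W" "(u, foldr push u []) \<in> fp_rel A B" by auto
  have "([c], [c]) \<in> fp_rel A B" using *(1) unfolding fp_rel_def by auto
  from fp_rel_append[OF this *(3)] have "(c # u, c # foldr push u []) \<in> fp_rel A B" by simp
  moreover have "foldr push u [] \<in> W" using *(3) unfolding fp_rel_def by auto
  then have "(c # foldr push u [], foldr push (c # u) []) \<in> fp_rel A B"
    using push_rel[OF *(1)] by simp
  ultimately show ?case using equivE[OF fp_rel_equiv] by (auto elim: transE)
qed

text \<open>
  The stack machine changes a word only within its class (\<open>pushes_in_rel\<close>), and equivalent words
  end in the same stack (\<open>pushes_rel\<close>).
\<close>

theorem class_eq_one_iff: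
  assumes "u \<in> W"
  shows "fp_rel A B `` {u} = \<one>\<^bsub>free_product A B\<^esub> \<longleftrightarrow> foldr push u [] = []"
proof
  assume "fp_rel A B `` {u} = \<one>\<^bsub>free_product A B\<^esub>"
  then have "(u, []) \<in> fp_rel A B"
    unfolding free_product_one by (rule eq_equiv_class[OF _ fp_rel_equiv]) simp
  from pushes_rel[OF this] show "foldr push u [] = []" by simp
next
  assume "foldr push u [] = []"
  then have "(u, []) \<in> fp_rel A B" using pushes_in_rel[OF assms] by simp
  then show "fp_rel A B `` {u} = \<one>\<^bsub>free_product A B\<^esub>"
    unfolding free_product_one by (rule equiv_class_eq[OF fp_rel_equiv])
qed

end


section \<open>Relators of bounded length\<close>

definition letter_value :: "('a, 'm) monoid_scheme \<Rightarrow> 'a list \<Rightarrow> 'a \<Rightarrow> nat \<times> int \<Rightarrow> 'a"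
  where "letter_value G hs g l = (case l of (0, k) \<Rightarrow> g [^]\<^bsub>G\<^esub> k | (Suc i, k) \<Rightarrow> (hs ! i) [^]\<^bsub>G\<^esub> k)"

definition word_value :: "('a, 'm) monoid_scheme \<Rightarrow> 'a list \<Rightarrow> 'a \<Rightarrow> eqn_word \<Rightarrow> 'a"
  where "word_value G hs g w = foldr (\<lambda>l. monoid.mult G (letter_value G hs g l)) w \<one>\<^bsub>G\<^esub>"

definition eqn_letter :: "('a, 'm) monoid_scheme \<Rightarrow> 'a list \<Rightarrow> nat \<times> int \<Rightarrow> 'a + int"
  where "eqn_letter G hs l = (case l of (0, k) \<Rightarrow> Inr k | (Suc i, k) \<Rightarrow> Inl ((hs ! i) [^]\<^bsub>G\<^esub> k))"

text \<open>
  Exponents other than \<open>\<plusminus>1\<close> can be spelled out, so there are only finitely many letters to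
  consider.
\<close>

definition unit_word :: "'a list \<Rightarrow> eqn_word \<Rightarrow> bool"
  where "unit_word hs w \<longleftrightarrow> valid_eqn_word hs w \<and> (\<forall>(j, k) \<in> set w. k = 1 \<or> k = -1)"

definition inv_word :: "eqn_word \<Rightarrow> eqn_word"
  where "inv_word w = rev (map (\<lambda>(j, k). (j, - k)) w)"

lemma letter_value_simps [simp]:
  "letter_value G hs g (0, k) = g [^]\<^bsub>G\<^esub> k"
  "letter_value G hs g (Suc i, k) = (hs ! i) [^]\<^bsub>G\<^esub> k"
  by (simp_all add: letter_value_def)

lemma eqn_letter_simps [simp]:
  "eqn_letter G hs (0, k) = Inr k"
  "eqn_letter G hs (Suc i, k) = Inl ((hs ! i) [^]\<^bsub>G\<^esub> k)"
  by (simp_all add: eqn_letter_def)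

lemma word_value_Nil [simp]: "word_value G hs g [] = \<one>\<^bsub>G\<^esub>"
  and word_value_Cons [simp]: "word_value G hs g (l # w) = letter_value G hs g l \<otimes>\<^bsub>G\<^esub> word_value G hs g w"
  by (simp_all add: word_value_def)

lemma valid_eqn_word_simps [simp]:
  "valid_eqn_word hs []"
  "valid_eqn_word hs ((j, k) # w) \<longleftrightarrow> j \<le> length hs \<and> valid_eqn_word hs w"
  "valid_eqn_word hs (u @ w) \<longleftrightarrow> valid_eqn_word hs u \<and> valid_eqn_word hs w"
  by (auto simp: valid_eqn_word_def)

lemma unit_word_simps [simp]:
  "unit_word hs []"
  "unit_word hs ((j, k) # w) \<longleftrightarrow> j \<le> length hs \<and> (k = 1 \<or> k = -1) \<and> unit_word hs w"
  "unit_word hs (u @ w) \<longleftrightarrow> unit_word hs u \<and> unit_word hs w"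
  "unit_word hs (inv_word w) \<longleftrightarrow> unit_word hs w"
  by (auto simp: unit_word_def inv_word_def valid_eqn_word_def)

lemma length_inv_word [simp]: "length (inv_word w) = length w"
  by (simp add: inv_word_def)

context
  fixes G :: "('a, 'm) monoid_scheme" (structure) and hs :: "'a list" and g :: 'a
  assumes G: "group G" and hs: "set hs \<subseteq> carrier G" and g: "g \<in> carrier G"
begin

interpretation group G by (fact G)

private abbreviation "H \<equiv> generate G (set hs)"
private abbreviation "E \<equiv> equations G H"
private abbreviation "EW \<equiv> lists (H <+> (UNIV :: int set))"
private abbreviation "ER \<equiv> fp_rel (G\<lparr>carrier := H\<rparr>) integer_group"
private abbreviation "eqn \<equiv> eqn_of_word G H hs"
private abbreviation "val \<equiv> word_value G hs g"

lemma generate_subgroup: "subgroup H G" by (rule generate_is_subgroup[OF hs])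

interpretation E: group E by (rule equations_group[OF G generate_subgroup g])

interpretation ev: group_hom E G "eval_eq G g"
  by (unfold_locales) (rule eval_eq_hom[OF G generate_subgroup g])

lemma nth_power_in_H: "i < length hs \<Longrightarrow> (hs ! i) [^] (k :: int) \<in> H"
proof -
  assume "i < length hs"
  then have "hs ! i \<in> H" by (intro generate.incl) simp
  then show ?thesis by (rule subgroup_int_pow_closed[OF generate_subgroup])
qed

private lemma E_mult: "u \<in> EW \<Longrightarrow> v \<in> EW \<Longrightarrow> ER `` {u} \<otimes>\<^bsub>E\<^esub> ER `` {v} = ER `` {u @ v}"
  unfolding equations_def using free_product_mult[of u "G\<lparr>carrier := H\<rparr>" integer_group v] by simp

private lemma E_carrier: "carrier E = EW // ER"
  unfolding equations_def free_product_carrier by simp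

private lemma E_one: "\<one>\<^bsub>E\<^esub> = ER `` {[]}"
  unfolding equations_def free_product_one by simp

lemma eqn_letters_in: "valid_eqn_word hs w \<Longrightarrow> map (eqn_letter G hs) w \<in> EW"
proof (induction w)
  case (Cons l w)
  obtain j k where l: "l = (j, k)" by (cases l)
  then show ?case using Cons nth_power_in_H[of _ k] by (cases j) auto
qed simp

lemma eqn_of_word_class:
  "valid_eqn_word hs w \<Longrightarrow> eqn w = ER `` {map (eqn_letter G hs) w}"
proof (induction w)
  case (Cons l w)
  obtain j k where l: "l = (j, k)" by (cases l)
  have w: "map (eqn_letter G hs) w \<in> EW" "valid_eqn_word hs w" using Cons.prems l eqn_letters_in by auto
  show ?case
  proof (cases j)
    case 0
    then show ?thesis
      using Cons.IH[OF w(2)] E_mult[OF _ w(1), of "[Inr k]"] InrI[of k UNIV H] by (simp add: l var_pow_def)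
  next
    case (Suc i)
    then have "i < length hs" using Cons.prems l by simp
    then show ?thesis
      using Cons.IH[OF w(2)] E_mult[OF _ w(1), of "[Inl (hs ! i [^] k)]"]
        InlI[OF nth_power_in_H[OF \<open>i < length hs\<close>, of k], of UNIV] Suc
      by (simp add: l const_eq_def)
  qed
qed (simp add: E_one)

lemma const_eq_in [simp]: "h \<in> H \<Longrightarrow> const_eq G H h \<in> carrier E"
  unfolding const_eq_def E_carrier by (rule quotientI) auto

lemma var_pow_in [simp]: "var_pow G H k \<in> carrier E"
  unfolding var_pow_def E_carrier by (rule quotientI) auto

lemma const_eq_mult:
  assumes "h \<in> H" "h' \<in> H"
  shows "const_eq G H (h \<otimes> h') = const_eq G H h \<otimes>\<^bsub>E\<^esub> const_eq G H h'"
proof -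
  have "([Inl h, Inl h'], [Inl (h \<otimes> h')]) \<in> fp_step (G\<lparr>carrier := H\<rparr>) integer_group"
    using fp_step.mult_l[of "[]" "G\<lparr>carrier := H\<rparr>" integer_group "[]" h h'] assms by simp
  moreover have "h \<otimes> h' \<in> H" using assms by (rule generate.eng)
  ultimately have "([Inl h, Inl h'], [Inl (h \<otimes> h')]) \<in> ER"
    using assms unfolding fp_rel_def by auto
  then show ?thesis
    using equiv_class_eq[OF fp_rel_equiv] E_mult[of "[Inl h]" "[Inl h']"] assms
    unfolding const_eq_def by fastforce
qed

lemma var_pow_add: "var_pow G H (k + l) = var_pow G H k \<otimes>\<^bsub>E\<^esub> var_pow G H l"
proof -
  have "([Inr k, Inr l], [Inr (k + l)]) \<in> fp_step (G\<lparr>carrier := H\<rparr>) integer_group"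
    using fp_step.mult_r[of "[]" "G\<lparr>carrier := H\<rparr>" integer_group "[]" k l] by simp
  then have "([Inr k, Inr l], [Inr (k + l)]) \<in> ER"
    unfolding fp_rel_def by auto
  then show ?thesis
    using equiv_class_eq[OF fp_rel_equiv] E_mult[of "[Inr k]" "[Inr l]"]
    unfolding var_pow_def by fastforce
qed

lemma const_var_one: "const_eq G H \<one> = \<one>\<^bsub>E\<^esub>" "var_pow G H 0 = \<one>\<^bsub>E\<^esub>"
proof -
  have "\<one> \<in> H" by (rule generate.one)
  then have "const_eq G H \<one> \<otimes>\<^bsub>E\<^esub> const_eq G H \<one> = const_eq G H \<one>"
    using const_eq_mult[of \<one> \<one>] by simp
  then show "const_eq G H \<one> = \<one>\<^bsub>E\<^esub>" using \<open>\<one> \<in> H\<close> by (metis E.l_cancel_one const_eq_in)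
  have "var_pow G H 0 \<otimes>\<^bsub>E\<^esub> var_pow G H 0 = var_pow G H 0" using var_pow_add[of 0 0] by simp
  then show "var_pow G H 0 = \<one>\<^bsub>E\<^esub>" by (metis E.l_cancel_one var_pow_in)
qed

lemma eqn_of_word_in [simp]: "valid_eqn_word hs w \<Longrightarrow> eqn w \<in> carrier E"
  using eqn_letters_in unfolding E_carrier by (simp add: eqn_of_word_class quotientI)

lemma eqn_of_word_append:
  "valid_eqn_word hs u \<Longrightarrow> valid_eqn_word hs v \<Longrightarrow> eqn (u @ v) = eqn u \<otimes>\<^bsub>E\<^esub> eqn v"
  using eqn_letters_in by (simp add: eqn_of_word_class E_mult del: append_in_lists_conv)

lemma valid_inv_word: "valid_eqn_word hs w \<Longrightarrow> valid_eqn_word hs (inv_word w)"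
  by (auto simp: inv_word_def valid_eqn_word_def)

lemma eqn_of_word_inv: "valid_eqn_word hs w \<Longrightarrow> eqn (inv_word w) = inv\<^bsub>E\<^esub> eqn w"
proof (induction w)
  case (Cons l w)
  obtain j k where l: "l = (j, k)" by (cases l)
  have w: "valid_eqn_word hs w" "j \<le> length hs" using Cons.prems l by auto
  have "eqn [(j, - k)] \<otimes>\<^bsub>E\<^esub> eqn [(j, k)] = \<one>\<^bsub>E\<^esub>"
  proof (cases j)
    case 0
    then show ?thesis using var_pow_add[of "- k" k, symmetric] const_var_one by simp
  next
    case (Suc i)
    then have i: "i < length hs" using w(2) by simp
    have "(hs ! i) [^] (- k) \<otimes> (hs ! i) [^] k = \<one>"
      using i hs int_pow_mult[of "hs ! i" "- k" k] by (simp add: subset_iff)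
    then show ?thesis
      using Suc const_eq_mult[OF nth_power_in_H[OF i, of "- k"] nth_power_in_H[OF i, of k], symmetric]
        const_var_one nth_power_in_H[OF i] by simp
  qed
  then have "inv\<^bsub>E\<^esub> eqn [(j, k)] = eqn [(j, - k)]" using w(2) by (intro E.inv_equality) auto
  moreover have "eqn (l # w) = eqn [(j, k)] \<otimes>\<^bsub>E\<^esub> eqn w"
    using eqn_of_word_append[of "[(j, k)]" w] w by (simp add: l)
  moreover have "eqn (inv_word (l # w)) = eqn (inv_word w) \<otimes>\<^bsub>E\<^esub> eqn [(j, - k)]"
    using eqn_of_word_append[of "inv_word w" "[(j, - k)]"] valid_inv_word w by (simp add: l inv_word_def)
  ultimately show ?case
    using Cons.IH[OF w(1)] w by (simp add: E.inv_mult_group del: eqn_of_word.simps)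
qed (simp add: inv_word_def)

lemma eval_eqn_of_word: "valid_eqn_word hs w \<Longrightarrow> eval_eq G g (eqn w) = val w"
proof (induction w)
  case (Cons l w)
  obtain j k where l: "l = (j, k)" by (cases l)
  have w: "valid_eqn_word hs w" using Cons.prems l by auto
  show ?case
  proof (cases j)
    case 0
    then show ?thesis
      using Cons.IH[OF w] w by (simp add: l eval_eq_var[OF G generate_subgroup g])
  next
    case (Suc i)
    then have "i < length hs" using Cons.prems l by simp
    then show ?thesis
      using Cons.IH[OF w] w nth_power_in_H Suc
      by (simp add: l eval_eq_const[OF G generate_subgroup g])
  qed
qed simp

lemma letter_value_in: "j \<le> length hs \<Longrightarrow> letter_value G hs g (j, k) \<in> carrier G"
  using nth_power_in_H[of "j - 1" k] subgroup.mem_carrier[OF generate_subgroup] g by (cases j) auto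

lemma word_value_in: "valid_eqn_word hs w \<Longrightarrow> val w \<in> carrier G"
  by (induction w) (auto simp: letter_value_in)

lemma word_value_append:
  "valid_eqn_word hs u \<Longrightarrow> valid_eqn_word hs v \<Longrightarrow> val (u @ v) = val u \<otimes> val v"
  by (induction u) (auto simp: letter_value_in word_value_in m_assoc)

lemma word_value_inv: "valid_eqn_word hs w \<Longrightarrow> val (inv_word w) = inv (val w)"
proof (induction w)
  case (Cons l w)
  obtain j k where l: "l = (j, k)" by (cases l)
  have w: "valid_eqn_word hs w" "j \<le> length hs" using Cons.prems l by auto
  have "letter_value G hs g (j, - k) = inv (letter_value G hs g (j, k))"
    using w(2) hs g by (cases j) (auto simp: int_pow_neg subset_iff)
  moreover have "valid_eqn_word hs (inv_word w)" using w by (auto simp: inv_word_def valid_eqn_word_def)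
  ultimately show ?case
    using Cons.IH[OF w(1)] w letter_value_in word_value_in word_value_append[of "inv_word w" "[(j, - k)]"]
    by (simp add: l inv_word_def inv_mult_group)
qed (simp add: inv_word_def)

lemma valid_if_unit: "unit_word hs w \<Longrightarrow> valid_eqn_word hs w"
  by (simp add: unit_word_def)

lemma unit_word_exists:
  assumes "X \<in> carrier E"
  shows "\<exists>w. unit_word hs w \<and> X = eqn w"
proof -
  have app: "\<exists>w. unit_word hs w \<and> eqn u \<otimes>\<^bsub>E\<^esub> eqn v = eqn w"
    if "unit_word hs u" "unit_word hs v" for u v
    using that eqn_of_word_append valid_if_unit by (intro exI[of _ "u @ v"]) auto
  have var: "\<exists>w. unit_word hs w \<and> var_pow G H k = eqn w" for k
  proof (induction k rule: int_induct[of _ 0])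
    case base
    show ?case using const_var_one by (intro exI[of _ "[]"]) simp
  next
    case (step1 i)
    then show ?case using app[of _ "[(0, 1)]"] var_pow_add[of i 1] by fastforce
  next
    case (step2 i)
    then show ?case using app[of _ "[(0, -1)]"] var_pow_add[of i "-1"] by fastforce
  qed
  have const: "\<exists>w. unit_word hs w \<and> const_eq G H h = eqn w" if "h \<in> H" for h
    using that
  proof (induction h rule: generate.induct)
    case one
    show ?case using const_var_one by (intro exI[of _ "[]"]) simp
  next
    case (incl h)
    then obtain i where "i < length hs" "h = hs ! i" by (metis in_set_conv_nth)
    moreover have "h \<in> carrier G" using incl hs by blast
    ultimately show ?case
      using E.r_one[OF const_eq_in[of h]] incl by (intro exI[of _ "[(Suc i, 1)]"]) (auto simp: generate.incl)
  next
    case (inv h)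
    then obtain i where "i < length hs" "h = hs ! i" by (metis in_set_conv_nth)
    moreover have "h \<in> carrier G" using inv hs by blast
    ultimately show ?case
      using E.r_one[OF const_eq_in[of "inv h"]] inv
      by (intro exI[of _ "[(Suc i, -1)]"]) (auto simp: generate.inv int_pow_neg)
  next
    case (eng h h')
    then show ?case using const_eq_mult[of h h'] app by metis
  qed
  obtain u where u: "u \<in> EW" "X = ER `` {u}" using assms unfolding E_carrier by (auto elim!: quotientE)
  have "\<exists>w. unit_word hs w \<and> ER `` {u} = eqn w" using u(1)
  proof (induction u)
    case Nil
    then show ?case by (intro exI[of _ "[]"]) (simp add: E_one)
  next
    case (Cons c u)
    then obtain v where v: "unit_word hs v" "ER `` {u} = eqn v" by auto
    have *: "ER `` {c # u} = ER `` {[c]} \<otimes>\<^bsub>E\<^esub> ER `` {u}"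
      using E_mult[of "[c]" u] Cons by simp
    obtain v' where "unit_word hs v'" "ER `` {[c]} = eqn v'"
    proof (cases c)
      case (Inl h)
      then have "h \<in> H" using Cons by auto
      from const[OF this] that show ?thesis unfolding Inl const_eq_def by blast
    next
      case (Inr k)
      from var[of k] that show ?thesis unfolding Inr var_pow_def by blast
    qed
    with v * app show ?case by metis
  qed
  with u show ?thesis by simp
qed

lemma eqn_word_trivial_iff:
  assumes "valid_eqn_word hs w"
  shows "eqn w = \<one>\<^bsub>E\<^esub> \<longleftrightarrow>
    ER `` {map (eqn_letter G hs) w} = \<one>\<^bsub>free_product (G\<lparr>carrier := H\<rparr>) integer_group\<^esub>"
  unfolding eqn_of_word_class[OF assms] equations_def ..

text \<open>
  Let \<open>T L\<close> consist of the elements of \<open>B\<close> that are values of words of length at most \<open>L\<close>. The sets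
  \<open>T 1 \<subseteq> T 2 \<subseteq> T 4 \<subseteq> \<dots>\<close> cannot grow at each of the first \<open>card B + 1\<close> steps, so \<open>T (2 * L) = T L\<close>
  for some \<open>L \<le> 2 ^ card B\<close>. A relator is viewed as a sequence of blocks of length at most \<open>L\<close>
  with values in \<open>B\<close>, initially its letters. If \<open>u\<close> and \<open>v\<close> are adjacent blocks whose product is
  in \<open>B\<close>, then the value of \<open>u v\<close> is also that of some block \<open>x\<close> by the choice of \<open>L\<close>. Replacing
  \<open>u v\<close> by \<open>x\<close> costs a conjugate of the relator \<open>u v x\<^sup>-\<^sup>1\<close> of length at most \<open>3 * L\<close> and lowers the
  number of blocks.
\<close>

theorem ideal_generated_by_short_relators:
  fixes B :: "'a set"
  assumes fin: "finite B"
    and gens: "\<And>j. j \<le> length hs \<Longrightarrow> letter_value G hs g (j, 1) \<in> B \<and> letter_value G hs g (j, -1) \<in> B"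
    and merge: "\<And>ks. set ks \<subseteq> B \<Longrightarrow> 2 \<le> length ks \<Longrightarrow> foldr (\<otimes>) ks \<one> = \<one>
      \<Longrightarrow> \<exists>us a b vs. ks = us @ [a, b] @ vs \<and> a \<otimes> b \<in> B"
    and R: "\<And>w. unit_word hs w \<Longrightarrow> length w \<le> 3 * 2 ^ card B \<Longrightarrow> val w = \<one> \<Longrightarrow> eqn w \<noteq> \<one>\<^bsub>E\<^esub> \<Longrightarrow> w \<in> R"
  shows "equation_ideal G H g \<subseteq> normal_closure E (eqn ` R)"
proof -
  define N where "N = normal_closure E (eqn ` R)"
  define T where "T L = {b \<in> B. \<exists>w. unit_word hs w \<and> length w \<le> L \<and> val w = b}" for L :: nat
  have T_mono: "T L \<subseteq> T L'" if "L \<le> L'" for L L' using that unfolding T_def by (blast intro: le_trans)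
  have T_fin: "finite (T L)" "card (T L) \<le> card B" for L
    using fin card_mono[OF fin] unfolding T_def by auto
  have "\<exists>t\<le>card B. T (2 ^ t) = T (2 ^ Suc t)"
  proof (rule ccontr)
    assume no: "\<not> (\<exists>t\<le>card B. T (2 ^ t) = T (2 ^ Suc t))"
    have "t \<le> card (T (2 ^ t))" if "t \<le> Suc (card B)" for t
      using that
    proof (induction t)
      case (Suc t)
      then have "T (2 ^ t) \<noteq> T (2 ^ Suc t)" using no that by auto
      moreover have "T (2 ^ t) \<subseteq> T (2 ^ Suc t)" by (rule T_mono) simp
      ultimately have "card (T (2 ^ t)) < card (T (2 ^ Suc t))"
        using T_fin by (intro psubset_card_mono) auto
      then show ?case using Suc by simp
    qed simp
    from this[of "Suc (card B)"] T_fin(2)[of "2 ^ Suc (card B)"] show False by simp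
  qed
  then obtain t where t: "t \<le> card B" "T (2 ^ t) = T (2 ^ Suc t)" by blast
  define L :: nat where "L = 2 ^ t"
  have L: "1 \<le> L" "3 * L \<le> 3 * 2 ^ card B" "T (2 * L) = T L"
    using t by (auto simp: L_def intro: power_increasing)
  have one: "\<one>\<^bsub>E\<^esub> \<in> N" unfolding N_def normal_closure_def by (rule generate.one)
  have mult: "X \<otimes>\<^bsub>E\<^esub> Y \<in> N" if "X \<in> N" "Y \<in> N" for X Y
    using that unfolding N_def normal_closure_def by (rule generate.eng)
  have relator: "X \<otimes>\<^bsub>E\<^esub> eqn r \<otimes>\<^bsub>E\<^esub> inv\<^bsub>E\<^esub> X \<in> N"
    if "X \<in> carrier E" "unit_word hs r" "length r \<le> 3 * L" "val r = \<one>" for X r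
  proof (cases "eqn r = \<one>\<^bsub>E\<^esub>")
    case True
    then show ?thesis using that one by simp
  next
    case False
    then have "r \<in> R" using R that L by (meson le_trans)
    then show ?thesis using that unfolding N_def normal_closure_def by (intro generate.incl) blast
  qed
  have main: "eqn (concat ws) \<in> N"
    if "\<forall>w\<in>set ws. unit_word hs w \<and> length w \<le> L \<and> val w \<in> B" "val (concat ws) = \<one>" for ws
    using that
  proof (induction "length ws" arbitrary: ws rule: less_induct)
    case less
    have unit: "unit_word hs (concat vs)" if "set vs \<subseteq> set ws" for vs
      using that less.prems(1) by (induction vs) auto
    have prod: "foldr (\<otimes>) (map val vs) \<one> = val (concat vs)" if "set vs \<subseteq> set ws" for vs
      using that
    proof (induction vs)
      case (Cons v vs)
      have "unit_word hs (concat vs)" "unit_word hs v" using unit[of vs] unit[of "[v]"] Cons.prems by auto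
      then show ?case using Cons by (simp add: word_value_append valid_if_unit)
    qed simp
    consider "ws = []" | w where "ws = [w]" | "2 \<le> length ws"
      by (cases ws; cases "tl ws") auto
    then show ?case
    proof cases
      case 1
      then show ?thesis using one by simp
    next
      case 2
      then have w: "unit_word hs w" "length w \<le> 3 * L" "val w = \<one>" using less.prems by auto
      from relator[OF E.one_closed this] show ?thesis
        using w(1) 2 by (simp add: valid_if_unit)
    next
      case 3
      have "set (map val ws) \<subseteq> B" "2 \<le> length (map val ws)" "foldr (\<otimes>) (map val ws) \<one> = \<one>"
        using less.prems 3 prod[of ws] by auto
      from merge[OF this] obtain as a b bs where ab: "map val ws = as @ [a, b] @ bs" "a \<otimes> b \<in> B" by blast
      then obtain us u v vs where ws: "ws = us @ [u, v] @ vs" "val u = a" "val v = b"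
        by (auto simp: map_eq_append_conv map_eq_Cons_conv)
      have units: "unit_word hs (concat us)" "unit_word hs u" "unit_word hs v" "unit_word hs (concat vs)"
        using unit[of us] unit[of vs] less.prems ws by auto
      note valids = units[THEN valid_if_unit]
      \<comment> \<open>The value of \<open>u v\<close> lies in \<open>T (2 * L)\<close>, hence in \<open>T L\<close>: this yields the block \<open>x\<close>.\<close>
      have "length (u @ v) \<le> 2 * L" using less.prems ws by auto
      moreover have "val (u @ v) = a \<otimes> b" using ws valids by (simp add: word_value_append)
      ultimately have "a \<otimes> b \<in> T (2 * L)" using ab(2) units unfolding T_def
        by (auto intro!: exI[of _ "u @ v"])
      then obtain x where x: "unit_word hs x" "length x \<le> L" "val x = a \<otimes> b"
        unfolding L(3) by (auto simp: T_def)
      note vx = valid_if_unit[OF x(1)]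
      have ix: "valid_eqn_word hs (inv_word x)" using x(1) valid_if_unit[of "inv_word x"] by simp
      let ?r = "u @ v @ inv_word x"
      have r: "unit_word hs ?r" "length ?r \<le> 3 * L"
        using units x less.prems(1) ws(1) by auto
      have ab_in: "a \<in> carrier G" "b \<in> carrier G" using ws valids word_value_in by auto
      have "val ?r = \<one>"
        using valids ix vx ws x(3) ab_in by (simp add: word_value_append word_value_inv m_assoc[symmetric])
      from relator[OF eqn_of_word_in[OF valids(1)] r this]
      have 1: "eqn (concat us) \<otimes>\<^bsub>E\<^esub> eqn ?r \<otimes>\<^bsub>E\<^esub> inv\<^bsub>E\<^esub> eqn (concat us) \<in> N" .
      have "val (concat (us @ [x] @ vs)) = val (concat ws)"
        using valids vx ws x(3) ab_in word_value_in[OF valids(1)] word_value_in[OF valids(4)]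
        by (simp add: word_value_append m_assoc)
      then have 2: "eqn (concat (us @ [x] @ vs)) \<in> N"
        by (intro less.hyps) (use ws x ab less.prems in auto)
      \<comment> \<open>With \<open>p = us\<close>, \<open>q = vs\<close>: the identity \<open>p u v q = p (u v x\<^sup>-\<^sup>1) p\<^sup>-\<^sup>1 p x q\<close>.\<close>
      have "eqn (concat ws) = (eqn (concat us) \<otimes>\<^bsub>E\<^esub> eqn ?r \<otimes>\<^bsub>E\<^esub> inv\<^bsub>E\<^esub> eqn (concat us))
          \<otimes>\<^bsub>E\<^esub> eqn (concat (us @ [x] @ vs))"
      proof -
        define p y z q where "p = eqn (concat us)" and "y = eqn (u @ v)" and "z = eqn x" and "q = eqn (concat vs)"
        have in_E: "p \<in> carrier E" "y \<in> carrier E" "z \<in> carrier E" "q \<in> carrier E"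
          using valids vx by (simp_all add: p_def y_def z_def q_def)
        have iz: "eqn (inv_word x) = inv\<^bsub>E\<^esub> z"
          using vx by (simp add: z_def eqn_of_word_inv)
        have "eqn ?r = y \<otimes>\<^bsub>E\<^esub> inv\<^bsub>E\<^esub> z"
          using eqn_of_word_append[of "u @ v" "inv_word x"] valids ix by (simp add: y_def iz)
        moreover have "eqn (concat (us @ [x] @ vs)) = p \<otimes>\<^bsub>E\<^esub> (z \<otimes>\<^bsub>E\<^esub> q)"
          using valids vx by (simp add: p_def z_def q_def eqn_of_word_append)
        moreover have "eqn (concat ws) = p \<otimes>\<^bsub>E\<^esub> (y \<otimes>\<^bsub>E\<^esub> q)"
          using valids by (simp add: ws(1) p_def y_def q_def eqn_of_word_append E.m_assoc)
        moreover have "(p \<otimes>\<^bsub>E\<^esub> (y \<otimes>\<^bsub>E\<^esub> inv\<^bsub>E\<^esub> z) \<otimes>\<^bsub>E\<^esub> inv\<^bsub>E\<^esub> p) \<otimes>\<^bsub>E\<^esub> (p \<otimes>\<^bsub>E\<^esub> (z \<otimes>\<^bsub>E\<^esub> q)) = p \<otimes>\<^bsub>E\<^esub> (y \<otimes>\<^bsub>E\<^esub> q)"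
          using in_E by (simp add: E.m_assoc E.inv_solve_left')
        ultimately show ?thesis by (simp add: p_def)
      qed
      then show ?thesis using mult[OF 1 2] by simp
    qed
  qed
  show ?thesis
  proof
    fix X assume "X \<in> equation_ideal G H g"
    then have X: "X \<in> carrier E" "eval_eq G g X = \<one>" by (auto simp: equation_ideal_def kernel_def)
    obtain w where w: "unit_word hs w" "X = eqn w" using unit_word_exists[OF X(1)] by blast
    have "val w = \<one>" using X(2) w eval_eqn_of_word valid_if_unit by simp
    moreover have "concat (map (\<lambda>l. [l]) w) = w" by (induction w) auto
    moreover have "\<forall>v\<in>set (map (\<lambda>l. [l]) w). unit_word hs v \<and> length v \<le> L \<and> val v \<in> B"
    proof
      fix v assume "v \<in> set (map (\<lambda>l. [l]) w)"
      then obtain j k where v: "v = [(j, k)]" "(j, k) \<in> set w" by auto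
      then have "j \<le> length hs" "k = 1 \<or> k = -1" using w(1) by (auto simp: unit_word_def valid_eqn_word_def)
      then show "unit_word hs v \<and> length v \<le> L \<and> val v \<in> B"
        using v gens[of j] L(1) letter_value_in[of j k] by auto
    qed
    ultimately show "X \<in> normal_closure E (eqn ` R)"
      using main[of "map (\<lambda>l. [l]) w"] w(2) unfolding N_def by simp
  qed
qed

end


section \<open>The algorithm\<close>

definition computable_mat :: "(nat \<Rightarrow> int^2^2) \<Rightarrow> bool"
  where "computable_mat f \<longleftrightarrow> (\<forall>i j. computable_int (\<lambda>n. f n $ i $ j))"

lemma computable_mat_entry [comp_intros]: "computable_mat f \<Longrightarrow> computable_int (\<lambda>n. f n $ i $ j)"
  unfolding computable_mat_def by blast

lemma computable_mat_const [comp_intros]: "computable_mat (\<lambda>n. A)"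
  unfolding computable_mat_def by (intro allI comp_intros)

lemma computable_mat_mult [comp_intros]:
  "computable_mat f \<Longrightarrow> computable_mat g \<Longrightarrow> computable_mat (\<lambda>n. f n ** g n)"
  unfolding computable_mat_def[of "\<lambda>n. f n ** g n"] mat2_mult_nth by (intro allI comp_intros)

lemma computable_mat2 [comp_intros]:
  assumes "computable_int a" "computable_int b" "computable_int c" "computable_int d"
  shows "computable_mat (\<lambda>n. mat2 (a n) (b n) (c n) (d n))"
  unfolding computable_mat_def forall_2 mat2_nth using assms by blast

lemma computable_mat2_inv [comp_intros]: "computable_mat f \<Longrightarrow> computable_mat (\<lambda>n. mat2_inv (f n))"
  unfolding mat2_inv_def det_2 by (intro comp_intros)

lemma computable_mat_if [comp_intros]:
  assumes "decidable P" "computable_mat f" "computable_mat g"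
  shows "computable_mat (\<lambda>n. if P n then f n else g n)"
proof -
  have "(if P n then f n else g n) $ i $ j = (if P n then f n $ i $ j else g n $ i $ j)" for n i j
    by simp
  then show ?thesis unfolding computable_mat_def by (simp only:) (intro allI comp_intros assms)
qed

lemma computable_matrix_code [comp_intros]:
  "computable_mat f \<Longrightarrow> computable (\<lambda>n. matrix_code (f n))"
  unfolding matrix_code_def list_encode.simps by (intro comp_intros)

lemma decidable_mat_mem [comp_intros]:
  assumes "finite Z" "computable_mat f"
  shows "decidable (\<lambda>n. f n \<in> Z)"
  using assms(1)
proof induction
  case empty
  show ?case using decidable_not[OF decidable_eq[OF computable_const[of 0] computable_const[of 0]]] by simp
next
  case (insert A Z)
  have "decidable (\<lambda>n. f n = A)"
    unfolding mat2_eq_iff by (intro comp_intros assms)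
  then show ?case using insert.IH unfolding insert_iff by (rule decidable_disj)
qed

definition mat_decode :: "nat \<Rightarrow> int^2^2"
  where "mat_decode c = mat2 (int_decode (lhd c)) (int_decode (lhd (ltl c)))
    (int_decode (lhd (ltl (ltl c)))) (int_decode (lhd (ltl (ltl (ltl c)))))"

lemma mat_decode_matrix_code [simp]: "mat_decode (matrix_code A) = A"
  by (simp add: mat_decode_def matrix_code_def mat2_eq_iff)

lemma computable_mat_decode [comp_intros]: "computable a \<Longrightarrow> computable_mat (\<lambda>n. mat_decode (a n))"
  unfolding mat_decode_def by (intro comp_intros)

lemma computable_mat_foldr:
  assumes i: "computable_mat i" and m: "computable m"
    and h: "computable_mat (\<lambda>p. h (pfst p) (psnd (psnd p)) (mat_decode (pfst (psnd p))))"
  shows "computable_mat (\<lambda>n. foldr (\<lambda>x A. h n x A) (list_decode (m n)) (i n))"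
proof -
  have "computable_mat (\<lambda>n. mat_decode (foldr (\<lambda>x s. matrix_code (h n x (mat_decode s)))
      (list_decode (m n)) (matrix_code (i n))))"
    by (intro computable_mat_decode computable_foldr computable_matrix_code i m h)
  moreover have "foldr (\<lambda>x s. matrix_code (h n x (mat_decode s))) xs (matrix_code A)
      = matrix_code (foldr (\<lambda>x A. h n x A) xs A)" for n xs A
    by (induction xs) auto
  ultimately show ?thesis by simp
qed

text \<open>
  The functions below work on codes: \<open>n\<close> is the code of an input, \<open>l\<close> that of a letter, \<open>m\<close> that of
  a word. The letter number 0 is the variable, whose value \<open>g\<close> is the second component of the
  input.
\<close>

definition input_gen :: "nat \<Rightarrow> nat \<Rightarrow> int^2^2"
  where "input_gen n j = mat_decode (if j = 0 then psnd n else lhd (ldrop (j - 1) (pfst n)))"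

definition input_letter :: "nat \<Rightarrow> nat \<Rightarrow> int^2^2"
  where "input_letter n l = (if psnd l = int_encode 1 then input_gen n (pfst l) else mat2_inv (input_gen n (pfst l)))"

text \<open>
  Dropping \<open>i\<close> elements of a list leaves a non-empty list iff the list has an element number \<open>i\<close>.
\<close>

definition valid_letter :: "nat \<Rightarrow> nat \<Rightarrow> bool"
  where "valid_letter n l \<longleftrightarrow> (psnd l = int_encode 1 \<or> psnd l = int_encode (-1)) \<and>
    (pfst l = 0 \<or> ldrop (pfst l - 1) (pfst n) \<noteq> 0)"

definition word_matrix :: "nat \<Rightarrow> nat \<Rightarrow> int^2^2"
  where "word_matrix n m = foldr (\<lambda>l A. input_letter n l ** A) (list_decode m) (mat 1)"

fun syllable_code :: "int^2^2 + int \<Rightarrow> nat"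
where
  "syllable_code (Inl A) = prod_encode (0, matrix_code A)"
| "syllable_code (Inr k) = prod_encode (1, int_encode k)"

definition stack_code :: "(int^2^2 + int) list \<Rightarrow> nat"
  where "stack_code s = list_encode (map syllable_code s)"

text \<open>
  The stack machine on matrices; \<open>Z\<close> is the set of the matrices that represent the neutral
  element.
\<close>

definition mat_push :: "(int^2^2) set \<Rightarrow> int^2^2 + int \<Rightarrow> (int^2^2 + int) list \<Rightarrow> (int^2^2 + int) list"
  where "mat_push Z c s = (case c of
    Inl A \<Rightarrow> push_l (**) (\<lambda>X. X \<in> Z) A s | Inr k \<Rightarrow> push_r (+) (\<lambda>x. x = 0) k s)"

text \<open>
  The function \<open>mat_push\<close> on codes. A syllable is coded as a pair whose first component tells the
  factor of the free product to which it belongs.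
\<close>

definition code_push :: "(int^2^2) set \<Rightarrow> nat \<Rightarrow> nat \<Rightarrow> nat"
  where "code_push Z c s =
    (if pfst c = 0 then
       let top = (s \<noteq> 0 \<and> pfst (lhd s) = 0); r = (if top then ltl s else s);
           A = (if top then mat_decode (psnd c) ** mat_decode (psnd (lhd s)) else mat_decode (psnd c))
       in if A \<in> Z then r else Suc (prod_encode (prod_encode (0, matrix_code A), r))
     else
       let top = (s \<noteq> 0 \<and> pfst (lhd s) \<noteq> 0); r = (if top then ltl s else s);
           k = (if top then int_decode (psnd c) + int_decode (psnd (lhd s)) else int_decode (psnd c))
       in if k = 0 then r else Suc (prod_encode (prod_encode (1, int_encode k), r)))"

lemma code_push: "code_push Z (syllable_code c) (stack_code s) = stack_code (mat_push Z c s)"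
  by (cases c; cases s rule: syllables_cases)
    (auto simp: code_push_def mat_push_def stack_code_def Let_def)

lemma computable_code_push [comp_intros]:
  assumes "finite Z" "computable a" "computable b"
  shows "computable (\<lambda>n. code_push Z (a n) (b n))"
  unfolding code_push_def Let_def by (intro comp_intros assms)

definition input_syllable :: "nat \<Rightarrow> nat \<Rightarrow> nat"
  where "input_syllable n l =
    (if pfst l = 0 then prod_encode (1, psnd l) else prod_encode (0, matrix_code (input_letter n l)))"

definition word_stack :: "(int^2^2) set \<Rightarrow> nat \<Rightarrow> nat \<Rightarrow> nat"
  where "word_stack Z n m = foldr (\<lambda>l s. code_push Z (input_syllable n l) s) (list_decode m) 0"

definition relator_code :: "(int^2^2) set \<Rightarrow> nat \<Rightarrow> nat \<Rightarrow> bool"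
  where "relator_code Z n m \<longleftrightarrow>
    (\<forall>l\<in>set (list_decode m). valid_letter n l) \<and> word_matrix n m \<in> Z \<and> word_stack Z n m \<noteq> 0"

lemma computable_input_letter [comp_intros]:
  "computable a \<Longrightarrow> computable b \<Longrightarrow> computable_mat (\<lambda>n. input_letter (a n) (b n))"
  unfolding input_letter_def input_gen_def by (intro comp_intros)

lemma computable_input_syllable [comp_intros]:
  "computable a \<Longrightarrow> computable b \<Longrightarrow> computable (\<lambda>n. input_syllable (a n) (b n))"
  unfolding input_syllable_def by (intro comp_intros)

lemma decidable_valid_letter [comp_intros]:
  "computable a \<Longrightarrow> computable b \<Longrightarrow> decidable (\<lambda>n. valid_letter (a n) (b n))"
  unfolding valid_letter_def by (intro comp_intros)

lemma decidable_relator_code: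
  assumes "finite Z" "computable a" "computable b"
  shows "decidable (\<lambda>n. relator_code Z (a n) (b n))"
  unfolding relator_code_def word_matrix_def word_stack_def
  by (intro comp_intros decidable_list_all computable_mat_foldr computable_foldr
      computable_compose[OF assms(2)] assms)

text \<open>
  The entries of the input matrices are bounded by the input code \<open>n\<close>, so these matrices lie in the
  ball of radius \<open>18 * n\<^sup>2\<close> (\<open>in_gl_ball\<close>). The fourth power of \<open>c\<close> bounds the size of this
  ball (\<open>card_gl_ball\<close>).
\<close>

definition length_bound :: "nat \<Rightarrow> nat"
  where "length_bound n = (let c = 4 * 3 ^ Suc (18 * (n * n)) + 1 in 3 * 2 ^ (c * c * c * c))"

text \<open>
  A list of length \<open>L\<close> over letter codes below some bound has at most the code obtained by repeating
  the bound \<open>L\<close> times. The largest exponent code that occurs is that of 1, which exceeds that of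
  \<open>-1\<close>.
\<close>

definition code_bound :: "nat \<Rightarrow> nat"
  where "code_bound n =
    Suc (rec_nat 0 (\<lambda>k r. Suc (prod_encode (prod_encode (n, int_encode 1), r))) (length_bound n))"

definition relator_list :: "(int^2^2) set \<Rightarrow> nat \<Rightarrow> nat"
  where "relator_list Z n =
    rec_nat 0 (\<lambda>m r. if relator_code Z n m then Suc (prod_encode (m, r)) else r) (code_bound n)"

text \<open>
  A list of relators is empty iff its code is 0; a non-empty list is shifted by one because 0 is
  the negative answer.
\<close>

definition algebraicity :: "(int^2^2) set \<Rightarrow> nat \<Rightarrow> nat"
  where "algebraicity Z n = (if relator_list Z n = 0 then 0 else Suc (relator_list Z n))"

lemma computable_algebraicity:
  assumes "finite Z"
  shows "computable (algebraicity Z)"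
proof -
  have "computable (\<lambda>n. relator_list Z n)"
    unfolding relator_list_def code_bound_def length_bound_def Let_def
    by (intro comp_intros computable_rec_nat decidable_relator_code assms)
  then have "computable (\<lambda>n. if relator_list Z n = 0 then 0 else Suc (relator_list Z n))"
    by (intro comp_intros)
  then show ?thesis unfolding algebraicity_def[abs_def] .
qed

lemma relator_list_eq:
  "relator_list Z n = list_encode (filter (relator_code Z n) (rev [0..<code_bound n]))"
proof -
  have "rec_nat 0 (\<lambda>m r. if relator_code Z n m then Suc (prod_encode (m, r)) else r) b
      = list_encode (filter (relator_code Z n) (rev [0..<b]))" for b
    by (induction b) auto
  then show ?thesis by (simp add: relator_list_def)
qed

lemma prod_encode_mono: "a \<le> a' \<Longrightarrow> b \<le> b' \<Longrightarrow> prod_encode (a, b) \<le> prod_encode (a', b')"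
  using triangle_mono[of "a + b" "a' + b'"] by (simp add: prod_encode_def)

lemma mem_le_list_encode: "x \<in> set xs \<Longrightarrow> x \<le> list_encode xs"
proof (induction xs)
  case (Cons y xs)
  then show ?case
    using le_prod_encode_1[of y "list_encode xs"] le_prod_encode_2[of "list_encode xs" y] by auto
qed simp

lemma list_encode_le:
  assumes "\<forall>x\<in>set xs. x \<le> b" "length xs \<le> L"
  shows "list_encode xs \<le> rec_nat 0 (\<lambda>k r. Suc (prod_encode (b, r))) L"
  using assms
proof (induction L arbitrary: xs)
  case (Suc L)
  show ?case
  proof (cases xs)
    case (Cons y ys)
    then show ?thesis using Suc.IH[of ys] Suc.prems by (simp add: prod_encode_mono)
  qed simp
qed simp

lemma int_encode_ge: "\<bar>k\<bar> \<le> int (int_encode k)"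
  by (simp add: int_encode_def sum_encode_def)

lemma matrix_code_ge: "\<bar>A $ i $ j\<bar> \<le> int (matrix_code A)"
proof -
  have "int_encode (A $ i $ j) \<in> set [int_encode (A$1$1), int_encode (A$1$2), int_encode (A$2$1), int_encode (A$2$2)]"
    using exhaust_2[of i] exhaust_2[of j] by auto
  from mem_le_list_encode[OF this] show ?thesis
    using int_encode_ge[of "A $ i $ j"] unfolding matrix_code_def by linarith
qed


section \<open>Correctness of the algorithm\<close>

definition letter_code :: "nat \<times> int \<Rightarrow> nat"
  where "letter_code l = (case l of (j, k) \<Rightarrow> prod_encode (j, int_encode k))"

definition word_decode :: "nat \<Rightarrow> eqn_word"
  where "word_decode m = map (\<lambda>l. (pfst l, int_decode (psnd l))) (list_decode m)"

lemma list_decode_eqn_word_code [simp]: "list_decode (eqn_word_code w) = map letter_code w"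
  by (simp add: eqn_word_code_def letter_code_def[abs_def])

lemma eqn_word_code_decode [simp]: "eqn_word_code (word_decode m) = m"
  by (simp add: eqn_word_code_def word_decode_def comp_def)

lemma word_decode_code [simp]: "word_decode (eqn_word_code w) = w"
  by (simp add: word_decode_def letter_code_def comp_def case_prod_beta)

definition mat_letter :: "(int^2^2) list \<Rightarrow> int^2^2 \<Rightarrow> nat \<times> int \<Rightarrow> int^2^2"
  where "mat_letter hs g l = (let A = (case fst l of 0 \<Rightarrow> g | Suc i \<Rightarrow> hs ! i) in
    if snd l = 1 then A else mat2_inv A)"

definition mat_syllable :: "(int^2^2) list \<Rightarrow> int^2^2 \<Rightarrow> nat \<times> int \<Rightarrow> int^2^2 + int"
  where "mat_syllable hs g l = (if fst l = 0 then Inr (snd l) else Inl (mat_letter hs g l))"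

lemma lhd_ldrop: "i < length xs \<Longrightarrow> lhd (ldrop i (list_encode xs)) = xs ! i"
proof -
  assume i: "i < length xs"
  define c where "c = ldrop i (list_encode xs)"
  have c: "list_decode c = xs ! i # drop (Suc i) xs"
    unfolding c_def list_decode_ldrop using Cons_nth_drop_Suc[OF i] by simp
  then have "c \<noteq> 0" by (metis list.distinct(1) list_decode_eq_Nil)
  from list_decode_nonzero[OF this] c show ?thesis by (simp add: c_def)
qed

lemma ldrop_eq_0: "ldrop i (list_encode xs) = 0 \<longleftrightarrow> length xs \<le> i"
  unfolding list_decode_eq_Nil[symmetric] list_decode_ldrop by simp

lemma input_letter_code:
  assumes "j \<le> length hs"
  shows "input_letter (input_code hs g) (letter_code (j, k)) = mat_letter hs g (j, k)"
  using assms lhd_ldrop[of "j - 1" "map matrix_code hs"]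
  by (cases j) (auto simp: input_letter_def input_gen_def input_code_def mat_letter_def letter_code_def
      int_encode_eq)

lemma valid_letter_code:
  "valid_letter (input_code hs g) (letter_code (j, k)) \<longleftrightarrow> j \<le> length hs \<and> (k = 1 \<or> k = -1)"
  using ldrop_eq_0[of "j - 1" "map matrix_code hs"]
  by (cases j) (auto simp: valid_letter_def input_code_def letter_code_def int_encode_eq)

lemma valid_letters_iff:
  "(\<forall>l\<in>set (list_decode (eqn_word_code w)). valid_letter (input_code hs g) l) \<longleftrightarrow> unit_word hs w"
  by (induction w) (auto simp: valid_letter_code)

lemma input_syllable_code:
  assumes "j \<le> length hs"
  shows "input_syllable (input_code hs g) (letter_code (j, k)) = syllable_code (mat_syllable hs g (j, k))"
  using input_letter_code[OF assms, of g k]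
  by (simp add: input_syllable_def mat_syllable_def letter_code_def)

lemma word_matrix_code:
  "unit_word hs w \<Longrightarrow> word_matrix (input_code hs g) (eqn_word_code w)
    = foldr (\<lambda>l A. mat_letter hs g l ** A) w (mat 1)"
  by (induction w) (auto simp: word_matrix_def input_letter_code)

lemma word_stack_code:
  "unit_word hs w \<Longrightarrow> word_stack Z (input_code hs g) (eqn_word_code w)
    = stack_code (foldr (mat_push Z) (map (mat_syllable hs g) w) [])"
proof (induction w)
  case Nil
  show ?case by (simp add: word_stack_def stack_code_def)
next
  case (Cons l w)
  then show ?case
    by (cases l) (auto simp: word_stack_def input_syllable_code code_push)
qed

lemma stack_code_eq_0: "stack_code s = 0 \<longleftrightarrow> s = []"
  by (cases s) (simp_all add: stack_code_def)

lemma unit_word_map [simp]: "unit_word (map f hs) w \<longleftrightarrow> unit_word hs w"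
  by (simp add: unit_word_def valid_eqn_word_def)

lemma eqn_word_code_less_bound:
  assumes "unit_word hs w" "length w \<le> length_bound (input_code hs g)"
  shows "eqn_word_code w < code_bound (input_code hs g)"
proof -
  let ?n = "input_code hs g"
  have "length hs \<le> list_encode (map matrix_code hs)"
    using length_list_decode_le[of "list_encode (map matrix_code hs)"] by simp
  then have n: "length hs \<le> ?n"
    unfolding input_code_def using le_prod_encode_1 le_trans by blast
  have "list_encode (map letter_code w)
      \<le> rec_nat 0 (\<lambda>k r. Suc (prod_encode (prod_encode (?n, int_encode 1), r))) (length_bound ?n)"
  proof (rule list_encode_le)
    show "\<forall>x\<in>set (map letter_code w). x \<le> prod_encode (?n, int_encode 1)"
    proof
      fix x assume "x \<in> set (map letter_code w)"
      then obtain j k where x: "x = prod_encode (j, int_encode k)" "(j, k) \<in> set w"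
        by (auto simp: letter_code_def)
      with assms(1) have "j \<le> length hs" "k = 1 \<or> k = -1" by (auto simp: unit_word_def valid_eqn_word_def)
      then have "j \<le> ?n" "int_encode k \<le> int_encode 1" using n by (auto simp: int_encode_def sum_encode_def)
      then show "x \<le> prod_encode (?n, int_encode 1)" unfolding x(1) by (rule prod_encode_mono)
    qed
  qed (use assms in simp)
  then show ?thesis by (simp add: code_bound_def eqn_word_code_def letter_code_def[abs_def])
qed

text \<open>
  The homomorphism \<open>\<pi>\<close> sends a matrix in \<open>M\<close> to the group element that it represents. The inclusion
  \<open>Z \<subseteq> {I, - I}\<close> ensures that the kernel of \<open>\<pi>\<close> acts trivially on the tree, so that a word
  which is trivial in \<open>G\<close> still describes a closed polygon.
\<close>

context
  fixes G :: "('a, 'm) monoid_scheme" (structure) and M Z :: "(int^2^2) set" and \<pi> :: "int^2^2 \<Rightarrow> 'a"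
    and hs :: "(int^2^2) list" and g :: "int^2^2"
  assumes G: "group G" and M: "subgroup M GL2Z"
    and \<pi>_in: "\<And>A. A \<in> M \<Longrightarrow> \<pi> A \<in> carrier G"
    and \<pi>_mult: "\<And>A B. A \<in> M \<Longrightarrow> B \<in> M \<Longrightarrow> \<pi> (A ** B) = \<pi> A \<otimes> \<pi> B"
    and \<pi>_ker: "\<And>A. A \<in> M \<Longrightarrow> \<pi> A = \<one> \<longleftrightarrow> A \<in> Z"
    and Z: "Z \<subseteq> {mat 1, - mat 1}"
    and hs: "set hs \<subseteq> M" and g: "g \<in> M"
begin

interpretation group G by (fact G)

private abbreviation "inp \<equiv> input_code hs g"
private abbreviation "hs' \<equiv> map \<pi> hs"
private abbreviation "HS \<equiv> generate G (set hs')"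
private abbreviation "ES \<equiv> equations G HS"
private abbreviation "HG \<equiv> G\<lparr>carrier := HS\<rparr>"

private lemma hs': "set hs' \<subseteq> carrier G" and g': "\<pi> g \<in> carrier G"
  using hs g \<pi>_in by auto

private lemma M_GL: "A \<in> M \<Longrightarrow> A \<in> carrier GL2Z"
  using subgroup.mem_carrier[OF M] by blast

private lemma M_mult: "A \<in> M \<Longrightarrow> B \<in> M \<Longrightarrow> A ** B \<in> M"
  using subgroup.m_closed[OF M, of A B] by simp

private lemma M_one: "mat 1 \<in> M"
  using subgroup.one_closed[OF M] by simp

private lemma M_inv: "A \<in> M \<Longrightarrow> mat2_inv A \<in> M"
  using subgroup.m_inv_closed[OF M, of A] GL2Z_inv M_GL by simp

private lemma \<pi>_one: "\<pi> (mat 1) = \<one>"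
proof -
  have "\<pi> (mat 1) \<otimes> \<pi> (mat 1) = \<pi> (mat 1)" using \<pi>_mult[OF M_one M_one] by simp
  then show ?thesis using \<pi>_in[OF M_one] by (metis l_cancel_one)
qed

private lemma \<pi>_inv: "A \<in> M \<Longrightarrow> \<pi> (mat2_inv A) = inv \<pi> A"
  using \<pi>_mult[of "mat2_inv A" A] M_inv \<pi>_in \<pi>_one mat2_inv(2)[OF M_GL] by (metis inv_equality)

private lemma mat_letter_in: "j \<le> length hs \<Longrightarrow> mat_letter hs g (j, k) \<in> M"
  using hs g M_inv nth_mem[of "j - 1" hs] by (cases j) (auto simp: mat_letter_def Let_def subset_iff)

private lemma letter_value_eq:
  assumes "j \<le> length hs" "k = 1 \<or> k = -1"
  shows "letter_value G hs' (\<pi> g) (j, k) = \<pi> (mat_letter hs g (j, k))"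
proof (cases j)
  case 0
  then show ?thesis using assms(2) g \<pi>_in \<pi>_inv by (auto simp: mat_letter_def int_pow_neg)
next
  case (Suc i)
  then have "hs ! i \<in> M" "i < length hs" using assms(1) hs by auto
  then show ?thesis using assms(2) Suc \<pi>_in \<pi>_inv by (auto simp: mat_letter_def int_pow_neg)
qed

private lemma word_matrix_value:
  "unit_word hs w \<Longrightarrow> word_matrix inp (eqn_word_code w) \<in> M
    \<and> \<pi> (word_matrix inp (eqn_word_code w)) = word_value G hs' (\<pi> g) w"
proof (induction w)
  case Nil
  show ?case using M_one \<pi>_one by (simp add: word_matrix_def)
next
  case (Cons l w)
  obtain j k where l: "l = (j, k)" by (cases l)
  have w: "unit_word hs w" "j \<le> length hs" "k = 1 \<or> k = -1" using Cons.prems l by auto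
  have "word_matrix inp (eqn_word_code (l # w)) = mat_letter hs g l ** word_matrix inp (eqn_word_code w)"
    using word_matrix_code Cons.prems w(1) by simp
  then show ?case
    using Cons.IH[OF w(1)] mat_letter_in[OF w(2), of k] M_mult \<pi>_mult letter_value_eq[OF w(2,3)] l by simp
qed

private abbreviation "lift \<equiv> map_sum \<pi> (\<lambda>k :: int. k)"
private abbreviation "MW \<equiv> lists (M <+> (UNIV :: int set))"

private lemma lift_push:
  assumes "c \<in> M <+> UNIV" "s \<in> MW"
  shows "mat_push Z c s \<in> MW \<and> map lift (mat_push Z c s) = fp_push HG integer_group (lift c) (map lift s)"
  using assms
  by (cases c; cases s rule: syllables_cases)
    (auto simp: mat_push_def fp_push_def
      \<pi>_ker \<pi>_mult[symmetric] M_mult)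

private lemma lift_syllable:
  assumes "j \<le> length hs" "k = 1 \<or> k = -1"
  shows "mat_syllable hs g (j, k) \<in> M <+> UNIV" "lift (mat_syllable hs g (j, k)) = eqn_letter G hs' (j, k)"
  using letter_value_eq[OF assms] mat_letter_in[OF assms(1), of k]
  by (cases j; simp add: mat_syllable_def InlI InrI)+

private lemma lift_stack:
  "unit_word hs w \<Longrightarrow> foldr (mat_push Z) (map (mat_syllable hs g) w) [] \<in> MW
    \<and> map lift (foldr (mat_push Z) (map (mat_syllable hs g) w) [])
      = foldr (fp_push HG integer_group) (map (eqn_letter G hs') w) []"
proof (induction w)
  case (Cons l w)
  obtain j k where l: "l = (j, k)" by (cases l)
  have w: "unit_word hs w" "j \<le> length hs" "k = 1 \<or> k = -1" using Cons.prems l by auto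
  show ?case
    using lift_push[OF lift_syllable(1)[OF w(2,3)]] lift_syllable(2)[OF w(2,3)] Cons.IH[OF w(1)]
    by (simp add: l)
qed simp

private lemma word_stack_eq_0_iff:
  assumes "unit_word hs w"
  shows "word_stack Z inp (eqn_word_code w) = 0 \<longleftrightarrow> eqn_of_word G HS hs' w = \<one>\<^bsub>ES\<^esub>"
proof -
  have valid: "valid_eqn_word hs' w" using assms unfolding unit_word_map[of \<pi>, symmetric] unit_word_def by simp
  have HG: "group HG" by (rule subgroup_imp_group[OF generate_is_subgroup[OF hs']])
  have "eqn_of_word G HS hs' w = \<one>\<^bsub>ES\<^esub> \<longleftrightarrow> foldr (fp_push HG integer_group) (map (eqn_letter G hs') w) [] = []"
    unfolding eqn_word_trivial_iff[OF G hs' g' valid]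
    by (rule class_eq_one_iff[OF HG group_integer_group])
      (use eqn_letters_in[OF G hs' g' valid] in simp)
  also have "\<dots> \<longleftrightarrow> foldr (mat_push Z) (map (mat_syllable hs g) w) [] = []"
    using lift_stack[OF assms] by (metis Nil_is_map_conv)
  finally show ?thesis unfolding word_stack_code[OF assms] stack_code_eq_0 by simp
qed

text \<open>
  The codes that the algorithm keeps are those of the non-trivial relators: trivial ones contribute
  nothing to a normal closure, and a non-trivial one proves that \<open>\<pi> g\<close> is algebraic.
\<close>

private lemma relator_code_iff:
  "relator_code Z inp (eqn_word_code w) \<longleftrightarrow>
    unit_word hs w \<and> word_value G hs' (\<pi> g) w = \<one> \<and> eqn_of_word G HS hs' w \<noteq> \<one>\<^bsub>ES\<^esub>"
  unfolding relator_code_def valid_letters_iff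
  using word_matrix_value \<pi>_ker word_stack_eq_0_iff by metis

private definition "R = {w. relator_code Z inp (eqn_word_code w) \<and> eqn_word_code w < code_bound inp}"

private lemma letters_in_ball:
  assumes "j \<le> length hs"
  shows "mat_letter hs g (j, k) \<in> gl_ball (18 * inp ^ 2)"
proof -
  define A where "A = (case j of 0 \<Rightarrow> g | Suc i \<Rightarrow> hs ! i)"
  have "matrix_code A \<le> inp"
  proof (cases j)
    case 0
    then show ?thesis using le_prod_encode_2 by (simp add: A_def input_code_def)
  next
    case (Suc i)
    then have "matrix_code A \<in> set (map matrix_code hs)" using assms by (auto simp: A_def)
    from mem_le_list_encode[OF this] show ?thesis
      unfolding input_code_def using le_prod_encode_1 le_trans by blast
  qed
  then have A: "\<bar>A $ i $ j\<bar> \<le> int inp" for i j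
    using matrix_code_ge[of A i j] by linarith
  have GL: "A \<in> carrier GL2Z" using mat_letter_in[OF assms, of 1] M_GL by (simp add: mat_letter_def A_def)
  then have "det A = 1 \<or> det A = -1" by (simp add: GL2Z_iff)
  then have "\<forall>i j. \<bar>mat2_inv A $ i $ j\<bar> \<le> int inp" unfolding forall_2 mat2_inv_def using A by auto
  then show ?thesis
    using in_gl_ball[OF GL A] in_gl_ball[OF mat2_inv_in_GL2Z[OF GL], of inp]
    by (simp add: mat_letter_def A_def[symmetric] Let_def)
qed

text \<open>
  The image of the ball of matrices under \<open>\<pi>\<close> inherits the merging property, since words over it can
  be lifted letter by letter.
\<close>

private lemma ideal_generated: "equation_ideal G HS (\<pi> g) \<subseteq> normal_closure ES (eqn_of_word G HS hs' ` R)"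
proof (rule ideal_generated_by_short_relators[OF G hs' g'])
  let ?K = "gl_ball (18 * inp ^ 2)"
  let ?B = "\<pi> ` (?K \<inter> M)"
  show "finite ?B" using card_gl_ball(1) by blast
  show "letter_value G hs' (\<pi> g) (j, 1) \<in> ?B \<and> letter_value G hs' (\<pi> g) (j, -1) \<in> ?B"
    if "j \<le> length hs'" for j
    using that letter_value_eq letters_in_ball mat_letter_in by simp
  show "\<exists>us a b vs. ks = us @ [a, b] @ vs \<and> a \<otimes> b \<in> ?B"
    if ks: "set ks \<subseteq> ?B" "2 \<le> length ks" "foldr (\<otimes>) ks \<one> = \<one>" for ks
  proof -
    have "\<exists>As. ks = map \<pi> As \<and> set As \<subseteq> ?K \<inter> M"
      using ks(1)
    proof (induction ks)
      case (Cons k ks)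
      then obtain A As where "A \<in> ?K \<inter> M" "k = \<pi> A" "ks = map \<pi> As" "set As \<subseteq> ?K \<inter> M" by auto
      then show ?case by (intro exI[of _ "A # As"]) auto
    qed simp
    then obtain As where As: "ks = map \<pi> As" "set As \<subseteq> ?K" "set As \<subseteq> M" by blast
    have "mat_prod As \<in> M \<and> \<pi> (mat_prod As) = foldr (\<otimes>) (map \<pi> As) \<one>"
      using As(3) by (induction As) (auto simp: M_one \<pi>_one M_mult \<pi>_mult)
    then have "mat_prod As \<in> M" "\<pi> (mat_prod As) = \<one>" using ks(3) As(1) by auto
    then have "mat_prod As \<in> Z" using \<pi>_ker by blast
    then have "superbase (mat_prod As) = superbase (mat 1)"
      using Z by (auto simp: superbase_def Let_def)
    from gl_ball_merge[OF As(2) _ this] obtain us a b vs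
      where As_split: "As = us @ [a, b] @ vs" "a ** b \<in> ?K" using ks(2) As(1) by auto
    have ab: "a \<in> M" "b \<in> M" using As(3) As_split(1) by auto
    then have "\<pi> a \<otimes> \<pi> b \<in> ?B" using As_split(2) M_mult \<pi>_mult by (metis IntI imageI)
    then show ?thesis unfolding As(1) As_split(1)
      by (intro exI[of _ "map \<pi> us"] exI[of _ "\<pi> a"] exI[of _ "\<pi> b"] exI[of _ "map \<pi> vs"]) simp
  qed
  show "w \<in> R" if w: "unit_word hs' w" "length w \<le> 3 * 2 ^ card ?B" "word_value G hs' (\<pi> g) w = \<one>"
    "eqn_of_word G HS hs' w \<noteq> \<one>\<^bsub>ES\<^esub>" for w
  proof -
    have "card ?B \<le> card (?K \<inter> M)" using card_gl_ball(1) by (intro card_image_le) blast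
    also have "\<dots> \<le> card ?K" using card_gl_ball(1) by (intro card_mono) auto
    also have "\<dots> \<le> (4 * 3 ^ Suc (18 * inp ^ 2) + 1) ^ 4" by (rule card_gl_ball)
    finally have "(2 :: nat) ^ card ?B \<le> 2 ^ ((4 * 3 ^ Suc (18 * inp ^ 2) + 1) ^ 4)"
      by (rule power_increasing) simp
    then have "3 * 2 ^ card ?B \<le> length_bound inp"
      unfolding length_bound_def Let_def power4_eq_xxxx power2_eq_square[symmetric]
      by (simp only: power2_eq_square mult_le_mono2)
    then have "eqn_word_code w < code_bound inp"
      using w(1,2) by (intro eqn_word_code_less_bound) auto
    then show ?thesis unfolding R_def using relator_code_iff w by simp
  qed
qed

text \<open>
  If no non-trivial relator is found, the ideal is contained in the normal closure of the empty
  set and is trivial.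
\<close>

theorem algebraicity_correct: "correct_output G hs' (\<pi> g) (algebraicity Z inp)"
proof -
  define ws where "ws = map word_decode (filter (relator_code Z inp) (rev [0..<code_bound inp]))"
  have list: "relator_list Z inp = list_encode (map eqn_word_code ws)"
    by (simp add: relator_list_eq ws_def comp_def)
  have set: "set ws = R"
  proof
    show "R \<subseteq> set ws" unfolding R_def ws_def by (auto intro!: image_eqI[of _ word_decode])
  qed (auto simp: R_def ws_def)
  have rel: "unit_word hs w" "eqn_of_word G HS hs' w \<in> equation_ideal G HS (\<pi> g)"
      "eqn_of_word G HS hs' w \<noteq> \<one>\<^bsub>ES\<^esub>" if "w \<in> R" for w
  proof -
    have w: "unit_word hs w" "word_value G hs' (\<pi> g) w = \<one>" "eqn_of_word G HS hs' w \<noteq> \<one>\<^bsub>ES\<^esub>"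
      using that relator_code_iff unfolding R_def by auto
    then have "valid_eqn_word hs' w" unfolding unit_word_map[of \<pi>, symmetric] unit_word_def by simp
    then have "eqn_of_word G HS hs' w \<in> equation_ideal G HS (\<pi> g)"
      using w(2) eqn_of_word_in[OF G hs' g'] eval_eqn_of_word[OF G hs' g']
      unfolding equation_ideal_def kernel_def by simp
    with w show "unit_word hs w" "eqn_of_word G HS hs' w \<in> equation_ideal G HS (\<pi> g)"
      "eqn_of_word G HS hs' w \<noteq> \<one>\<^bsub>ES\<^esub>" by auto
  qed
  have alg: "algebraic_over G HS (\<pi> g) \<longleftrightarrow> ws \<noteq> []"
  proof
    assume "algebraic_over G HS (\<pi> g)"
    then obtain X where X: "X \<in> equation_ideal G HS (\<pi> g)" "X \<noteq> \<one>\<^bsub>ES\<^esub>"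
      unfolding algebraic_over_def equation_ideal_def kernel_def by blast
    show "ws \<noteq> []"
    proof
      assume "ws = []"
      then have "R = {}" using set by simp
      then have "normal_closure ES (eqn_of_word G HS hs' ` R) = generate ES {}"
        unfolding normal_closure_def by simp
      also have "\<dots> = {\<one>\<^bsub>ES\<^esub>}"
        using group.generate_empty[OF equations_group[OF G generate_is_subgroup[OF hs'] g']] .
      finally show False using ideal_generated X by blast
    qed
  next
    assume "ws \<noteq> []"
    then obtain w where "w \<in> R" using set by (cases ws) auto
    from rel[OF this] show "algebraic_over G HS (\<pi> g)"
      unfolding algebraic_over_def equation_ideal_def kernel_def by blast
  qed
  have "relator_list Z inp = 0 \<longleftrightarrow> ws = []" unfolding list by (cases ws) auto
  moreover have "valid_eqn_word hs' w" if "w \<in> R" for w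
    using rel(1)[OF that] unfolding unit_word_map[of \<pi>, symmetric] unit_word_def by simp
  ultimately show ?thesis
    unfolding correct_output_def Let_def
    using alg rel ideal_generated list by (auto simp: algebraicity_def set[symmetric])
qed

end

lemma algebraicity_algorithm_matrix_group:
  assumes "group G" "subgroup M GL2Z" "\<And>A. A \<in> M \<Longrightarrow> \<pi> A \<in> carrier G"
    and "\<And>A B. A \<in> M \<Longrightarrow> B \<in> M \<Longrightarrow> \<pi> (A ** B) = \<pi> A \<otimes>\<^bsub>G\<^esub> \<pi> B"
    and "\<And>A. A \<in> M \<Longrightarrow> \<pi> A = \<one>\<^bsub>G\<^esub> \<longleftrightarrow> A \<in> Z"
    and Z: "Z \<subseteq> {mat 1, - mat 1}"
  shows "algebraicity_algorithm G M \<pi> (algebraicity Z)"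
  unfolding algebraicity_algorithm_def
  using computable_algebraicity[OF finite_subset[OF Z]] algebraicity_correct[OF assms] by auto

lemma algebraicity_algorithm_mod_pm_one:
  assumes N: "{mat 1, - mat 1} \<lhd> K" and K: "K = GL2Z\<lparr>carrier := carrier K\<rparr>" "subgroup (carrier K) GL2Z"
  shows "algebraicity_algorithm (K Mod {mat 1, - mat 1}) (carrier K)
    (\<lambda>A. {mat 1, - mat 1} #>\<^bsub>K\<^esub> A) (algebraicity {mat 1, - mat 1})"
proof (rule algebraicity_algorithm_matrix_group)
  interpret N: normal "{mat 1, - mat 1}" K by (fact N)
  have mult: "A \<otimes>\<^bsub>K\<^esub> B = A ** B" for A B by (subst K(1)) simp
  show "group (K Mod {mat 1, - mat 1})" by (rule N.factorgroup_is_group)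
  show "subgroup (carrier K) GL2Z" by (fact K)
  show "{mat 1, - mat 1} #>\<^bsub>K\<^esub> A \<in> carrier (K Mod {mat 1, - mat 1})" if "A \<in> carrier K" for A
    using that by (auto simp: FactGroup_def RCOSETS_def)
  show "{mat 1, - mat 1} #>\<^bsub>K\<^esub> (A ** B)
      = ({mat 1, - mat 1} #>\<^bsub>K\<^esub> A) \<otimes>\<^bsub>K Mod {mat 1, - mat 1}\<^esub> ({mat 1, - mat 1} #>\<^bsub>K\<^esub> B)"
    if "A \<in> carrier K" "B \<in> carrier K" for A B
    using N.rcos_sum[OF that] by (simp add: FactGroup_def mult)
  show "{mat 1, - mat 1} #>\<^bsub>K\<^esub> A = \<one>\<^bsub>K Mod {mat 1, - mat 1}\<^esub> \<longleftrightarrow> A \<in> {mat 1, - mat 1}"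
    if "A \<in> carrier K" for A
    using that N.rcos_const N.coset_join1 N.subgroup_axioms N.subset by (auto simp: FactGroup_def)
qed auto

theorem corollary4p2:
  shows "(\<exists>F. algebraicity_algorithm GL2Z (carrier GL2Z) (\<lambda>A. A) F) \<and>
         (\<exists>F. algebraicity_algorithm PGL2Z (carrier GL2Z)
                (\<lambda>A. {mat 1, - mat 1} #>\<^bsub>GL2Z\<^esub> A) F) \<and>
         (\<exists>F. algebraicity_algorithm SL2Z (carrier SL2Z) (\<lambda>A. A) F) \<and>
         (\<exists>F. algebraicity_algorithm PSL2Z (carrier SL2Z)
                (\<lambda>A. {mat 1, - mat 1} #>\<^bsub>SL2Z\<^esub> A) F)"
proof (intro conjI exI)
  have SL: "A \<otimes>\<^bsub>SL2Z\<^esub> B = A ** B" "\<one>\<^bsub>SL2Z\<^esub> = mat 1" for A B by (simp_all add: SL2Z_def)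
  have GL_sub: "subgroup (carrier GL2Z) GL2Z" by (rule group.subgroup_self[OF GL2Z_group])
  show "algebraicity_algorithm GL2Z (carrier GL2Z) (\<lambda>A. A) (algebraicity {mat 1})"
    by (rule algebraicity_algorithm_matrix_group[OF GL2Z_group GL_sub]) auto
  show "algebraicity_algorithm SL2Z (carrier SL2Z) (\<lambda>A. A) (algebraicity {mat 1})"
    by (rule algebraicity_algorithm_matrix_group[OF SL2Z_group SL2Z_subgroup]) (auto simp: SL)
  show "algebraicity_algorithm PGL2Z (carrier GL2Z) (\<lambda>A. {mat 1, - mat 1} #>\<^bsub>GL2Z\<^esub> A)
      (algebraicity {mat 1, - mat 1})"
    unfolding PGL2Z_def by (rule algebraicity_algorithm_mod_pm_one[OF pm_one_normal(1) _ GL_sub]) simp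
  show "algebraicity_algorithm PSL2Z (carrier SL2Z) (\<lambda>A. {mat 1, - mat 1} #>\<^bsub>SL2Z\<^esub> A)
      (algebraicity {mat 1, - mat 1})"
    unfolding PSL2Z_def by (rule algebraicity_algorithm_mod_pm_one[OF pm_one_normal(2) SL2Z_eq SL2Z_subgroup])
qed

end
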